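(* Let $n$ and $k$ be integers for which there exists a connected graph with $n$ vertices and exactly $k$ cut vertices. Then, among all connected graphs with $n$ vertices and exactly $k$ cut vertices, the minimal distance spectral radius is obtained uniquely at $G_{n,k}$; that is, every connected graph $G$ with $n$ vertices and $k$ cut vertices satisfies $\Lambda_1(G)\geqslant\Lambda_1(G_{n,k})$, with equality only when $G\cong G_{n,k}$.
   Context: All graphs are finite, simple and connected. For a connected graph $H$ with vertex set $\{1,\ldots,n\}$, $\mathrm{dist}(i,j)$ is the number of edges of a shortest path from $i$ to $j$, and the distance matrix $D(H)$ is the $n\times n$ matrix with $(i,j)$-entry $\mathrm{dist}(i,j)$. The distance spectral radius $\Lambda_1(H)$ is the eigenvalue of $D(H)$ of largest magnitude. The graph $G_{n,k}$ is the $n$-vertex graph obtained from the complete graph $K_{n-k}$ by adding paths $P_{l_1+1},\ldots,P_{l_{n-k}+1}$ of almost equal lengths to its vertices: for each $i$, an end vertex of a path $P_{l_i+1}$ on $l_i+1$ vertices is identified with the $i$-th vertex of $K_{n-k}$ (so $l_i\geqslant 0$ new vertices are added there), where $l_1+\cdots+l_{n-k}=k$ and $|l_i-l_j|\leqslant 1$ for all $1\leqslant i,j\leqslant n-k$. This determines $G_{n,k}$ up to isomorphism. *)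

theory Defs
  imports
    "Graph_Theory.Graph_Theory"
    "Jordan_Normal_Form.Char_Poly"
    "HOL-Library.Countable_Set"
begin

text \<open>
  A finite simple graph is a \<^locale>\<open>pair_graph\<close>: a finite vertex set with a symmetric and
  irreflexive set of arcs, so that an edge is represented by its two orientations. The library's
  \<^const>\<open>connected\<close> requires the vertex set to be nonempty.
\<close>

text \<open>
  Deleting the vertex of \<open>K\<^sub>1\<close> leaves the empty graph, which is not \<^const>\<open>connected\<close> in the
  library's sense; the condition \<open>pverts G \<noteq> {v}\<close> keeps that vertex from being a cut vertex.
\<close>
definition cut_vertex :: "'a pair_pre_digraph \<Rightarrow> 'a \<Rightarrow> bool" where
  "cut_vertex G v \<longleftrightarrow>
     v \<in> pverts G \<and> pverts G \<noteq> {v} \<and> \<not> connected (pre_digraph.del_vert (with_proj G) v)"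

definition connected_graph_with_cut_vertices :: "nat \<Rightarrow> nat \<Rightarrow> 'a pair_pre_digraph \<Rightarrow> bool" where
  "connected_graph_with_cut_vertices n k G \<longleftrightarrow>
     pair_graph G \<and> connected (with_proj G) \<and>
     card (pverts G) = n \<and> card {v. cut_vertex G v} = k"

definition graph_dist :: "'a pair_pre_digraph \<Rightarrow> 'a \<Rightarrow> 'a \<Rightarrow> nat" where
  "graph_dist G u v = (LEAST d. \<exists>p. pre_digraph.apath (with_proj G) u p v \<and> length p = d)"

text \<open>
  The vertices are numbered \<open>0, \<dots>, n - 1\<close> by \<^term>\<open>from_nat_into (pverts G)\<close>, an arbitrary
  bijection from \<open>{..<n}\<close> onto the finite set of vertices. Another numbering conjugates the matrix
  by a permutation matrix and so does not change the eigenvalues.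
\<close>
definition distance_matrix :: "'a pair_pre_digraph \<Rightarrow> real mat" where
  "distance_matrix G =
     mat (card (pverts G)) (card (pverts G))
       (\<lambda>(i, j). real (graph_dist G (from_nat_into (pverts G) i) (from_nat_into (pverts G) j)))"

text \<open>
  The eigenvalue of largest magnitude. \<^const>\<open>Max\<close> only serves to choose the positive one
  when two eigenvalues of opposite sign share the largest magnitude, as for \<open>K\<^sub>2\<close>, whose distance
  matrix has the eigenvalues \<open>1\<close> and \<open>-1\<close>. Only real eigenvalues are considered since the distance
  matrix is real symmetric.
\<close>
definition distance_spectral_radius :: "'a pair_pre_digraph \<Rightarrow> real" where
  "distance_spectral_radius G =
     Max {x. eigenvalue (distance_matrix G) x \<and>
             (\<forall>y. eigenvalue (distance_matrix G) y \<longrightarrow> \<bar>y\<bar> \<le> \<bar>x\<bar>)}"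

text \<open>
  The complete graph on the \<open>m\<close> vertices \<open>(i, 0)\<close>, \<open>i < m\<close>, with the path
  \<open>(i, 0), (i, 1), \<dots>, (i, l i)\<close> on \<open>l i + 1\<close> vertices attached at \<open>(i, 0)\<close>.
\<close>
definition clique_with_paths :: "nat \<Rightarrow> (nat \<Rightarrow> nat) \<Rightarrow> (nat \<times> nat) pair_pre_digraph" where
  "clique_with_paths m l =
     \<lparr> pverts = {(i, j). i < m \<and> j \<le> l i},
       parcs = {((i, 0), (j, 0)) | i j. i < m \<and> j < m \<and> i \<noteq> j}
             \<union> {((i, j), (i, Suc j)) | i j. i < m \<and> j < l i}
             \<union> {((i, Suc j), (i, j)) | i j. i < m \<and> j < l i} \<rparr>"

text \<open>
  \<open>G\<^sub>n\<^sub>,\<^sub>k\<close> is \<^term>\<open>clique_with_paths (n - k) l\<close> for any \<open>l\<close> satisfying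
  \<open>almost_equal_lengths (n - k) k l\<close>.
\<close>
definition almost_equal_lengths :: "nat \<Rightarrow> nat \<Rightarrow> (nat \<Rightarrow> nat) \<Rightarrow> bool" where
  "almost_equal_lengths m k l \<longleftrightarrow>
     (\<Sum>i<m. l i) = k \<and> (\<forall>i<m. \<forall>j<m. \<bar>int (l i) - int (l j)\<bar> \<le> 1)"

lemma ex_almost_equal_lengths:
  assumes "0 < m"
  shows "\<exists>l. almost_equal_lengths m k l"
proof
  let ?l = "\<lambda>i. k div m + (if i < k mod m then 1 else 0)"
  have "{i. i < m \<and> i < k mod m} = {..<k mod m}"
    using mod_less_divisor[OF assms, of k] by auto
  hence "(\<Sum>i<m. if i < k mod m then 1 else 0::nat) = k mod m"
    by (simp add: sum.If_cases Int_def)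
  hence "(\<Sum>i<m. ?l i) = k"
    by (simp add: sum.distrib)
  thus "almost_equal_lengths m k ?l"
    by (simp add: almost_equal_lengths_def)
qed

end

theory Submission
  imports Defs "HOL-Analysis.Function_Topology"
begin

text \<open>
  In any connected graph \<open>dist(u, v) \<ge> 1 + s(u, v)\<close> for \<open>u \<noteq> v\<close>, where \<open>s(u, v)\<close> counts the cut
  vertices separating \<open>u\<close> from \<open>v\<close>, and equality holds in \<open>G\<^sub>n\<^sub>,\<^sub>k\<close>. Hence for a positive weight \<open>y\<close> on
  the vertices, up to terms depending only on the multiset of weights, the quadratic form
  \<open>y\<^sup>T D y\<close> is bounded below by the sum over the cut vertices \<open>c\<close> of the weights \<open>y u * y v\<close> of the
  pairs separated by \<open>c\<close>. Let \<open>x\<close> be the Perron vector of \<open>G\<^sub>n\<^sub>,\<^sub>k\<close>. It suffices to carry \<open>x\<close> over to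
  the given graph by a bijection under which every cut vertex separates at least as much weight as
  its image in \<open>G\<^sub>n\<^sub>,\<^sub>k\<close>, and then to compare Rayleigh quotients.

  To find the bijection, root the graph in the middle of a pair of vertices with the largest
  number of separators and split the cut vertices into chains, one for each non-cut vertex. The
  chains, sorted by length, are matched with the paths of \<open>G\<^sub>n\<^sub>,\<^sub>k\<close>, sorted in the same way, and the
  surplus of chains that are too long fills the paths that are too long. The eigenvalue
  equations of \<open>G\<^sub>n\<^sub>,\<^sub>k\<close> show that a whole branch outweighs every other branch without its root that
  is not longer, so both sides of each cut vertex are heavy enough. In the case of equality
  nothing is surplus, the separated pairs agree, and hence so do all distances.
\<close>

section \<open>The distance spectral radius as a maximum of the Rayleigh quotient\<close>

text \<open>The entries of the Perron vector differ and are not known explicitly, so counting the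
  vertices on the two sides of a cut vertex is not enough. A cut vertex \<open>c\<close> splits the
  remaining weight into A and B with A + B fixed, and the product A B is concave in A. If the tail
  beyond the image of \<open>c\<close> weighs s, it suffices that A and B are both at least s, or
  that the two splits agree. Hence a lower bound is needed on each side of \<open>c\<close>. The
  ends \<open>a\<close> and \<open>b\<close> with the most separators are singled out because their
  chains are long enough to fill their paths, so that the side of \<open>c\<close> away from its
  charged end covers a full path. The delicate case is a cut vertex charged to \<open>a\<close>
  whose image lies on a path longer than that of \<open>b\<close>. Then a third end on the far side
  supplies the missing weight; if there is no third end, nothing is surplus and the split is the one
  of the extremal graph.\<close>

definition qform :: "'v set \<Rightarrow> ('v \<Rightarrow> 'v \<Rightarrow> real) \<Rightarrow> ('v \<Rightarrow> real) \<Rightarrow> real" where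
  "qform V d x = (\<Sum>u\<in>V. \<Sum>v\<in>V. d u v * x u * x v)"

lemma qform_attains_max_on_sphere:
  fixes d :: "'v \<Rightarrow> 'v \<Rightarrow> real"
  assumes "finite V" "V \<noteq> {}"
  obtains x where "(\<Sum>v\<in>V. (x v)\<^sup>2) = 1"
    and "\<And>z. (\<Sum>v\<in>V. (z v)\<^sup>2) = 1 \<Longrightarrow> qform V d z \<le> qform V d x"
proof -
  \<comment> \<open>Functions on the whole type carry the product topology. With the coordinates
    outside \<open>V\<close> pinned to 0 the box is compact by Tychonoff, and truncation to
    \<open>V\<close> brings any \<open>z\<close> of norm 1 into it without changing the
    form.\<close>
  define B where "B = (\<lambda>v. if v \<in> V then {-1..1::real} else {0})"
  define K where "K = PiE UNIV B"
  have "compactin (product_topology (\<lambda>v::'v. euclidean :: real topology) UNIV) K"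
    unfolding K_def compactin_PiE by (auto simp: B_def)
  then have "compact K"
    unfolding euclidean_product_topology by simp
  moreover have "closed {f :: 'v \<Rightarrow> real. (\<Sum>v\<in>V. (f v)\<^sup>2) = 1}"
    by (intro closed_Collect_eq continuous_on_sum continuous_on_power continuous_on_const
        continuous_on_product_coordinates)
  ultimately have cpt: "compact (K \<inter> {f. (\<Sum>v\<in>V. (f v)\<^sup>2) = 1})"
    by (rule compact_Int_closed)
  obtain w where w: "w \<in> V" using assms by blast
  have "(\<lambda>v. if v = w then 1 else 0) \<in> K \<inter> {f. (\<Sum>v\<in>V. (f v)\<^sup>2) = 1}"
    using w assms by (auto simp: K_def B_def PiE_def if_distrib[of "\<lambda>t. t\<^sup>2"] cong: if_cong)
  then have ne: "K \<inter> {f. (\<Sum>v\<in>V. (f v)\<^sup>2) = 1} \<noteq> {}" by blast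
  have "continuous_on UNIV (qform V d)"
    unfolding qform_def
    by (intro continuous_on_sum continuous_on_mult continuous_on_const
        continuous_on_product_coordinates)
  then have "continuous_on (K \<inter> {f. (\<Sum>v\<in>V. (f v)\<^sup>2) = 1}) (qform V d)"
    using continuous_on_subset by blast
  from continuous_attains_sup[OF cpt ne this] obtain x where
    x: "x \<in> K \<inter> {f. (\<Sum>v\<in>V. (f v)\<^sup>2) = 1}"
    and mx: "\<forall>z\<in>K \<inter> {f. (\<Sum>v\<in>V. (f v)\<^sup>2) = 1}. qform V d z \<le> qform V d x" by blast
  show thesis
  proof (rule that[of x])
    show "(\<Sum>v\<in>V. (x v)\<^sup>2) = 1" using x by simp
    fix z :: "'v \<Rightarrow> real" assume z: "(\<Sum>v\<in>V. (z v)\<^sup>2) = 1"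
    define z' where "z' = (\<lambda>v. if v \<in> V then z v else 0)"
    have "\<bar>z v\<bar> \<le> 1" if "v \<in> V" for v
    proof -
      have "(z v)\<^sup>2 \<le> (\<Sum>v\<in>V. (z v)\<^sup>2)"
        using that assms by (intro member_le_sum) auto
      then show ?thesis using z by (simp add: abs_square_le_1)
    qed
    then have "z' \<in> K" by (force simp: K_def B_def z'_def abs_le_iff)
    moreover have "(\<Sum>v\<in>V. (z' v)\<^sup>2) = 1" using z by (simp add: z'_def)
    moreover have "qform V d z' = qform V d z"
      by (simp add: qform_def z'_def)
    ultimately show "qform V d z \<le> qform V d x"
      using mx by (metis (mono_tags, lifting) Int_iff mem_Collect_eq)
  qed
qed

lemma qform_le_of_sphere:
  assumes fin: "finite V"
    and mx: "\<And>z. (\<Sum>v\<in>V. (z v)\<^sup>2) = 1 \<Longrightarrow> qform V d z \<le> L"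
  shows "qform V d z \<le> L * (\<Sum>v\<in>V. (z v)\<^sup>2)"
proof (cases "(\<Sum>v\<in>V. (z v)\<^sup>2) = 0")
  case True
  then have "\<forall>v\<in>V. z v = 0" using fin by (simp add: sum_nonneg_eq_0_iff)
  then show ?thesis by (simp add: qform_def)
next
  case False
  define s where "s = (\<Sum>v\<in>V. (z v)\<^sup>2)"
  have s: "s > 0" using False by (simp add: s_def less_le sum_nonneg)
  define y where "y = (\<lambda>v. z v / sqrt s)"
  have "(\<Sum>v\<in>V. (y v)\<^sup>2) = s / s"
    unfolding y_def power_divide real_sqrt_pow2[OF less_imp_le[OF s]]
    by (simp add: s_def sum_divide_distrib[symmetric])
  then have "qform V d y \<le> L" using s by (intro mx) simp
  moreover have "qform V d y = qform V d z / s"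
  proof -
    have "sqrt s * sqrt s = s" using s by simp
    then show ?thesis
      by (simp add: qform_def y_def sum_divide_distrib divide_divide_eq_left)
  qed
  ultimately show ?thesis using s by (simp add: field_simps s_def)
qed

lemma qform_add_scaled:
  fixes d :: "'v \<Rightarrow> 'v \<Rightarrow> real"
  assumes sym: "\<And>u v. u \<in> V \<Longrightarrow> v \<in> V \<Longrightarrow> d u v = d v u"
  shows "qform V d (\<lambda>v. x v + t * w v) =
    qform V d x + 2 * t * (\<Sum>u\<in>V. w u * (\<Sum>v\<in>V. d u v * x v)) + t\<^sup>2 * qform V d w"
proof -
  have sw: "(\<Sum>u\<in>V. \<Sum>v\<in>V. d u v * x u * w v) = (\<Sum>u\<in>V. \<Sum>v\<in>V. d u v * w u * x v)"
    by (subst sum.swap) (intro sum.cong refl, simp add: sym ac_simps)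
  have "qform V d (\<lambda>v. x v + t * w v) = (\<Sum>u\<in>V. \<Sum>v\<in>V. d u v * x u * x v
      + t * (d u v * x u * w v) + t * (d u v * w u * x v) + t\<^sup>2 * (d u v * w u * w v))"
    unfolding qform_def by (intro sum.cong refl) (simp add: algebra_simps power2_eq_square)
  also have "\<dots> = qform V d x + t * (\<Sum>u\<in>V. \<Sum>v\<in>V. d u v * x u * w v)
      + t * (\<Sum>u\<in>V. \<Sum>v\<in>V. d u v * w u * x v) + t\<^sup>2 * qform V d w"
    by (simp add: qform_def sum.distrib sum_distrib_left)
  also have "(\<Sum>u\<in>V. \<Sum>v\<in>V. d u v * w u * x v) = (\<Sum>u\<in>V. w u * (\<Sum>v\<in>V. d u v * x v))"
    by (simp add: sum_distrib_left ac_simps)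
  finally show ?thesis unfolding sw by (simp add: sum_distrib_left ac_simps)
qed

text \<open>First variation in the direction of the residual r = L x - D x. With \<open>s\<close>
  the squared norm of \<open>r\<close>, the gap between the two sides of the Rayleigh bound at x + t
  r is \<open>2 * t * s + t\<^sup>2 * c\<close>. It is nonnegative for all \<open>t\<close>, so a
  small negative \<open>t\<close> forces \<open>s = 0\<close>.\<close>

lemma eigenvector_of_rayleigh_max:
  fixes d :: "'v \<Rightarrow> 'v \<Rightarrow> real"
  assumes fin: "finite V"
    and sym: "\<And>u v. u \<in> V \<Longrightarrow> v \<in> V \<Longrightarrow> d u v = d v u"
    and le: "\<And>z. qform V d z \<le> L * (\<Sum>v\<in>V. (z v)\<^sup>2)"
    and eq: "qform V d x = L * (\<Sum>v\<in>V. (x v)\<^sup>2)"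
    and u: "u \<in> V"
  shows "(\<Sum>v\<in>V. d u v * x v) = L * x u"
proof -
  define r where "r = (\<lambda>u. L * x u - (\<Sum>v\<in>V. d u v * x v))"
  define s where "s = (\<Sum>v\<in>V. (r v)\<^sup>2)"
  define c where "c = L * s - qform V d r"
  have c: "c \<ge> 0" using le[of r] by (simp add: c_def s_def)
  have *: "2 * t * s + t\<^sup>2 * c \<ge> 0" for t
  proof -
    have "(\<Sum>v\<in>V. (x v + t * r v)\<^sup>2) =
        (\<Sum>v\<in>V. (x v)\<^sup>2) + 2 * t * (\<Sum>v\<in>V. r v * x v) + t\<^sup>2 * s"
      by (simp add: power2_eq_square algebra_simps sum.distrib sum_distrib_left s_def)
    moreover have "qform V d (\<lambda>v. x v + t * r v) = qform V d x
        + 2 * t * (\<Sum>u\<in>V. r u * (\<Sum>v\<in>V. d u v * x v)) + t\<^sup>2 * qform V d r"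
      using sym by (rule qform_add_scaled)
    ultimately have "0 \<le> 2 * t * (L * (\<Sum>v\<in>V. r v * x v) - (\<Sum>u\<in>V. r u * (\<Sum>v\<in>V. d u v * x v)))
        + t\<^sup>2 * c"
      using le[of "\<lambda>v. x v + t * r v"] eq by (simp add: c_def algebra_simps)
    also have "L * (\<Sum>v\<in>V. r v * x v) - (\<Sum>u\<in>V. r u * (\<Sum>v\<in>V. d u v * x v)) = s"
    proof -
      have "s = (\<Sum>u\<in>V. r u * (L * x u - (\<Sum>v\<in>V. d u v * x v)))"
        by (simp add: s_def r_def power2_eq_square)
      then show ?thesis by (simp add: right_diff_distrib sum_subtractf sum_distrib_left ac_simps)
    qed
    finally show ?thesis .
  qed
  have "s \<le> 0"
  proof (rule ccontr)
    assume "\<not> s \<le> 0"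
    then have s: "s > 0" by simp
    \<comment> \<open>This \<open>k\<close> keeps \<open>k * c\<close> below 1 and is defined also
      for \<open>c = 0\<close>; the value \<open>t = - s * k\<close> then makes the gap
      negative.\<close>
    define k where "k = 1 / (c + 1)"
    have k: "k > 0" "k * c < 1" using c by (auto simp: k_def)
    have "2 * (- s * k) * s + (- s * k)\<^sup>2 * c = s\<^sup>2 * k * (k * c - 2)"
      by (simp add: algebra_simps power2_eq_square)
    moreover have "s\<^sup>2 * k * (k * c - 2) < 0" using s k by (simp add: mult_pos_neg)
    ultimately show False using *[of "- s * k"] by linarith
  qed
  moreover have "s \<ge> 0" by (simp add: s_def sum_nonneg)
  ultimately have "s = 0" by simp
  then have "r u = 0" using fin u by (simp add: s_def sum_nonneg_eq_0_iff)
  then show ?thesis by (simp add: r_def)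
qed

lemma qform_abs_le:
  assumes "\<And>u v. u \<in> V \<Longrightarrow> v \<in> V \<Longrightarrow> d u v \<ge> 0"
  shows "\<bar>qform V d x\<bar> \<le> qform V d (\<lambda>v. \<bar>x v\<bar>)"
proof -
  have "\<bar>qform V d x\<bar> \<le> (\<Sum>u\<in>V. \<Sum>v\<in>V. \<bar>d u v * x u * x v\<bar>)"
    unfolding qform_def by (rule order_trans[OF sum_abs sum_mono[OF sum_abs]])
  also have "\<dots> = qform V d (\<lambda>v. \<bar>x v\<bar>)"
    unfolding qform_def by (intro sum.cong refl) (simp add: abs_mult assms)
  finally show ?thesis .
qed

lemma qform_eigenvector:
  assumes "\<And>u. u \<in> V \<Longrightarrow> (\<Sum>v\<in>V. d u v * x v) = \<mu> * x u"
  shows "qform V d x = \<mu> * (\<Sum>v\<in>V. (x v)\<^sup>2)"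
proof -
  have "qform V d x = (\<Sum>u\<in>V. x u * (\<Sum>v\<in>V. d u v * x v))"
    by (simp add: qform_def sum_distrib_left ac_simps)
  also have "\<dots> = (\<Sum>u\<in>V. x u * (\<mu> * x u))" using assms by simp
  finally show ?thesis by (simp add: sum_distrib_left power2_eq_square ac_simps)
qed

section \<open>From the distance matrix to a quadratic form on the vertices\<close>

abbreviation rdist :: "'a pair_pre_digraph \<Rightarrow> 'a \<Rightarrow> 'a \<Rightarrow> real" where
  "rdist G u v \<equiv> real (graph_dist G u v)"

text \<open>Frees the eigenvalue problem from the numbering of the vertices, so that everything
  below works with functions on \<open>pverts G\<close>.\<close>

lemma eigenvalue_distance_matrix_iff:
  fixes G :: "'a pair_pre_digraph"
  assumes fin: "finite (pverts G)"
  shows "eigenvalue (distance_matrix G) \<mu> \<longleftrightarrow>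
    (\<exists>x. (\<exists>v\<in>pverts G. x v \<noteq> 0) \<and>
         (\<forall>u\<in>pverts G. (\<Sum>v\<in>pverts G. rdist G u v * x v) = \<mu> * x u))"
proof -
  define V where "V = pverts G"
  define n where "n = card V"
  define b where "b = from_nat_into V"
  have bij: "bij_betw b {..<n} V"
    unfolding b_def n_def using bij_betw_from_nat_into_finite fin V_def by blast
  define g where "g = the_inv_into {..<n} b"
  have gb: "g (b i) = i" if "i < n" for i
    using that bij unfolding g_def by (intro the_inv_into_f_f) (auto simp: bij_betw_def)
  have bg: "b (g v) = v" "g v < n" if "v \<in> V" for v
    using that bij unfolding g_def
    by (auto simp: bij_betw_def f_the_inv_into_f dest: the_inv_into_into[of b "{..<n}" v "{..<n}"])
  have bV: "b i \<in> V" if "i < n" for i using bij that by (auto simp: bij_betw_def)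
  have D: "distance_matrix G = mat n n (\<lambda>(i, j). rdist G (b i) (b j))"
    by (simp add: distance_matrix_def n_def b_def V_def)
  have mv: "(distance_matrix G *\<^sub>v w) $ i = (\<Sum>v\<in>V. rdist G (b i) v * w $ g v)"
    if "dim_vec w = n" "i < n" for w i
  proof -
    have "(distance_matrix G *\<^sub>v w) $ i = (\<Sum>j<n. rdist G (b i) (b j) * w $ j)"
      using that by (simp add: D scalar_prod_def lessThan_atLeast0)
    also have "\<dots> = (\<Sum>j<n. rdist G (b i) (b j) * w $ g (b j))"
      by (intro sum.cong refl) (simp add: gb)
    also have "\<dots> = (\<Sum>v\<in>V. rdist G (b i) v * w $ g v)"
      using sum.reindex_bij_betw[OF bij, of "\<lambda>v. rdist G (b i) v * w $ g v"] by simp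
    finally show ?thesis .
  qed
  show ?thesis
    unfolding V_def[symmetric]
  proof
    assume "eigenvalue (distance_matrix G) \<mu>"
    then obtain w where w: "w \<in> carrier_vec n" "w \<noteq> 0\<^sub>v n" "distance_matrix G *\<^sub>v w = \<mu> \<cdot>\<^sub>v w"
      by (auto simp: eigenvalue_def eigenvector_def D)
    have dw: "dim_vec w = n" using w by auto
    have "\<exists>i<n. w $ i \<noteq> 0" using w(2) dw by (metis eq_vecI index_zero_vec)
    then have "\<exists>v\<in>V. w $ g v \<noteq> 0" using bV gb by metis
    moreover have "(\<Sum>v\<in>V. rdist G u v * w $ g v) = \<mu> * w $ g u" if u: "u \<in> V" for u
      using mv[OF dw, of "g u"] w(3) bg[OF u] dw by simp
    ultimately show "\<exists>x. (\<exists>v\<in>V. x v \<noteq> 0) \<and> (\<forall>u\<in>V. (\<Sum>v\<in>V. rdist G u v * x v) = \<mu> * x u)"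
      by (intro exI[of _ "\<lambda>v. w $ g v"]) blast
  next
    assume "\<exists>x. (\<exists>v\<in>V. x v \<noteq> 0) \<and> (\<forall>u\<in>V. (\<Sum>v\<in>V. rdist G u v * x v) = \<mu> * x u)"
    then obtain x where x: "\<exists>v\<in>V. x v \<noteq> 0" "\<And>u. u \<in> V \<Longrightarrow> (\<Sum>v\<in>V. rdist G u v * x v) = \<mu> * x u"
      by blast
    define w where "w = vec n (\<lambda>i. x (b i))"
    have dw: "dim_vec w = n" by (simp add: w_def)
    have wg: "w $ g v = x v" if "v \<in> V" for v using bg[OF that] by (simp add: w_def)
    have "distance_matrix G *\<^sub>v w = \<mu> \<cdot>\<^sub>v w"
    proof (rule eq_vecI)
      fix i assume "i < dim_vec (\<mu> \<cdot>\<^sub>v w)"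
      then have i: "i < n" by (simp add: dw)
      have "(distance_matrix G *\<^sub>v w) $ i = (\<Sum>v\<in>V. rdist G (b i) v * x v)"
        unfolding mv[OF dw i] by (intro sum.cong refl) (simp add: wg)
      then show "(distance_matrix G *\<^sub>v w) $ i = (\<mu> \<cdot>\<^sub>v w) $ i"
        using x(2)[OF bV[OF i]] i by (simp add: w_def)
    qed (simp add: D dw)
    moreover have "w \<noteq> 0\<^sub>v n"
      using x(1) wg bg by (metis index_zero_vec(1))
    ultimately show "eigenvalue (distance_matrix G) \<mu>"
      unfolding eigenvalue_def eigenvector_def using dw by (auto simp: D intro!: exI[of _ w])
  qed
qed

text \<open>The entries are nonnegative, so taking absolute values of a maximiser on the sphere does
  not lower the form, and the maximum \<open>L\<close> dominates the modulus of every eigenvalue.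
  The set under \<open>Max\<close> then lies in \<open>{-L, L}\<close> and contains
  \<open>L\<close>.\<close>

lemma distance_spectral_radius_rayleigh:
  fixes G :: "'a pair_pre_digraph"
  assumes fin: "finite (pverts G)" and ne: "pverts G \<noteq> {}"
    and sym: "\<And>u v. u \<in> pverts G \<Longrightarrow> v \<in> pverts G \<Longrightarrow> graph_dist G u v = graph_dist G v u"
  obtains x where "\<And>v. v \<in> pverts G \<Longrightarrow> x v \<ge> 0" and "(\<Sum>v\<in>pverts G. (x v)\<^sup>2) = 1"
    and "\<And>u. u \<in> pverts G \<Longrightarrow>
      (\<Sum>v\<in>pverts G. rdist G u v * x v) = distance_spectral_radius G * x u"
    and "\<And>z. qform (pverts G) (rdist G) z \<le>
      distance_spectral_radius G * (\<Sum>v\<in>pverts G. (z v)\<^sup>2)"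
proof -
  define V where "V = pverts G"
  obtain x0 where x0: "(\<Sum>v\<in>V. (x0 v)\<^sup>2) = 1"
    and mx0: "\<And>z. (\<Sum>v\<in>V. (z v)\<^sup>2) = 1 \<Longrightarrow> qform V (rdist G) z \<le> qform V (rdist G) x0"
    using qform_attains_max_on_sphere[of V "rdist G"] fin ne V_def by blast
  define x where "x = (\<lambda>v. \<bar>x0 v\<bar>)"
  define L where "L = qform V (rdist G) x"
  have x1: "(\<Sum>v\<in>V. (x v)\<^sup>2) = 1" using x0 by (simp add: x_def)
  have "qform V (rdist G) x0 \<le> L"
    using qform_abs_le[of V "rdist G" x0] by (simp add: L_def x_def)
  then have "qform V (rdist G) z \<le> L" if "(\<Sum>v\<in>V. (z v)\<^sup>2) = 1" for z
    using mx0[OF that] by simp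
  then have le: "qform V (rdist G) z \<le> L * (\<Sum>v\<in>V. (z v)\<^sup>2)" for z
    using fin V_def by (intro qform_le_of_sphere) auto
  have ev: "(\<Sum>v\<in>V. rdist G u v * x v) = L * x u" if "u \<in> V" for u
    using fin sym le x1 that unfolding V_def
    by (intro eigenvector_of_rayleigh_max) (auto simp: L_def V_def)
  have xnz: "\<exists>v\<in>V. x v \<noteq> 0"
  proof (rule ccontr)
    assume "\<not> ?thesis"
    then have "(\<Sum>v\<in>V. (x v)\<^sup>2) = 0" by simp
    then show False using x1 by simp
  qed
  have evL: "eigenvalue (distance_matrix G) L"
    unfolding eigenvalue_distance_matrix_iff[OF fin] V_def[symmetric] using ev xnz by blast
  have bound: "\<bar>\<mu>\<bar> \<le> L" if \<mu>: "eigenvalue (distance_matrix G) \<mu>" for \<mu>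
  proof -
    obtain y where y: "\<exists>v\<in>V. y v \<noteq> 0"
      and ey: "\<And>u. u \<in> V \<Longrightarrow> (\<Sum>v\<in>V. rdist G u v * y v) = \<mu> * y u"
      using \<mu> unfolding eigenvalue_distance_matrix_iff[OF fin] V_def[symmetric] by blast
    have pos: "(\<Sum>v\<in>V. (y v)\<^sup>2) > 0"
      using y fin V_def by (metis (no_types, lifting) sum_pos2 zero_le_power2 zero_less_power2)
    have "\<bar>\<mu>\<bar> * (\<Sum>v\<in>V. (y v)\<^sup>2) = \<bar>qform V (rdist G) y\<bar>"
      using qform_eigenvector[OF ey] pos by (simp add: abs_mult)
    also have "\<dots> \<le> qform V (rdist G) (\<lambda>v. \<bar>y v\<bar>)" by (rule qform_abs_le) simp
    also have "\<dots> \<le> L * (\<Sum>v\<in>V. (y v)\<^sup>2)" using le[of "\<lambda>v. \<bar>y v\<bar>"] by simp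
    finally show ?thesis using pos by simp
  qed
  have L0: "L \<ge> 0" using bound[OF evL] by linarith
  define S where "S = {x. eigenvalue (distance_matrix G) x \<and>
             (\<forall>y. eigenvalue (distance_matrix G) y \<longrightarrow> \<bar>y\<bar> \<le> \<bar>x\<bar>)}"
  have LS: "L \<in> S" using evL bound L0 by (simp add: S_def)
  have "S \<subseteq> {-L, L}"
  proof
    fix z assume "z \<in> S"
    then have "\<bar>L\<bar> \<le> \<bar>z\<bar>" "\<bar>z\<bar> \<le> L" using evL bound by (auto simp: S_def)
    then show "z \<in> {-L, L}" by auto
  qed
  then have "Max S = L"
    using LS L0 by (intro Max_eqI) (auto intro: finite_subset)
  then have "distance_spectral_radius G = L"
    by (simp add: distance_spectral_radius_def S_def)
  then show thesis
    using that[of x] x1 ev le by (simp add: V_def x_def)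
qed

section \<open>Comparing the branches of an eigenvector\<close>

text \<open>
  Entries on the \<open>i\<close>-th path are indexed by the distance \<open>h\<close> to its free end, because two paths of
  different lengths are compared from that end.
\<close>

locale branch_eigenvector =
  fixes m :: nat and l :: "nat \<Rightarrow> nat" and z :: "nat \<Rightarrow> nat \<Rightarrow> real" and L C :: real
  fixes t :: "nat \<Rightarrow> nat \<Rightarrow> real" and W :: real
  defines "t i h \<equiv> \<Sum>h'<h. z i h'"
    and "W \<equiv> \<Sum>i<m. t i (Suc (l i))"
  assumes L: "L > 0"
    and z_pos: "\<And>i h. i < m \<Longrightarrow> h \<le> l i \<Longrightarrow> z i h > 0"
    and step: "\<And>i h. i < m \<Longrightarrow> h < l i \<Longrightarrow> L * (z i h - z i (Suc h)) = W - 2 * t i (Suc h)"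
    and root: "\<And>i. i < m \<Longrightarrow> L * z i (l i) + t i (Suc (l i)) = C"
    and large: "\<And>i h. i < m \<Longrightarrow> h \<le> l i \<Longrightarrow> L * z i h \<ge> W - z i h"
begin

lemma t_Suc: "t i (Suc h) = t i h + z i h"
  by (simp add: t_def)

lemma t_nonneg: "i < m \<Longrightarrow> h \<le> Suc (l i) \<Longrightarrow> t i h \<ge> 0"
  unfolding t_def using z_pos by (intro sum_nonneg) (simp add: less_imp_le)

lemma t_mono: "i < m \<Longrightarrow> h \<le> h' \<Longrightarrow> h' \<le> Suc (l i) \<Longrightarrow> t i h \<le> t i h'"
  unfolding t_def using z_pos by (intro sum_mono2) (auto simp: less_imp_le)

lemma two_branches_le_W:
  assumes "i < m" "j < m" "i \<noteq> j"
  shows "t i (Suc (l i)) + t j (Suc (l j)) \<le> W"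
proof -
  have "(\<Sum>i\<in>{i, j}. t i (Suc (l i))) \<le> W"
    unfolding W_def using assms t_nonneg by (intro sum_mono2) auto
  then show ?thesis using assms by simp
qed

lemma step': "i < m \<Longrightarrow> h < l i \<Longrightarrow> z i (Suc h) = z i h - (W - 2 * t i (Suc h)) / L"
  using step[of i h] L by (simp add: field_simps)

text \<open>The recursion \<open>step'\<close> is increasing in both the current entry and the
  partial sum, so an inequality at the free ends propagates towards the clique.\<close>

lemma less_from_end:
  assumes "i < m" "j < m" "z i 0 < z j 0" "h \<le> l i" "h \<le> l j"
  shows "z i h < z j h \<and> t i (Suc h) < t j (Suc h)"
  using assms(4,5)
proof (induction h)
  case 0
  then show ?case using assms(3) by (simp add: t_def)
next
  case (Suc h)
  then have IH: "z i h < z j h" "t i (Suc h) < t j (Suc h)" by auto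
  have "(W - 2 * t i (Suc h)) / L > (W - 2 * t j (Suc h)) / L"
    using IH L by (intro divide_strict_right_mono) auto
  then have "z i (Suc h) < z j (Suc h)"
    using IH step'[of i h] step'[of j h] Suc.prems assms(1,2) by simp
  then show ?case using IH t_Suc[of i "Suc h"] t_Suc[of j "Suc h"] by simp
qed

lemma eq_from_end:
  assumes "i < m" "j < m" "z i 0 = z j 0" "h \<le> l i" "h \<le> l j"
  shows "z i h = z j h \<and> t i (Suc h) = t j (Suc h)"
  using assms(4,5)
proof (induction h)
  case 0
  then show ?case using assms(3) by (simp add: t_def)
next
  case (Suc h)
  then have IH: "z i h = z j h" "t i (Suc h) = t j (Suc h)" by auto
  then have "z i (Suc h) = z j (Suc h)"
    using step'[of i h] step'[of j h] Suc.prems assms(1,2) by simp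
  then show ?case using IH t_Suc[of i "Suc h"] t_Suc[of j "Suc h"] by simp
qed

text \<open>A strict inequality at the free ends would reach the roots, where \<open>root\<close>
  gives \<open>L * z + t\<close> the same value on all paths.\<close>

lemma same_length_not_less:
  assumes "i < m" "j < m" "l i = l j"
  shows "\<not> z i 0 < z j 0"
proof
  assume "z i 0 < z j 0"
  then have *: "z i (l i) < z j (l i)" "t i (Suc (l i)) < t j (Suc (l i))"
    using less_from_end[of i j "l i"] assms by auto
  then have "L * z i (l i) < L * z j (l i)" using L by simp
  then show False using * root[of i] root[of j] assms by simp
qed

lemma same_length_eq:
  assumes "i < m" "j < m" "l i = l j"
  shows "t i (Suc (l i)) = t j (Suc (l j))"
proof -
  have "z i 0 = z j 0"
    using same_length_not_less[of i j] same_length_not_less[of j i] assms by force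
  then show ?thesis using eq_from_end[of i j "l i"] assms by simp
qed

text \<open>Otherwise the long path is lighter on its outer \<open>Suc (l j)\<close> cells. Its one
  additional step and \<open>two_branches_le_W\<close> then make \<open>L * z + t\<close> at its
  root strictly smaller than on path \<open>j\<close>, against \<open>root\<close>.\<close>

lemma long_end_ge:
  assumes ij: "i < m" "j < m" and long: "l i = Suc (l j)"
  shows "z i 0 \<ge> z j 0"
proof (rule ccontr)
  assume "\<not> ?thesis"
  then have *: "z i (l j) < z j (l j)" "t i (Suc (l j)) < t j (Suc (l j))"
    using less_from_end[of i j "l j"] assms by auto
  have "i \<noteq> j" using long by auto
  then have W: "t i (Suc (l i)) + t j (Suc (l j)) \<le> W" using ij two_branches_le_W by simp
  have "L * z i (l j) < L * z j (l j)" using * L by simp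
  moreover have "L * z i (l i) = L * z i (l j) - (W - 2 * t i (l i))"
    using step[of i "l j"] ij long by (simp add: algebra_simps)
  ultimately show False
    using root[of i] root[of j] ij W * long by simp
qed

lemma ge_from_end:
  assumes "i < m" "j < m" "z i 0 \<ge> z j 0" "h \<le> l i" "h \<le> l j"
  shows "z i h \<ge> z j h \<and> t i (Suc h) \<ge> t j (Suc h)"
  using less_from_end[of j i h] eq_from_end[of i j h] assms by (cases "z i 0 = z j 0") auto

lemma long_branch_gt:
  assumes ij: "i < m" "j < m" and long: "l i = Suc (l j)"
  shows "t i (Suc (l i)) > t j (Suc (l j))"
proof -
  have "t i (l i) \<ge> t j (Suc (l j))"
    using ge_from_end[of i j "l j"] long_end_ge[OF assms] assms by simp
  then show ?thesis using z_pos[of i "l i"] ij t_Suc[of i "l i"] by simp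
qed

text \<open>Here the paths are aligned at their roots and the induction runs outwards. It starts
  from \<open>root\<close>: the heavier long branch has the smaller root entry.\<close>

lemma shift_from_root:
  assumes ij: "i < m" "j < m" and long: "l i = Suc (l j)" and h: "h \<le> l j"
  shows "z i (Suc h) \<le> z j h \<and> t i (Suc (Suc h)) \<ge> t j (Suc h)"
  using h
proof (induction h rule: inc_induct)
  case base
  have "L * z i (l i) < L * z j (l j)"
    using root[of i] root[of j] long_branch_gt[OF ij long] ij by simp
  then show ?case using L long_branch_gt[OF ij long] long by simp
next
  case (step h)
  then have IH: "z i (Suc (Suc h)) \<le> z j (Suc h)" "t i (Suc (Suc (Suc h))) \<ge> t j (Suc (Suc h))"
    by auto
  have t: "t i (Suc (Suc h)) \<ge> t j (Suc h)"
    using IH t_Suc[of i "Suc (Suc h)"] t_Suc[of j "Suc h"] by simp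
  have "(W - 2 * t i (Suc (Suc h))) / L \<le> (W - 2 * t j (Suc h)) / L"
    using t L by (intro divide_right_mono) auto
  then show ?case
    using IH t step'[of i "Suc h"] step'[of j h] step.hyps ij long by simp
qed

lemma branch_gt_rootless_branch:
  assumes ij: "i < m" "j < m" and "l j \<le> l i" "l i \<le> Suc (l j)"
  shows "t i (Suc (l i)) > t j (l j)"
proof -
  have "t i (Suc (l i)) \<ge> t j (Suc (l j))"
    using same_length_eq[OF ij] long_branch_gt[OF ij] assms(3,4)
    by (cases "l i = l j") auto
  then show ?thesis using t_Suc[of j "l j"] z_pos[of j "l j"] ij by simp
qed

text \<open>With \<open>shift_from_root\<close>, the difference of the two sums telescopes to at
  most \<open>z i 0 - z i (l i)\<close>. The first step from the free end,
  \<open>z i 0 - z i 1\<close>, is less than \<open>z i (l i)\<close>, so the difference is less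
  than \<open>z i 1\<close>, which is at most \<open>z j' 0\<close>.\<close>

lemma rootless_long_branch_less:
  assumes ij: "i < m" "j < m" "j' < m" and long: "l i = Suc (l j)" "l i = Suc (l j')"
  shows "t i (l i) < t j (Suc (l j)) + z j' 0"
proof -
  have diff: "z i h - z j h \<le> z i h - z i (Suc h)" if "h \<le> l j" for h
    using shift_from_root[OF ij(1,2) long(1) that] by simp
  have "t i (l i) - t j (Suc (l j)) = (\<Sum>h<l i. z i h - z j h)"
    by (simp add: t_def sum_subtractf long(1))
  also have "\<dots> \<le> (\<Sum>h<l i. z i h - z i (Suc h))"
    using diff long(1) by (intro sum_mono) auto
  also have "\<dots> = z i 0 - z i (l i)" by (simp add: sum_lessThan_telescope')
  finally have 1: "t i (l i) - t j (Suc (l j)) \<le> z i 0 - z i (l i)" .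
  \<comment> \<open>Path \<open>j\<close> is lighter than path \<open>i\<close>, so its partial sums
    are at most half of \<open>W\<close> and its entries do not increase towards the clique.\<close>
  have "z j h \<le> z j 0" if "h \<le> l j" for h
    using that
  proof (induction h)
    case (Suc h)
    have "i \<noteq> j" using long by auto
    then have "2 * t j (Suc (l j)) \<le> W"
      using two_branches_le_W[of i j] long_branch_gt[OF ij(1,2) long(1)] ij by simp
    then have "2 * t j (Suc h) \<le> W" using t_mono[of j "Suc h" "Suc (l j)"] Suc.prems ij by simp
    then have "L * z j (Suc h) \<le> L * z j h" using step[of j h] Suc.prems ij by (simp add: algebra_simps)
    then have "z j (Suc h) \<le> z j h" using L by simp
    then show ?case using Suc by simp
  qed simp
  then have "z i (l i) \<le> z j 0"
    using shift_from_root[OF ij(1,2) long(1), of "l j"] long(1) by fastforce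
  also have "z j 0 \<le> z i 0" by (rule long_end_ge[OF ij(1,2) long(1)])
  finally have small: "z i (l i) < 2 * z i 0" using z_pos[of i 0] ij by simp
  have "L * (z i 0 - z i 1) = W - 2 * z i 0"
    using step[of i 0] ij long by (simp add: t_def)
  also have "\<dots> < W - z i (l i)" using small by simp
  also have "\<dots> \<le> L * z i (l i)" using large[of i "l i"] ij by simp
  finally have "z i 0 - z i 1 < z i (l i)" using L by simp
  moreover have "z i 1 \<le> z j' 0" using shift_from_root[OF ij(1,3) long(2), of 0] by simp
  ultimately show ?thesis using 1 by linarith
qed

end

section \<open>Separation by cut vertices\<close>

text \<open>Counting predecessors numbers a finite strict total order. Used for the separators of a
  pair and for each chain.\<close>

lemma bij_betw_rank:
  assumes fin: "finite A" and irr: "\<And>x. x \<in> A \<Longrightarrow> \<not> R x x"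
    and tr: "\<And>x y z. x \<in> A \<Longrightarrow> y \<in> A \<Longrightarrow> z \<in> A \<Longrightarrow> R x y \<Longrightarrow> R y z \<Longrightarrow> R x z"
    and tot: "\<And>x y. x \<in> A \<Longrightarrow> y \<in> A \<Longrightarrow> x \<noteq> y \<Longrightarrow> R x y \<or> R y x"
  shows "bij_betw (\<lambda>x. card {y \<in> A. R y x}) A {..<card A}"
proof -
  let ?r = "\<lambda>x. card {y \<in> A. R y x}"
  have less: "?r x < ?r y" if xy: "x \<in> A" "y \<in> A" "R x y" for x y
  proof (intro psubset_card_mono psubsetI)
    show "{z \<in> A. R z x} \<subseteq> {z \<in> A. R z y}" using tr xy by blast
    show "{z \<in> A. R z x} \<noteq> {z \<in> A. R z y}" using irr[OF xy(1)] xy by blast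
  qed (simp add: fin)
  have inj: "inj_on ?r A"
  proof (rule inj_onI, rule ccontr)
    fix x y assume xy: "x \<in> A" "y \<in> A" "?r x = ?r y" "x \<noteq> y"
    then show False using tot[OF xy(1,2,4)] less[OF xy(1,2)] less[OF xy(2,1)] by auto
  qed
  have sub: "?r ` A \<subseteq> {..<card A}"
  proof
    fix r assume "r \<in> ?r ` A"
    then obtain x where "x \<in> A" "r = ?r x" by blast
    moreover have "?r x < card A"
      using irr[OF \<open>x \<in> A\<close>] \<open>x \<in> A\<close> by (intro psubset_card_mono[OF fin] psubsetI) blast+
    ultimately show "r \<in> {..<card A}" by simp
  qed
  have "?r ` A = {..<card A}"
    using sub card_image[OF inj] by (intro card_subset_eq) auto
  then show ?thesis using inj by (simp add: bij_betw_def)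
qed

text \<open>
  \<open>sep c u v\<close> says that \<open>u\<close> and \<open>v\<close> lie in different components once \<open>c\<close> is deleted. The
  assumptions are all that is used of the block structure of a connected graph.
\<close>

locale separation =
  fixes V :: "'v set" and sep :: "'v \<Rightarrow> 'v \<Rightarrow> 'v \<Rightarrow> bool"
  assumes fin: "finite V"
    and sep_in: "sep c u v \<Longrightarrow> c \<in> V \<and> u \<in> V \<and> v \<in> V \<and> c \<noteq> u \<and> c \<noteq> v \<and> u \<noteq> v"
    and sep_sym: "sep c u v \<Longrightarrow> sep c v u"
    and sep_cotrans: "sep c u v \<Longrightarrow> w \<in> V \<Longrightarrow> w \<noteq> c \<Longrightarrow> sep c u w \<or> sep c w v"
    and sep_asym: "sep c u c' \<Longrightarrow> \<not> sep c' u c"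
begin

section \<open>Cut vertices as a rooted order seen from one vertex\<close>

definition cuts :: "'v set" where "cuts = {c. \<exists>u v. sep c u v}"
definition ends :: "'v set" where "ends = V - cuts"
definition separators :: "'v \<Rightarrow> 'v \<Rightarrow> 'v set" where "separators u v = {c. sep c u v}"
definition side :: "'v \<Rightarrow> 'v \<Rightarrow> 'v set" where "side a c = {v \<in> V. v \<noteq> c \<and> \<not> sep c a v}"

lemma cuts_subset: "cuts \<subseteq> V"
  unfolding cuts_def using sep_in by blast

lemma finite_cuts: "finite cuts"
  using finite_subset[OF cuts_subset fin] .

lemma finite_ends: "finite ends"
  using fin by (simp add: ends_def)

lemma card_ends_cuts: "card ends + card cuts = card V"
  unfolding ends_def using cuts_subset fin
  by (metis add.commute card_Diff_subset card_mono finite_cuts le_add_diff_inverse)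

lemma separators_subset: "separators u v \<subseteq> cuts"
  by (auto simp: separators_def cuts_def)

lemma finite_separators: "finite (separators u v)"
  using finite_subset[OF separators_subset finite_cuts] .

lemma separators_commute: "separators u v = separators v u"
  unfolding separators_def using sep_sym by blast

text \<open>Seen from a fixed \<open>a\<close>, \<open>sep c a c'\<close> is a strict order with
  \<open>c\<close> nearer to \<open>a\<close>, as in a rooted tree. If \<open>v\<close> were not
  beyond \<open>c\<close>, then \<open>c\<close> would separate \<open>v\<close> from
  \<open>c'\<close>; so \<open>c'\<close> could separate \<open>c\<close> neither from
  \<open>v\<close> nor from \<open>a\<close>, hence not \<open>a\<close> from
  \<open>v\<close>.\<close>

lemma sep_trans:
  assumes "sep c a c'" "sep c' a v"
  shows "sep c a v"
proof (rule ccontr)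
  assume n: "\<not> sep c a v"
  have "\<not> sep c' a c" using sep_asym[OF assms(1)] .
  then have "v \<noteq> c" using assms(2) by auto
  then have "sep c v c'" using sep_cotrans[OF assms(1), of v] sep_in[OF assms(2)] n by blast
  then have "\<not> sep c' v c" using sep_asym by blast
  moreover have "sep c' a c \<or> sep c' c v"
    using sep_cotrans[OF assms(2), of c] sep_in[OF assms(1)] by blast
  ultimately show False using sep_sym sep_asym[OF assms(1)] by blast
qed

text \<open>The tree property of this order: what lies between \<open>a\<close> and a given
  \<open>d\<close> is a chain.\<close>

lemma sep_comparable:
  assumes "sep c a d" "sep c' a d" "c \<noteq> c'"
  shows "sep c a c' \<or> sep c' a c"
proof (rule ccontr)
  assume n: "\<not> ?thesis"
  then have "sep c c' d"
    using sep_cotrans[OF assms(1), of c'] sep_in[OF assms(2)] assms(3) by blast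
  then have "\<not> sep c' d c" using sep_sym sep_asym by blast
  moreover have "sep c' a c \<or> sep c' c d"
    using sep_cotrans[OF assms(2), of c] sep_in[OF assms(1)] assms(3) by blast
  ultimately show False using n sep_sym by blast
qed

lemma cut_separates:
  assumes "c \<in> cuts" "a \<in> V" "a \<noteq> c"
  obtains v where "sep c a v"
proof -
  obtain u v where uv: "sep c u v" using assms(1) unfolding cuts_def by blast
  from sep_cotrans[OF this assms(2,3)] show thesis using that sep_sym by blast
qed

text \<open>Passing to a cut vertex beyond \<open>c\<close> shrinks the set of vertices beyond, so
  the search stops at a vertex that is not a cut vertex.\<close>

lemma ex_end_beyond:
  "sep c a v \<Longrightarrow> \<exists>d\<in>ends. sep c a d"
proof (induction "card {w. sep c a w}" arbitrary: c v rule: less_induct)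
  case less
  show ?case
  proof (cases "v \<in> ends")
    case True
    then show ?thesis using less.prems by blast
  next
    case False
    then have "v \<in> cuts" using sep_in[OF less.prems] by (auto simp: ends_def)
    then obtain w where w: "sep v a w"
      using cut_separates[of v a] sep_in[OF less.prems] by auto
    have "{w. sep c a w} \<subseteq> V" using sep_in by blast
    then have "finite {w. sep c a w}" using fin finite_subset by blast
    moreover have "{w. sep v a w} \<subset> {w. sep c a w}"
    proof
      show "{w. sep v a w} \<subseteq> {w. sep c a w}" using sep_trans[OF less.prems] by blast
      show "{w. sep v a w} \<noteq> {w. sep c a w}" using less.prems sep_in[of v a v] by blast
    qed
    ultimately have "card {w. sep v a w} < card {w. sep c a w}" by (intro psubset_card_mono)
    from less.hyps[OF this w] show ?thesis using sep_trans[OF less.prems] by blast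
  qed
qed

text \<open>A vertex \<open>b\<close> with something behind it is not at maximal separation from
  \<open>a\<close>, so a pair with the most separators consists of members of
  \<open>ends\<close>.\<close>

lemma separators_psubset:
  assumes "sep b a w"
  shows "separators a b \<subset> separators a w"
proof
  show "separators a b \<subseteq> separators a w"
    unfolding separators_def using sep_trans[OF _ assms] by blast
  have "b \<in> separators a w" "b \<notin> separators a b"
    unfolding separators_def using assms sep_in by blast+
  then show "separators a b \<noteq> separators a w" by blast
qed

lemma bij_betw_separators_rank:
  "bij_betw (\<lambda>c. card {c' \<in> separators a b. sep c' a c}) (separators a b) {..<card (separators a b)}"
proof (rule bij_betw_rank)
  show "\<not> sep c a c" for c using sep_in by blast
  show "sep x a z" if "sep x a y" "sep y a z" for x y z using that sep_trans by blast
  show "sep x a y \<or> sep y a x" if "x \<in> separators a b" "y \<in> separators a b" "x \<noteq> y" for x y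
    using that sep_comparable unfolding separators_def by blast
qed (rule finite_separators)

lemma side_comparable:
  assumes "c \<in> V" "c' \<in> V" "c \<noteq> c'"
  shows "c \<in> side x c' \<or> c' \<in> side x c"
  using assms sep_asym by (auto simp: side_def)

lemma side_nested:
  assumes "sep c x y" "sep c' x y" "c' \<in> side x c"
  shows "side x c' \<subseteq> side x c"
proof
  fix v assume v: "v \<in> side x c'"
  have 1: "sep c' x c" using sep_comparable[OF assms(1,2)] assms(3) by (auto simp: side_def)
  have "v \<noteq> c" using v 1 by (auto simp: side_def)
  moreover have "\<not> sep c x v"
  proof
    assume s: "sep c x v"
    have "sep c c' v" using sep_cotrans[OF s, of c'] assms(3) by (auto simp: side_def)
    then have "\<not> sep c' v c" using sep_sym sep_asym by blast
    then have "sep c' x v" using sep_cotrans[OF 1, of v] v by (auto simp: side_def)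
    then show False using v by (auto simp: side_def)
  qed
  ultimately show "v \<in> side x c" using v by (auto simp: side_def)
qed

lemma side_separated:
  assumes "u \<in> side x c" "v \<in> V" "v \<notin> side x c" "v \<noteq> c"
  shows "sep c u v"
proof -
  have "sep c x v" using assms by (auto simp: side_def)
  from sep_cotrans[OF this, of u] show ?thesis using assms by (auto simp: side_def)
qed

lemma beyond_separated:
  assumes "sep c x u" "v \<in> V" "\<not> sep c x v" "v \<noteq> c"
  shows "sep c u v"
  using sep_cotrans[OF assms(1), of v] assms sep_sym by blast

text \<open>For a cut vertex \<open>c\<close> that does not separate \<open>a\<close> from
  \<open>b\<close>, this keeps the region beyond \<open>c\<close> free of separators of
  \<open>a\<close> and \<open>b\<close>, as \<open>a_avoided\<close> demands.\<close>

lemma separator_not_beyond: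
  assumes "b \<in> ends" "\<not> sep c a b" "sep c' a b"
  shows "\<not> sep c a c'"
proof
  assume s: "sep c a c'"
  have "b \<noteq> c" "b \<in> V" using assms(1) s by (auto simp: ends_def cuts_def)
  then have "sep c b c'" using sep_cotrans[OF s, of b] assms(2) by blast
  then have "\<not> sep c' b c" using sep_asym by blast
  moreover have "sep c' a c \<or> sep c' c b"
    using sep_cotrans[OF assms(3), of c] sep_in[OF s] by blast
  ultimately show False using sep_asym[OF s] sep_sym by blast
qed

end

text \<open>
  Every cut vertex \<open>c\<close> is charged to an end vertex \<open>e c\<close> in a union \<open>T c\<close> of components of the
  graph without \<open>c\<close>. The cut vertices charged to one end form a chain. The chains of \<open>a\<close> and \<open>b\<close>
  are the two longest.
\<close>

locale chain_decomposition = separation +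
  fixes a b :: 'a and e :: "'a \<Rightarrow> 'a" and T :: "'a \<Rightarrow> 'a set"
  assumes ab: "a \<in> ends" "b \<in> ends" "a \<noteq> b"
    and e_ends: "c \<in> cuts \<Longrightarrow> e c \<in> ends"
    and e_T: "c \<in> cuts \<Longrightarrow> e c \<in> T c"
    and T_subset: "c \<in> cuts \<Longrightarrow> T c \<subseteq> V - {c}"
    and T_sep: "c \<in> cuts \<Longrightarrow> u \<in> T c \<Longrightarrow> v \<in> V \<Longrightarrow> v \<notin> T c \<Longrightarrow> v \<noteq> c \<Longrightarrow> sep c u v"
    and chain_total: "c \<in> cuts \<Longrightarrow> c' \<in> cuts \<Longrightarrow> c \<noteq> c' \<Longrightarrow> e c = e c' \<Longrightarrow> c \<in> T c' \<or> c' \<in> T c"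
    and chain_nested: "c \<in> cuts \<Longrightarrow> c' \<in> cuts \<Longrightarrow> e c = e c' \<Longrightarrow> c' \<in> T c \<Longrightarrow> T c' \<subseteq> T c"
    and chain_le: "d \<in> ends \<Longrightarrow> d \<noteq> a \<Longrightarrow> d \<noteq> b \<Longrightarrow> card {c \<in> cuts. e c = d} \<le> card {c \<in> cuts. e c = b}"
    and chain_ab: "card {c \<in> cuts. e c = b} \<le> card {c \<in> cuts. e c = a}"
      "card {c \<in> cuts. e c = a} \<le> Suc (card {c \<in> cuts. e c = b})"
    and a_avoided: "c \<in> cuts \<Longrightarrow> e c \<noteq> a \<Longrightarrow> a \<notin> T c"
      "c \<in> cuts \<Longrightarrow> e c \<noteq> a \<Longrightarrow> c' \<in> cuts \<Longrightarrow> e c' = a \<Longrightarrow> c' \<notin> T c"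
    and b_avoided: "c \<in> cuts \<Longrightarrow> e c = a \<Longrightarrow> b \<notin> T c"
      "c \<in> cuts \<Longrightarrow> e c = a \<Longrightarrow> c' \<in> cuts \<Longrightarrow> e c' = b \<Longrightarrow> c' \<notin> T c"
    and third: "card ends \<ge> 3 \<Longrightarrow> \<exists>d\<in>ends - {a, b}. \<forall>c\<in>cuts. e c = a \<longrightarrow> d \<notin> T c"

context separation
begin

text \<open>
  The separators of \<open>a\<close> and \<open>b\<close> are split in the middle, so that the half on the side of \<open>a\<close> is
  charged to \<open>a\<close> and the rest to \<open>b\<close>. Maximality of the number of separators bounds all other
  chains by half of it.
\<close>

lemma chain_decomposition_of_max_pair:
  assumes ab: "a \<in> ends" "b \<in> ends" "a \<noteq> b"
    and mx: "\<And>u v. u \<in> V \<Longrightarrow> v \<in> V \<Longrightarrow> card (separators u v) \<le> card (separators a b)"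
    and third: "card ends \<ge> 3 \<Longrightarrow> \<exists>d\<in>ends - {a, b}.
      card {c \<in> separators a b. sep c b d} \<le> card {c \<in> separators a b. sep c a d}"
  shows "\<exists>e T. chain_decomposition V sep a b e T"
proof -
  define S where "S = separators a b"
  define N where "N = card S"
  define rk where "rk c = card {c' \<in> S. sep c' a c}" for c
  \<comment> \<open>\<open>(N + 1) div 2\<close> rounds up, so for odd \<open>N\<close> the middle
    separator goes to \<open>a\<close>. This is the difference of one allowed in
    \<open>chain_ab\<close>.\<close>
  define Lt where "Lt = {c \<in> S. rk c < (N + 1) div 2}"
  define Rt where "Rt = S - Lt"
  \<comment> \<open>The part holding the charged end: the component of \<open>a\<close> or
    \<open>b\<close> at a separator, everything away from \<open>a\<close> at any other cut
    vertex.\<close>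
  define T where "T c = (if c \<in> Lt then side a c else if c \<in> Rt then side b c else {v. sep c a v})" for c
  define e where "e c = (if c \<in> Lt then a else if c \<in> Rt then b else (SOME d. d \<in> ends \<and> sep c a d))" for c
  have finS: "finite S" by (simp add: S_def finite_separators)
  have Sab: "c \<in> S \<longleftrightarrow> sep c a b" for c by (simp add: S_def separators_def)
  have Sba: "c \<in> S \<longleftrightarrow> sep c b a" for c using Sab sep_sym by blast
  have S_cuts: "S \<subseteq> cuts" by (simp add: S_def separators_subset)
  have LtS: "Lt \<subseteq> S" and RtS: "Rt \<subseteq> S" and LR: "Lt \<inter> Rt = {}" "S = Lt \<union> Rt"
    by (auto simp: Lt_def Rt_def)
  have abV: "a \<in> V" "b \<in> V" and ab_nc: "a \<notin> cuts" "b \<notin> cuts" using ab by (auto simp: ends_def)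
  have cutsV: "c \<in> V" if "c \<in> cuts" for c using that cuts_subset by blast
  have rk_bij: "bij_betw rk S {..<N}"
    unfolding rk_def S_def N_def by (rule bij_betw_separators_rank)
  have "rk ` Lt = {..<(N + 1) div 2}"
  proof -
    have S: "rk ` S = {..<N}" using rk_bij by (simp add: bij_betw_def)
    have "r \<in> rk ` Lt" if r: "r < (N + 1) div 2" for r
    proof -
      have "r \<in> rk ` S" unfolding S using r by auto
      then obtain c where "c \<in> S" "r = rk c" by blast
      then show ?thesis using r by (auto simp: Lt_def)
    qed
    then show ?thesis by (auto simp: Lt_def)
  qed
  moreover have "inj_on rk Lt" using rk_bij LtS by (auto simp: bij_betw_def intro: inj_on_subset)
  ultimately have cLt: "card Lt = (N + 1) div 2" by (metis card_image card_lessThan)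
  then have cRt: "card Rt = N - (N + 1) div 2"
    using card_Diff_subset[OF finite_subset[OF LtS finS] LtS] by (simp add: Rt_def N_def)
  have rk_mono: "rk c < rk c'" if "c \<in> S" "c' \<in> S" "sep c a c'" for c c'
    unfolding rk_def
  proof (intro psubset_card_mono psubsetI)
    show "finite {c'' \<in> S. sep c'' a c'}" using finS by simp
    show "{c' \<in> S. sep c' a c} \<subseteq> {c'' \<in> S. sep c'' a c'}" using sep_trans[OF _ that(3)] by blast
    show "{c' \<in> S. sep c' a c} \<noteq> {c'' \<in> S. sep c'' a c'}" using that sep_in[of c a c] by blast
  qed
  have LR_sep: "sep c a c'" if "c \<in> Lt" "c' \<in> Rt" for c c'
  proof -
    have "c \<noteq> c'" "c \<in> S" "c' \<in> S" using that LR by auto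
    then have "sep c a c' \<or> sep c' a c" using sep_comparable Sab by blast
    moreover have "rk c < rk c'" using that \<open>c' \<in> S\<close> by (auto simp: Lt_def Rt_def)
    ultimately show ?thesis using rk_mono[of c' c] \<open>c \<in> S\<close> \<open>c' \<in> S\<close> by fastforce
  qed
  have RL_sep: "sep c b c'" if "c \<in> Rt" "c' \<in> Lt" for c c'
  proof -
    have s: "sep c' a c" using LR_sep that by blast
    have "sep c a b" using that RtS Sab by blast
    from sep_cotrans[OF this, of c'] show ?thesis
      using s sep_asym[OF s] sep_in[OF s] sep_sym by blast
  qed
  have other: "e c \<in> ends \<and> sep c a (e c)" if "c \<in> cuts" "c \<notin> S" for c
  proof -
    have "c \<in> cuts" "a \<noteq> c" using that ab_nc by auto
    then obtain v where "sep c a v" using cut_separates[of c a] abV by blast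
    then have "\<exists>d. d \<in> ends \<and> sep c a d" using ex_end_beyond by blast
    from someI_ex[OF this] show ?thesis using that LR by (simp add: e_def)
  qed
  have eL: "e c = a" if "c \<in> Lt" for c using that by (simp add: e_def)
  have eR: "e c = b" if "c \<in> Rt" for c using that LR by (auto simp: e_def)
  have TL: "T c = side a c" if "c \<in> Lt" for c using that by (simp add: T_def)
  have TR: "T c = side b c" if "c \<in> Rt" for c using that LR by (auto simp: T_def)
  have TO: "T c = {v. sep c a v}" if "c \<notin> S" for c using that LR by (auto simp: T_def)
  have e_a: "c \<in> Lt" if "c \<in> cuts" "e c = a" for c
    using that eR[of c] other[of c] ab LR sep_in by (metis UnE)
  have e_b: "c \<in> Rt" if "c \<in> cuts" "e c = b" for c
    using that eL[of c] other[of c] ab LR Sab by (metis UnE)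
  have chain_a: "{c \<in> cuts. e c = a} = Lt" using e_a eL LtS S_cuts by blast
  have chain_b: "{c \<in> cuts. e c = b} = Rt" using e_b eR RtS S_cuts by blast
  have e_other: "c \<notin> S" if "c \<in> cuts" "e c \<noteq> a" "e c \<noteq> b" for c
    using that eL eR LR by blast
  have "chain_decomposition V sep a b e T"
  proof (unfold_locales)
    show "a \<in> ends" "b \<in> ends" "a \<noteq> b" by (rule ab)+
  next
    fix c assume c: "c \<in> cuts"
    show "e c \<in> ends" using c ab eL eR other LR by (metis UnE)
    show "e c \<in> T c"
    proof -
      consider "c \<in> Lt" | "c \<in> Rt" | "c \<notin> S" using LR by blast
      then show ?thesis
      proof cases
        case 1
        then show ?thesis using eL TL abV ab_nc c sep_in[of c a a] by (auto simp: side_def)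
      next
        case 2
        then show ?thesis using eR TR abV ab_nc c sep_in[of c b b] by (auto simp: side_def)
      next
        case 3
        then show ?thesis using other c TO by auto
      qed
    qed
    show "T c \<subseteq> V - {c}" using sep_in by (auto simp: T_def side_def)
    fix u v assume "u \<in> T c" "v \<in> V" "v \<notin> T c" "v \<noteq> c"
    then show "sep c u v"
      by (auto simp: T_def split: if_splits intro: side_separated beyond_separated)
  next
    fix c c' assume c: "c \<in> cuts" "c' \<in> cuts" and eq: "e c = e c'"
    consider "c \<in> Lt" "c' \<in> Lt" | "c \<in> Rt" "c' \<in> Rt" | "c \<notin> S" "c' \<notin> S"
      using eq c e_a e_b e_other eL eR LR by (metis UnE)
    note cs = this
    show "c \<in> T c' \<or> c' \<in> T c" if "c \<noteq> c'"
      using cs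
    proof cases
      case 3
      then have "sep c a (e c)" "sep c' a (e c)" using other[of c] other[of c'] c eq by auto
      then have "sep c a c' \<or> sep c' a c" using that by (rule sep_comparable)
      then show ?thesis using TO 3 by auto
    qed (use side_comparable[of c c'] cutsV c that TL TR in auto)
    show "T c' \<subseteq> T c" if "c' \<in> T c"
      using cs
    proof cases
      case 1
      then show ?thesis
        using side_nested[of c a b c'] that TL LtS Sab by auto
    next
      case 2
      then show ?thesis
        using side_nested[of c b a c'] that TR RtS Sba by auto
    next
      case 3
      then show ?thesis using that TO sep_trans by auto
    qed
  next
    fix d assume d: "d \<in> ends" "d \<noteq> a" "d \<noteq> b"
    define Q where "Q = {c \<in> cuts. e c = d}"
    have dV: "d \<in> V" "d \<notin> cuts" using d by (auto simp: ends_def)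
    have QS: "c \<notin> S \<and> sep c a d" if "c \<in> Q" for c
      using that d e_other other by (auto simp: Q_def)
    \<comment> \<open>\<open>c\<close> does not separate \<open>a\<close> from \<open>b\<close>, so
      \<open>d\<close> lies beyond \<open>c\<close> from either of them.\<close>
    have Qb: "sep c b d" if "c \<in> Q" for c
    proof -
      have c: "c \<in> cuts" "\<not> sep c a b" "sep c a d" using QS[OF that] that Sab by (auto simp: Q_def)
      then have "c \<noteq> b" using ab_nc by blast
      then show ?thesis using sep_cotrans[OF c(3), of b] c abV by blast
    qed
    define A where "A = {c \<in> S. sep c a d}"
    define B where "B = {c \<in> S. sep c b d}"
    have finQ: "finite Q" using finite_cuts by (simp add: Q_def)
    have finAB: "finite A" "finite B" using finS by (auto simp: A_def B_def)
    \<comment> \<open>Maximality bounds \<open>card Q + card A\<close> and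
      \<open>card Q + card B\<close> by \<open>N\<close>. As \<open>A\<close> and \<open>B\<close>
      together cover \<open>S\<close>, this leaves \<open>2 * card Q \<le> N\<close>, so
      \<open>Q\<close> has at most as many elements as the half charged to \<open>b\<close>.\<close>
    have "Q \<union> A \<subseteq> separators a d" using QS by (auto simp: A_def separators_def)
    then have "card (Q \<union> A) \<le> card (separators a d)" by (intro card_mono finite_separators)
    also have "\<dots> \<le> N" using mx[OF abV(1) dV(1)] by (simp add: N_def S_def)
    finally have "card (Q \<union> A) \<le> N" .
    moreover have "card (Q \<union> A) = card Q + card A"
      using QS finQ finAB by (intro card_Un_disjoint) (auto simp: A_def)
    moreover have "card (Q \<union> B) \<le> N"
    proof -
      have "Q \<union> B \<subseteq> separators b d" using Qb by (auto simp: B_def separators_def)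
      then have "card (Q \<union> B) \<le> card (separators b d)" by (intro card_mono finite_separators)
      also have "\<dots> \<le> N" using mx[OF abV(2) dV(1)] by (simp add: N_def S_def)
      finally show ?thesis .
    qed
    moreover have "card (Q \<union> B) = card Q + card B"
      using QS finQ finAB by (intro card_Un_disjoint) (auto simp: B_def)
    moreover have "S \<subseteq> A \<union> B"
    proof
      fix c assume c: "c \<in> S"
      then have "d \<noteq> c" using S_cuts dV by blast
      then show "c \<in> A \<union> B"
        using c sep_cotrans[of c a b d] dV Sab sep_sym by (auto simp: A_def B_def)
    qed
    then have "N \<le> card A + card B"
      using card_mono[of "A \<union> B" S] card_Un_le[of A B] finAB by (simp add: N_def)
    ultimately have "2 * card Q \<le> N" by linarith
    then show "card {c \<in> cuts. e c = d} \<le> card {c \<in> cuts. e c = b}"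
      unfolding chain_b cRt Q_def[symmetric] by linarith
  next
    show "card {c \<in> cuts. e c = b} \<le> card {c \<in> cuts. e c = a}"
      "card {c \<in> cuts. e c = a} \<le> Suc (card {c \<in> cuts. e c = b})"
      unfolding chain_a chain_b cLt cRt by linarith+
  next
    fix c assume c: "c \<in> cuts" "e c \<noteq> a"
    then have "c \<notin> Lt" using eL by blast
    then consider "c \<in> Rt" | "c \<notin> S" using LR by blast
    note cs = this
    show "a \<notin> T c" using cs
    proof cases
      case 1
      then show ?thesis using TR RtS Sba by (auto simp: side_def)
    next
      case 2
      then show ?thesis using TO sep_in[of c a a] by auto
    qed
    fix c' assume c': "c' \<in> cuts" "e c' = a"
    then have L': "c' \<in> Lt" using e_a by blast
    show "c' \<notin> T c" using cs
    proof cases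
      case 1
      then show ?thesis using TR RL_sep[OF _ L'] by (auto simp: side_def)
    next
      case 2
      then show ?thesis using TO separator_not_beyond[OF ab(2), of c a c'] L' LtS Sab by auto
    qed
  next
    fix c assume c: "c \<in> cuts" "e c = a"
    then have L: "c \<in> Lt" using e_a by blast
    then show "b \<notin> T c" using TL LtS Sab by (auto simp: side_def)
    show "c' \<notin> T c" if "c' \<in> cuts" "e c' = b" for c'
      using that e_b L LR_sep TL by (auto simp: side_def)
  next
    assume "card ends \<ge> 3"
    then obtain d where d: "d \<in> ends - {a, b}"
      and le: "card {c \<in> S. sep c b d} \<le> card {c \<in> S. sep c a d}"
      using third S_def by blast
    define D where "D = {c \<in> S. sep c a d}"
    have dV: "d \<in> V" "d \<notin> cuts" using d by (auto simp: ends_def)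
    have finD: "finite D" using finS by (simp add: D_def)
    have "S \<subseteq> D \<union> {c \<in> S. sep c b d}"
    proof
      fix c assume c: "c \<in> S"
      then have "d \<noteq> c" using S_cuts dV by blast
      then show "c \<in> D \<union> {c \<in> S. sep c b d}"
        using c sep_cotrans[of c a b d] dV Sab sep_sym by (auto simp: D_def)
    qed
    then have "N \<le> card D + card {c \<in> S. sep c b d}"
      using card_mono[of "D \<union> {c \<in> S. sep c b d}" S] card_Un_le[of D "{c \<in> S. sep c b d}"] finD finS
      by (simp add: N_def)
    then have cD: "(N + 1) div 2 \<le> card D" using le by (simp add: D_def)
    \<comment> \<open>\<open>D\<close> is an initial segment of \<open>S\<close> in the order from
      \<open>a\<close>, with at least half of its elements. An element of \<open>S\<close> outside
      \<open>D\<close> has all of \<open>D\<close> before it, which is too many for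
      \<open>Lt\<close>.\<close>
    have "sep c a d" if c: "c \<in> Lt" for c
    proof (rule ccontr)
      assume n: "\<not> sep c a d"
      have "D \<subseteq> {c' \<in> S. sep c' a c}"
      proof
        fix c' assume c': "c' \<in> D"
        then have "c' \<noteq> c" using n by (auto simp: D_def)
        then have "sep c' a c \<or> sep c a c'"
          using sep_comparable[of c' a b c] c' c LtS Sab by (auto simp: D_def)
        then show "c' \<in> {c' \<in> S. sep c' a c}"
          using n c' sep_trans[of c a c' d] by (auto simp: D_def)
      qed
      then have "card D \<le> rk c" unfolding rk_def using finS by (intro card_mono) auto
      then show False using c cD by (simp add: Lt_def)
    qed
    then have "\<forall>c\<in>cuts. e c = a \<longrightarrow> d \<notin> T c" using e_a TL by (auto simp: side_def)
    then show "\<exists>d\<in>ends - {a, b}. \<forall>c\<in>cuts. e c = a \<longrightarrow> d \<notin> T c" using d by blast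
  qed
  then show ?thesis by blast
qed

text \<open>Any third end \<open>d\<close> serves: the names \<open>a\<close> and \<open>b\<close>
  are swapped if fewer separators of the pair lie between \<open>a\<close> and \<open>d\<close> than
  between \<open>b\<close> and \<open>d\<close>.\<close>

lemma ex_chain_decomposition:
  assumes "card V \<ge> 2"
  shows "\<exists>a b e T. chain_decomposition V sep a b e T"
proof -
  define P where "P = {(u, v). u \<in> V \<and> v \<in> V \<and> u \<noteq> v}"
  have "P \<subseteq> V \<times> V" by (auto simp: P_def)
  then have finP: "finite P" using fin finite_subset by blast
  obtain u v where "u \<in> V" "v \<in> V" "u \<noteq> v"
    using assms by (metis card_2_iff' card_le_Suc0_iff_eq fin not_less_eq_eq numeral_2_eq_2)
  then have neP: "P \<noteq> {}" by (auto simp: P_def)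
  define mxv where "mxv = Max ((\<lambda>(u, v). card (separators u v)) ` P)"
  have "mxv \<in> (\<lambda>(u, v). card (separators u v)) ` P"
    unfolding mxv_def using finP neP by (intro Max_in) auto
  then obtain a b where ab: "a \<in> V" "b \<in> V" "a \<noteq> b" and mab: "card (separators a b) = mxv"
    by (auto simp: P_def)
  have mx: "card (separators u v) \<le> card (separators a b)" if "u \<in> V" "v \<in> V" for u v
  proof (cases "u = v")
    case True
    then have "separators u v = {}" using sep_in by (auto simp: separators_def)
    then show ?thesis by simp
  next
    case False
    then have "(u, v) \<in> P" using that by (simp add: P_def)
    then show ?thesis unfolding mab mxv_def using finP by (intro Max_ge) force+
  qed
  have end_of: "y \<in> ends" if xy: "x \<in> V" "y \<in> V" "x \<noteq> y" and
      m: "\<And>u v. u \<in> V \<Longrightarrow> v \<in> V \<Longrightarrow> card (separators u v) \<le> card (separators x y)" for x y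
  proof (rule ccontr)
    assume "y \<notin> ends"
    then have "y \<in> cuts" using xy by (simp add: ends_def)
    then obtain w where w: "sep y x w" using cut_separates xy by blast
    then have "card (separators x y) < card (separators x w)"
      using separators_psubset finite_separators by (intro psubset_card_mono)
    then show False using m[of x w] xy sep_in[OF w] by simp
  qed
  have b: "b \<in> ends" using end_of[OF ab mx] .
  have mx': "card (separators u v) \<le> card (separators b a)" if "u \<in> V" "v \<in> V" for u v
    using mx[OF that] separators_commute[of a b] by simp
  have a: "a \<in> ends" using end_of[OF ab(2,1) _ mx'] ab by blast
  show ?thesis
  proof (cases "card ends \<ge> 3")
    case False
    then show ?thesis using chain_decomposition_of_max_pair[OF a b ab(3) mx] by auto
  next
    case True
    then have "\<not> ends \<subseteq> {a, b}"
      using card_mono[of "{a, b}" ends] ab by auto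
    then obtain d where d: "d \<in> ends - {a, b}" by blast
    show ?thesis
    proof (cases "card {c \<in> separators a b. sep c b d} \<le> card {c \<in> separators a b. sep c a d}")
      case True
      then show ?thesis using chain_decomposition_of_max_pair[OF a b ab(3) mx] d by blast
    next
      case False
      then have "card {c \<in> separators b a. sep c a d} \<le> card {c \<in> separators b a. sep c b d}"
        using separators_commute[of a b] by simp
      then show ?thesis using chain_decomposition_of_max_pair[OF b a ab(3)[symmetric] mx'] d by blast
    qed
  qed
qed

end

section \<open>Distributing the weights of the extremal graph\<close>

lemma ex_monotone_bij:
  fixes f :: "'b \<Rightarrow> nat" and g :: "'c \<Rightarrow> nat"
  assumes "finite A" "finite B" "card A = card B"
  shows "\<exists>\<pi>. bij_betw \<pi> A B \<and> (\<forall>x\<in>A. \<forall>y\<in>A. f x < f y \<longrightarrow> g (\<pi> x) \<le> g (\<pi> y))"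
  using assms
proof (induction "card A" arbitrary: A B)
  case 0
  then show ?case by (auto simp: bij_betw_def)
next
  case (Suc n)
  have "A \<noteq> {}" "B \<noteq> {}" using Suc by auto
  obtain x0 where x0: "x0 \<in> A" "\<And>x. x \<in> A \<Longrightarrow> f x0 \<le> f x"
    using \<open>A \<noteq> {}\<close> arg_min_if_finite[of A f] Suc.prems by (metis linorder_not_le)
  obtain y0 where y0: "y0 \<in> B" "\<And>y. y \<in> B \<Longrightarrow> g y0 \<le> g y"
    using \<open>B \<noteq> {}\<close> arg_min_if_finite[of B g] Suc.prems by (metis linorder_not_le)
  have "n = card (A - {x0})" "card (A - {x0}) = card (B - {y0})"
    using Suc x0 y0 by auto
  then obtain \<pi> where \<pi>: "bij_betw \<pi> (A - {x0}) (B - {y0})"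
    and m: "\<And>x y. x \<in> A - {x0} \<Longrightarrow> y \<in> A - {x0} \<Longrightarrow> f x < f y \<Longrightarrow> g (\<pi> x) \<le> g (\<pi> y)"
    using Suc.hyps(1)[of "A - {x0}" "B - {y0}"] Suc.prems by auto
  let ?\<pi> = "\<pi>(x0 := y0)"
  have im: "\<pi> x \<in> B - {y0}" if "x \<in> A - {x0}" for x using \<pi> that by (auto simp: bij_betw_def)
  have "bij_betw ?\<pi> (A - {x0}) (B - {y0})"
    using \<pi> by (subst bij_betw_cong[of _ _ \<pi>]) auto
  then have "bij_betw ?\<pi> (insert x0 (A - {x0})) (insert y0 (B - {y0}))"
    using notIn_Un_bij_betw[of x0 "A - {x0}" ?\<pi> "B - {y0}"] by simp
  then have "bij_betw ?\<pi> A B" using x0 y0 by (simp add: insert_absorb)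
  moreover have "g (?\<pi> x) \<le> g (?\<pi> y)" if "x \<in> A" "y \<in> A" "f x < f y" for x y
    using that m[of x y] x0(2)[of x] y0(2) im[of y] by (cases "x = x0"; cases "y = x0") auto
  ultimately show ?case by blast
qed

lemma ex_bij_extending:
  assumes "finite A" "finite B" "card A = card B" and A0: "A0 \<subseteq> A" "inj_on s A0" "s ` A0 \<subseteq> B"
  shows "\<exists>\<sigma>. bij_betw \<sigma> A B \<and> (\<forall>x\<in>A0. \<sigma> x = s x)"
proof -
  have "card (A - A0) = card (B - s ` A0)"
    using assms by (simp add: card_Diff_subset card_image finite_subset)
  then obtain r where r: "bij_betw r (A - A0) (B - s ` A0)"
    using finite_same_card_bij[of "A - A0" "B - s ` A0"] assms by auto
  define \<sigma> where "\<sigma> x = (if x \<in> A0 then s x else r x)" for x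
  have "bij_betw \<sigma> A0 (s ` A0)"
    using A0 by (auto simp: \<sigma>_def bij_betw_def inj_on_def)
  moreover have "bij_betw \<sigma> (A - A0) (B - s ` A0)"
    using r by (subst bij_betw_cong[of _ _ r]) (auto simp: \<sigma>_def)
  ultimately have "bij_betw \<sigma> (A0 \<union> (A - A0)) (s ` A0 \<union> (B - s ` A0))"
    by (rule bij_betw_combine) auto
  moreover have "A0 \<union> (A - A0) = A" "s ` A0 \<union> (B - s ` A0) = B" using A0 by auto
  ultimately show ?thesis by (metis \<sigma>_def)
qed

section \<open>Cells, branches and tails of the extremal graph\<close>

definition cells :: "nat \<Rightarrow> (nat \<Rightarrow> nat) \<Rightarrow> (nat \<times> nat) set" where
  "cells m l = {(i, j). i < m \<and> j \<le> l i}"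

definition branch :: "(nat \<Rightarrow> nat) \<Rightarrow> nat \<Rightarrow> (nat \<times> nat) set" where
  "branch l i = Pair i ` {..l i}"

text \<open>The part of its path that deleting \<open>p\<close> cuts off from the other paths;
  \<open>tail_of l (i, 0)\<close> is branch \<open>i\<close> without its root.\<close>

definition tail_of :: "(nat \<Rightarrow> nat) \<Rightarrow> nat \<times> nat \<Rightarrow> (nat \<times> nat) set" where
  "tail_of l p = Pair (fst p) ` {snd p<..l (fst p)}"

lemma cells_eq_Sigma: "cells m l = (SIGMA i:{..<m}. {..l i})"
  by (auto simp: cells_def)

lemma finite_cells [simp]: "finite (cells m l)"
  by (simp add: cells_eq_Sigma)

lemma card_cells: "card (cells m l) = m + (\<Sum>i<m. l i)"
  by (simp add: cells_eq_Sigma sum_Suc)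

lemma finite_branch [simp]: "finite (branch l i)" and finite_tail_of [simp]: "finite (tail_of l p)"
  by (auto simp: branch_def tail_of_def)

lemma tail_of_subset_cells: "fst p < m \<Longrightarrow> tail_of l p \<subseteq> cells m l"
  by (auto simp: tail_of_def cells_def)

lemma branch_subset_cells: "i < m \<Longrightarrow> branch l i \<subseteq> cells m l"
  by (auto simp: branch_def cells_def)

text \<open>The pairs are ordered, which is the origin of the factor 2 in
  \<open>tail_weight\<close>.\<close>

definition pair_weight :: "('v \<Rightarrow> 'v \<Rightarrow> 'v \<Rightarrow> bool) \<Rightarrow> ('v \<Rightarrow> real) \<Rightarrow> 'v \<Rightarrow> real" where
  "pair_weight sep y c = (\<Sum>(u, v)\<in>{(u, v). sep c u v}. y u * y v)"

text \<open>The value of \<open>pair_weight\<close> at the cell \<open>p\<close> of the extremal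
  graph, in a closed form that can be used before the separators of that graph are known.\<close>

definition tail_weight ::
  "nat \<Rightarrow> (nat \<Rightarrow> nat) \<Rightarrow> (nat \<times> nat \<Rightarrow> real) \<Rightarrow> nat \<times> nat \<Rightarrow> real" where
  "tail_weight m l x p =
    2 * sum x (tail_of l p) * (sum x (cells m l) - x p - sum x (tail_of l p))"

section \<open>Positions inside the chains\<close>

context chain_decomposition
begin

definition chain :: "'a \<Rightarrow> 'a set" where "chain d = {c \<in> cuts. e c = d}"

definition tip :: "'a \<Rightarrow> 'a" where "tip v = (if v \<in> ends then v else e v)"

text \<open>The intended distance from the free end of a path: an end has 0, and a cut vertex comes
  after the members of its chain that lie in \<open>T v\<close>.\<close>

definition rank :: "'a \<Rightarrow> nat" where
  "rank v = (if v \<in> ends then 0 else Suc (card {c \<in> chain (e v). c \<in> T v}))"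

lemma chain_subset: "chain d \<subseteq> cuts"
  by (auto simp: chain_def)

lemma finite_chain: "finite (chain d)"
  using finite_subset[OF chain_subset finite_cuts] .

lemma cuts_not_ends: "c \<in> cuts \<Longrightarrow> c \<notin> ends"
  by (simp add: ends_def)

lemma V_cases: "v \<in> V \<Longrightarrow> v \<in> ends \<or> v \<in> cuts"
  by (simp add: ends_def)

lemma ends_subset: "ends \<subseteq> V"
  by (auto simp: ends_def)

lemma tip_ends: "v \<in> V \<Longrightarrow> tip v \<in> ends"
  using V_cases e_ends by (auto simp: tip_def)

lemma tip_chain: "c \<in> chain d \<Longrightarrow> tip c = d"
  using cuts_not_ends by (auto simp: tip_def chain_def)

lemma bij_betw_rank_chain: "bij_betw rank (chain d) {1..card (chain d)}"
proof -
  have "bij_betw (\<lambda>c. card {c' \<in> chain d. c' \<in> T c}) (chain d) {..<card (chain d)}"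
  proof (rule bij_betw_rank)
    show "c \<notin> T c" if "c \<in> chain d" for c using that T_subset[of c] by (auto simp: chain_def)
    show "c1 \<in> T c3" if "c1 \<in> chain d" "c2 \<in> chain d" "c3 \<in> chain d" "c1 \<in> T c2" "c2 \<in> T c3"
      for c1 c2 c3 using that chain_nested[of c3 c2] by (auto simp: chain_def)
    show "c1 \<in> T c2 \<or> c2 \<in> T c1" if "c1 \<in> chain d" "c2 \<in> chain d" "c1 \<noteq> c2" for c1 c2
      using that chain_total[of c1 c2] by (auto simp: chain_def)
  qed (rule finite_chain)
  moreover have "bij_betw Suc {..<card (chain d)} {1..card (chain d)}"
    by (simp add: bij_betw_def image_Suc_lessThan)
  ultimately have "bij_betw (Suc \<circ> (\<lambda>c. card {c' \<in> chain d. c' \<in> T c})) (chain d) {1..card (chain d)}"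
    by (rule bij_betw_trans)
  moreover have "bij_betw rank (chain d) {1..card (chain d)} \<longleftrightarrow>
      bij_betw (Suc \<circ> (\<lambda>c. card {c' \<in> chain d. c' \<in> T c})) (chain d) {1..card (chain d)}"
    using cuts_not_ends by (intro bij_betw_cong) (auto simp: rank_def chain_def)
  ultimately show ?thesis by blast
qed

lemma rank_less:
  assumes "c \<in> chain d" "c' \<in> chain d" "c' \<in> T c"
  shows "rank c' < rank c"
proof -
  have c: "c \<in> cuts" "c' \<in> cuts" "e c = d" "e c' = d" using assms by (auto simp: chain_def)
  have "T c' \<subseteq> T c" using chain_nested[of c c'] c assms(3) by simp
  moreover have "c' \<notin> T c'" using T_subset[OF c(2)] by blast
  ultimately have "{x \<in> chain d. x \<in> T c'} \<subset> {x \<in> chain d. x \<in> T c}"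
    using assms(2,3) by blast
  then have "card {x \<in> chain d. x \<in> T c'} < card {x \<in> chain d. x \<in> T c}"
    using finite_chain by (intro psubset_card_mono) auto
  then show ?thesis using c cuts_not_ends by (simp add: rank_def)
qed

lemma rank_less_imp:
  assumes "c \<in> chain d" "c' \<in> chain d" "rank c' < rank c"
  shows "c' \<in> T c"
  using assms chain_total[of c c'] rank_less[of c' d c] by (force simp: chain_def)

lemma ex_rank:
  assumes "d \<in> ends" "h \<le> card (chain d)"
  shows "\<exists>v \<in> insert d (chain d). rank v = h"
proof (cases h)
  case 0
  then show ?thesis using assms by (auto simp: rank_def)
next
  case (Suc h')
  then have "h \<in> rank ` chain d" using bij_betw_rank_chain[of d] assms by (auto simp: bij_betw_def)
  then show ?thesis by auto
qed

lemma sum_card_chains: "(\<Sum>d\<in>ends. card (chain d)) = card cuts"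
proof -
  have "(\<Sum>d\<in>ends. \<Sum>c\<in>{c \<in> cuts. e c = d}. 1) = (\<Sum>c\<in>cuts. 1::nat)"
    using e_ends by (intro sum.group finite_cuts finite_ends) auto
  then show ?thesis by (simp add: chain_def)
qed

lemma rank_inj:
  assumes "v \<in> V" "w \<in> V" "tip v = tip w" "rank v = rank w"
  shows "v = w"
proof -
  have pos: "rank c > 0" if "c \<in> cuts" for c using that cuts_not_ends by (simp add: rank_def)
  have zero: "rank d = 0" if "d \<in> ends" for d using that by (simp add: rank_def)
  consider "v \<in> ends" "w \<in> ends" | "v \<in> cuts" "w \<in> cuts"
    using V_cases[OF assms(1)] V_cases[OF assms(2)] pos zero assms(4) by fastforce
  then show ?thesis
  proof cases
    case 1
    then show ?thesis using assms by (simp add: tip_def)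
  next
    case 2
    then have "v \<in> chain (tip v)" "w \<in> chain (tip v)"
      using assms(3) cuts_not_ends by (auto simp: chain_def tip_def)
    then show ?thesis
      using bij_betw_rank_chain[of "tip v"] assms(4) by (auto simp: bij_betw_def dest: inj_onD)
  qed
qed

text \<open>
  The factor 3 lets the chain length dominate; the small summands put \<open>a\<close> first and \<open>b\<close>
  second among chains of equal length.
\<close>

lemma ex_sorted_labelling:
  assumes m: "card ends = m" and k: "(\<Sum>i<m. l i) = card cuts"
    and near: "\<And>i j. i < m \<Longrightarrow> j < m \<Longrightarrow> l i \<le> Suc (l j)"
  obtains \<pi> where "bij_betw \<pi> ends {..<m}"
    and "\<And>d. d \<in> ends \<Longrightarrow> l (\<pi> d) \<le> l (\<pi> a)"
    and "\<And>d. d \<in> ends \<Longrightarrow> d \<noteq> a \<Longrightarrow> l (\<pi> d) \<le> l (\<pi> b)"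
    and "l (\<pi> a) \<le> card (chain a)" and "l (\<pi> b) \<le> card (chain b)"
    and "\<And>d d'. d \<in> ends \<Longrightarrow> d' \<in> ends \<Longrightarrow> l (\<pi> d) < card (chain d) \<Longrightarrow>
      card (chain d') < l (\<pi> d') \<Longrightarrow> l (\<pi> d') \<le> l (\<pi> d)"
proof -
  define s where "s d = card (chain d)" for d
  define f where "f d = 3 * s d + (if d = a then 2 else if d = b then 1 else 0)" for d
  obtain \<pi> where \<pi>: "bij_betw \<pi> ends {..<m}"
    and mono: "\<And>x y. x \<in> ends \<Longrightarrow> y \<in> ends \<Longrightarrow> f x < f y \<Longrightarrow> l (\<pi> x) \<le> l (\<pi> y)"
    using ex_monotone_bij[of ends "{..<m}" f l] finite_ends m by auto
  have \<pi>m: "\<pi> d < m" if "d \<in> ends" for d using \<pi> that by (auto simp: bij_betw_def)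
  have near': "l (\<pi> d) \<le> Suc (l (\<pi> d'))" if "d \<in> ends" "d' \<in> ends" for d d'
    using near \<pi>m that by blast
  have sb: "s d \<le> s b" if "d \<in> ends" "d \<noteq> a" for d
    using chain_le[of d] that by (cases "d = b") (auto simp: s_def chain_def)
  have sab: "s b \<le> s a" "s a \<le> Suc (s b)" using chain_ab by (auto simp: s_def chain_def)
  have sa: "s d \<le> s a" if "d \<in> ends" for d
    using sb[of d] sab that by (cases "d = a") auto
  have la: "l (\<pi> d) \<le> l (\<pi> a)" if "d \<in> ends" for d
    using mono[of d a] sa[OF that] that ab by (cases "d = a"; cases "d = b") (auto simp: f_def)
  have lb: "l (\<pi> d) \<le> l (\<pi> b)" if "d \<in> ends" "d \<noteq> a" for d
    using mono[of d b] sb[OF that] that ab by (cases "d = b") (auto simp: f_def)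
  have tot: "(\<Sum>d\<in>ends. l (\<pi> d)) = (\<Sum>d\<in>ends. s d)"
    unfolding s_def sum_card_chains k[symmetric] by (rule sum.reindex_bij_betw[OF \<pi>])
  \<comment> \<open>The totals agree, so if every path is at least as long as its chain, none is
    strictly longer.\<close>
  have nl: "\<not> s x < l (\<pi> x)" if "x \<in> ends" "\<And>d. d \<in> ends \<Longrightarrow> s d \<le> l (\<pi> d)" for x
  proof
    assume "s x < l (\<pi> x)"
    then have "(\<Sum>d\<in>ends. s d) < (\<Sum>d\<in>ends. l (\<pi> d))"
      using that finite_ends by (intro sum_strict_mono_ex1) auto
    then show False using tot by simp
  qed
  \<comment> \<open>A path longer than the longest chain would, by \<open>near\<close>, make every
    path at least as long as its chain.\<close>
  have "l (\<pi> a) \<le> s a"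
  proof (rule ccontr)
    assume n: "\<not> ?thesis"
    have "s d \<le> l (\<pi> d)" if "d \<in> ends" for d
      using sa[OF that] near'[OF ab(1) that] n by linarith
    then show False using nl[OF ab(1)] n by simp
  qed
  moreover have "l (\<pi> b) \<le> s b"
  proof (rule ccontr)
    assume n: "\<not> ?thesis"
    have "s d \<le> l (\<pi> d)" if "d \<in> ends" for d
      using sb[OF that] near'[OF ab(2) that] n sab la[OF ab(2)] by (cases "d = a") auto
    then show False using nl[OF ab(2)] n by simp
  qed
  moreover have "l (\<pi> d') \<le> l (\<pi> d)"
    if "d \<in> ends" "d' \<in> ends" "l (\<pi> d) < s d" "s d' < l (\<pi> d')" for d d'
  proof (rule ccontr)
    assume n: "\<not> ?thesis"
    then have "s d' < s d" using near'[OF that(2,1)] that by linarith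
    then have "f d' < f d" by (auto simp: f_def)
    then show False using mono[OF that(2,1)] n by simp
  qed
  ultimately show thesis using that[OF \<pi> la lb] by (simp add: s_def)
qed

end

text \<open>\<open>\<pi>\<close> matches ends with paths, \<open>\<sigma>\<close> vertices with
  cells. A vertex whose rank fits its path sits at that distance from the free end. On the misfits
  \<open>\<sigma>\<close> is an arbitrary completion to a bijection, and \<open>\<pi>_excess\<close>
  limits the paths on which they can land.\<close>

locale weight_assignment = chain_decomposition +
  fixes m :: nat and l :: "nat \<Rightarrow> nat" and x :: "nat \<times> nat \<Rightarrow> real"
    and \<pi> :: "'a \<Rightarrow> nat" and \<sigma> :: "'a \<Rightarrow> nat \<times> nat"
  assumes k: "(\<Sum>i<m. l i) = card cuts"
    and near: "\<And>i j. i < m \<Longrightarrow> j < m \<Longrightarrow> l i \<le> Suc (l j)"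
    and x_pos: "\<And>p. p \<in> cells m l \<Longrightarrow> x p > 0"
    and branch_heavy: "\<And>i j. i < m \<Longrightarrow> j < m \<Longrightarrow> l j \<le> l i \<Longrightarrow>
      sum x (tail_of l (j, 0)) < sum x (branch l i)"
    and branch_end_heavy: "\<And>i j j'. i < m \<Longrightarrow> j < m \<Longrightarrow> j' < m \<Longrightarrow> l i = Suc (l j) \<Longrightarrow>
      l i = Suc (l j') \<Longrightarrow> sum x (tail_of l (i, 0)) < sum x (branch l j) + x (j', l j')"
    and \<pi>: "bij_betw \<pi> ends {..<m}"
    and \<pi>_a: "\<And>d. d \<in> ends \<Longrightarrow> l (\<pi> d) \<le> l (\<pi> a)"
    and \<pi>_b: "\<And>d. d \<in> ends \<Longrightarrow> d \<noteq> a \<Longrightarrow> l (\<pi> d) \<le> l (\<pi> b)"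
    and full_ab: "l (\<pi> a) \<le> card (chain a)" "l (\<pi> b) \<le> card (chain b)"
    and \<pi>_excess: "\<And>d d'. d \<in> ends \<Longrightarrow> d' \<in> ends \<Longrightarrow> l (\<pi> d) < card (chain d) \<Longrightarrow>
      card (chain d') < l (\<pi> d') \<Longrightarrow> l (\<pi> d') \<le> l (\<pi> d)"
    and \<sigma>: "bij_betw \<sigma> V (cells m l)"
    and \<sigma>_regular: "\<And>v. v \<in> V \<Longrightarrow> rank v \<le> l (\<pi> (tip v)) \<Longrightarrow>
      \<sigma> v = (\<pi> (tip v), l (\<pi> (tip v)) - rank v)"
begin

section \<open>Both sides of a cut vertex against the tail of its image\<close>

lemma m: "card ends = m"
  using bij_betw_same_card[OF \<pi>] by simp

lemma \<pi>_less: "d \<in> ends \<Longrightarrow> \<pi> d < m"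
  using \<pi> by (auto simp: bij_betw_def)

lemma inj_\<sigma>: "inj_on \<sigma> V"
  using \<sigma> by (simp add: bij_betw_def)

lemma \<sigma>_cells: "v \<in> V \<Longrightarrow> \<sigma> v \<in> cells m l"
  using \<sigma> by (auto simp: bij_betw_def)

lemma \<sigma>_fst: "v \<in> V \<Longrightarrow> fst (\<sigma> v) < m"
  using \<sigma>_cells[of v] by (auto simp: cells_def)

lemma \<sigma>_end: "d \<in> ends \<Longrightarrow> \<sigma> d = (\<pi> d, l (\<pi> d))"
  using \<sigma>_regular[of d] ends_subset by (auto simp: rank_def tip_def)

lemma image_subset_cells: "A \<subseteq> V \<Longrightarrow> \<sigma> ` A \<subseteq> cells m l"
  using \<sigma>_cells by blast

lemma sum_mono_cells:
  assumes "A \<subseteq> B" "B \<subseteq> cells m l"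
  shows "sum x A \<le> sum x B"
proof (rule sum_mono2)
  show "finite B" using assms(2) finite_cells by (rule finite_subset)
  show "0 \<le> x p" if "p \<in> B - A" for p using that assms(2) x_pos[of p] by auto
qed fact

lemma sum_strict_mono_cells:
  assumes "A \<subset> B" "B \<subseteq> cells m l"
  shows "sum x A < sum x B"
proof -
  obtain q where "q \<in> B" "q \<notin> A" using assms(1) by blast
  then show ?thesis
  proof (intro sum_strict_mono2[where b = q])
    show "finite B" using assms(2) finite_cells by (rule finite_subset)
    show "0 < x q" using \<open>q \<in> B\<close> assms(2) x_pos[of q] by auto
    show "0 \<le> x p" if "p \<in> B" for p using that assms(2) x_pos[of p] by auto
  qed (use assms(1) in auto)
qed

lemma sum_tail_le: "p \<in> cells m l \<Longrightarrow> sum x (tail_of l p) \<le> sum x (tail_of l (fst p, 0))"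
  by (rule sum_mono_cells) (auto simp: tail_of_def cells_def)

lemma ex_cell:
  assumes d: "d \<in> ends" and h: "h \<le> card (chain d)" "h \<le> l (\<pi> d)"
  shows "\<exists>v \<in> insert d (chain d). rank v = h \<and> \<sigma> v = (\<pi> d, l (\<pi> d) - h)"
proof -
  obtain v where v: "v \<in> insert d (chain d)" "rank v = h" using ex_rank[OF d h(1)] by blast
  then have "v \<in> V" using d ends_subset chain_subset cuts_subset by blast
  moreover have "tip v = d" using v d tip_chain[of v d] by (auto simp: tip_def)
  ultimately show ?thesis using \<sigma>_regular[of v] v h by auto
qed

lemma branch_covered:
  assumes d: "d \<in> ends" and full: "l (\<pi> d) \<le> card (chain d)"
  shows "branch l (\<pi> d) \<subseteq> \<sigma> ` insert d (chain d)"
proof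
  fix p assume "p \<in> branch l (\<pi> d)"
  then obtain j where j: "p = (\<pi> d, j)" "j \<le> l (\<pi> d)" by (auto simp: branch_def)
  then have h: "l (\<pi> d) - j \<le> card (chain d)" using full by simp
  obtain v where "v \<in> insert d (chain d)" "\<sigma> v = (\<pi> d, l (\<pi> d) - (l (\<pi> d) - j))"
    using ex_cell[OF d h] by auto
  then show "p \<in> \<sigma> ` insert d (chain d)" using j by force
qed

lemma below_in_T:
  assumes c: "c \<in> cuts" and h: "h < rank c" "h \<le> l (\<pi> (e c))"
  shows "(\<pi> (e c), l (\<pi> (e c)) - h) \<in> \<sigma> ` T c"
proof -
  have cc: "c \<in> chain (e c)" using c by (simp add: chain_def)
  then have "rank c \<in> {1..card (chain (e c))}"
    using bij_betw_rank_chain[of "e c"] by (auto simp: bij_betw_def)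
  then have "h \<le> card (chain (e c))" using h by simp
  then obtain v where v: "v \<in> insert (e c) (chain (e c))" "rank v = h"
    "\<sigma> v = (\<pi> (e c), l (\<pi> (e c)) - h)"
    using ex_cell[OF e_ends[OF c] _ h(2)] by blast
  then have "v \<in> T c" using e_T[OF c] rank_less_imp[OF cc, of v] h by auto
  then show ?thesis using v by force
qed

lemma tail_subset_T:
  assumes c: "c \<in> cuts" and reg: "rank c \<le> l (\<pi> (e c))"
  shows "tail_of l (\<sigma> c) \<subseteq> \<sigma> ` T c"
proof
  fix p assume p: "p \<in> tail_of l (\<sigma> c)"
  have t: "tip c = e c" using c cuts_not_ends by (simp add: tip_def)
  have "c \<in> V" using c cuts_subset by blast
  then have "\<sigma> c = (\<pi> (e c), l (\<pi> (e c)) - rank c)" using \<sigma>_regular[of c] reg t by simp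
  then obtain j where j: "p = (\<pi> (e c), j)" "l (\<pi> (e c)) - rank c < j" "j \<le> l (\<pi> (e c))"
    using p by (auto simp: tail_of_def)
  then have "(\<pi> (e c), l (\<pi> (e c)) - (l (\<pi> (e c)) - j)) \<in> \<sigma> ` T c"
    using reg by (intro below_in_T[OF c]) auto
  then show "p \<in> \<sigma> ` T c" using j by simp
qed

lemma branch_subset_T:
  assumes c: "c \<in> cuts" and irr: "l (\<pi> (e c)) < rank c"
  shows "branch l (\<pi> (e c)) \<subseteq> \<sigma> ` T c"
proof
  fix p assume "p \<in> branch l (\<pi> (e c))"
  then obtain j where j: "p = (\<pi> (e c), j)" "j \<le> l (\<pi> (e c))" by (auto simp: branch_def)
  then have "(\<pi> (e c), l (\<pi> (e c)) - (l (\<pi> (e c)) - j)) \<in> \<sigma> ` T c"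
    using irr by (intro below_in_T[OF c]) auto
  then show "p \<in> \<sigma> ` T c" using j by simp
qed

text \<open>A path no longer than its chain is filled by its own end and chain, so a misfit
  \<open>c\<close> lands on a path longer than its chain. The path of \<open>e c\<close> is shorter
  than the chain of \<open>c\<close>, and \<open>\<pi>_excess\<close> compares the two
  paths.\<close>

lemma irregular_branch_long:
  assumes c: "c \<in> cuts" and irr: "l (\<pi> (e c)) < rank c"
  shows "l (fst (\<sigma> c)) \<le> l (\<pi> (e c))"
proof -
  have cV: "c \<in> V" using c cuts_subset by blast
  have "fst (\<sigma> c) \<in> \<pi> ` ends" using \<sigma>_fst[OF cV] \<pi> by (simp add: bij_betw_def)
  then obtain d where d: "d \<in> ends" "fst (\<sigma> c) = \<pi> d" by blast
  have "card (chain d) < l (\<pi> d)"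
  proof (rule ccontr)
    assume "\<not> ?thesis"
    then have full: "l (\<pi> d) \<le> card (chain d)" by simp
    define h where "h = l (\<pi> d) - snd (\<sigma> c)"
    have "snd (\<sigma> c) \<le> l (\<pi> d)" using \<sigma>_cells[OF cV] d by (auto simp: cells_def)
    then have h: "h \<le> card (chain d)" "h \<le> l (\<pi> d)" and "(\<pi> d, l (\<pi> d) - h) = \<sigma> c"
      using full d(2) by (auto simp: h_def prod_eq_iff)
    then obtain v where v: "v \<in> insert d (chain d)" "rank v = h" "\<sigma> v = \<sigma> c"
      using ex_cell[OF d(1) h] by auto
    moreover have "v \<in> V" using v d ends_subset chain_subset cuts_subset by blast
    ultimately have "v = c" using cV inj_\<sigma> by (auto dest: inj_onD)
    then have "c \<in> chain d" using v c d cuts_not_ends by auto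
    then have "d = e c" by (simp add: chain_def)
    then show False using irr v \<open>v = c\<close> by (simp add: h_def)
  qed
  moreover have "l (\<pi> (e c)) < card (chain (e c))"
  proof -
    have "c \<in> chain (e c)" using c by (simp add: chain_def)
    then have "rank c \<in> {1..card (chain (e c))}"
      using bij_betw_rank_chain[of "e c"] by (auto simp: bij_betw_def)
    then show ?thesis using irr by simp
  qed
  ultimately show ?thesis using \<pi>_excess[OF e_ends[OF c] d(1)] d(2) by simp
qed

text \<open>If the rank of \<open>c\<close> fits, the tail consists of images of \<open>T c\<close>.
  Otherwise the images of \<open>T c\<close> cover a whole branch, which by
  \<open>branch_heavy\<close> outweighs the rootless branch on which \<open>c\<close> landed.
  Strictness there excludes misfits in the case of equality.\<close>

lemma T_weight:
  assumes c: "c \<in> cuts"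
  shows "sum x (tail_of l (\<sigma> c)) \<le> sum x (\<sigma> ` T c)"
    and "l (\<pi> (e c)) < rank c \<Longrightarrow> sum x (tail_of l (\<sigma> c)) < sum x (\<sigma> ` T c)"
proof -
  have cV: "c \<in> V" using c cuts_subset by blast
  have TV: "\<sigma> ` T c \<subseteq> cells m l" using T_subset[OF c] by (intro image_subset_cells) auto
  show irr: "sum x (tail_of l (\<sigma> c)) < sum x (\<sigma> ` T c)" if i: "l (\<pi> (e c)) < rank c"
  proof -
    have "sum x (tail_of l (\<sigma> c)) \<le> sum x (tail_of l (fst (\<sigma> c), 0))"
      by (rule sum_tail_le[OF \<sigma>_cells[OF cV]])
    also have "\<dots> < sum x (branch l (\<pi> (e c)))"
      using irregular_branch_long[OF c i] \<sigma>_fst[OF cV] \<pi>_less[OF e_ends[OF c]]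
      by (intro branch_heavy) auto
    also have "\<dots> \<le> sum x (\<sigma> ` T c)" by (rule sum_mono_cells[OF branch_subset_T[OF c i] TV])
    finally show ?thesis .
  qed
  show "sum x (tail_of l (\<sigma> c)) \<le> sum x (\<sigma> ` T c)"
    using irr sum_mono_cells[OF tail_subset_T[OF c] TV] by fastforce
qed

definition rest :: "'a \<Rightarrow> 'a set" where "rest c = V - T c - {c}"

lemma rest_weight_ge:
  assumes d: "d \<in> ends" "l (\<pi> d) \<le> card (chain d)"
    and sub: "insert d (chain d) \<subseteq> rest c"
  shows "sum x (branch l (\<pi> d)) \<le> sum x (\<sigma> ` rest c)"
proof (rule sum_mono_cells)
  show "branch l (\<pi> d) \<subseteq> \<sigma> ` rest c" using branch_covered[OF d] sub by blast
  show "\<sigma> ` rest c \<subseteq> cells m l" by (rule image_subset_cells) (auto simp: rest_def)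
qed

lemma rest_contains_a:
  assumes "c \<in> cuts" "e c \<noteq> a"
  shows "insert a (chain a) \<subseteq> rest c"
  using assms a_avoided[OF assms] ab(1) ends_subset cuts_subset cuts_not_ends[of c]
  by (auto simp: rest_def chain_def)

lemma rest_contains_b:
  assumes "c \<in> cuts" "e c = a"
  shows "insert b (chain b) \<subseteq> rest c"
  using assms b_avoided[OF assms] ab(2,3) ends_subset cuts_subset cuts_not_ends[of c]
  by (auto simp: rest_def chain_def)

text \<open>With two ends both paths are exactly as long as their chains, so the chain of
  \<open>a\<close> sits at its prescribed places. This case has no third end for
  \<open>rest_weight\<close> to use.\<close>

lemma two_ends_T_image:
  assumes m2: "m = 2" and c: "c \<in> cuts" "e c = a"
  shows "\<sigma> ` T c \<subseteq> tail_of l (\<sigma> c)"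
proof -
  have "card {a, b} = card ends" using m m2 ab by simp
  then have E: "ends = {a, b}"
    using ab finite_ends by (metis card_subset_eq empty_subsetI insert_subset)
  have "card (chain a) + card (chain b) = card cuts"
    using sum_card_chains ab by (simp add: E)
  moreover have "l (\<pi> a) + l (\<pi> b) = card cuts"
    using sum.reindex_bij_betw[OF \<pi>, of l] k ab by (simp add: E)
  ultimately have len: "card (chain a) = l (\<pi> a)" using full_ab by linarith
  have reg: "\<sigma> v = (\<pi> a, l (\<pi> a) - rank v) \<and> rank v \<le> l (\<pi> a)" if v: "v \<in> chain a" for v
  proof -
    have "v \<in> V" using v chain_subset cuts_subset by blast
    moreover have "rank v \<in> {1..card (chain a)}"
      using v bij_betw_rank_chain[of a] by (auto simp: bij_betw_def)
    ultimately show ?thesis using \<sigma>_regular[of v] tip_chain[OF v] len by simp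
  qed
  have ca: "c \<in> chain a" using c by (simp add: chain_def)
  have rc: "rank c > 0" using c cuts_not_ends by (simp add: rank_def)
  show ?thesis
  proof
    fix p assume "p \<in> \<sigma> ` T c"
    then obtain v where v: "v \<in> T c" "p = \<sigma> v" by blast
    have vV: "v \<in> V" using v T_subset[OF c(1)] by blast
    have "v \<noteq> b" "v \<notin> chain b" using v b_avoided[OF c] by (auto simp: chain_def)
    then have "v = a \<or> v \<in> chain a"
      using V_cases[OF vV] e_ends[of v] E by (auto simp: chain_def)
    then show "p \<in> tail_of l (\<sigma> c)"
    proof
      assume "v = a"
      then show ?thesis using v \<sigma>_end[OF ab(1)] reg[OF ca] rc by (auto simp: tail_of_def)
    next
      assume va: "v \<in> chain a"
      then have "rank v < rank c" using rank_less[OF ca] v by blast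
      then show ?thesis using v reg[OF ca] reg[OF va] by (auto simp: tail_of_def)
    qed
  qed
qed

text \<open>The alternative is what the product in \<open>sep_weight_bound\<close> needs: a strictly
  heavy second factor or a vanishing first one. The images of \<open>rest c\<close> cover the path
  of \<open>a\<close>, or that of \<open>b\<close> if \<open>c\<close> is charged to
  \<open>a\<close>.\<close>

lemma rest_weight:
  assumes c: "c \<in> cuts"
  shows "sum x (tail_of l (\<sigma> c)) < sum x (\<sigma> ` rest c) \<or>
    sum x (\<sigma> ` T c) = sum x (tail_of l (\<sigma> c))"
proof -
  have cV: "c \<in> V" using c cuts_subset by blast
  obtain d0 where d0: "d0 \<in> ends" "\<pi> d0 = fst (\<sigma> c)"
    using \<sigma>_fst[OF cV] \<pi> by (metis bij_betw_def imageE lessThan_iff)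
  note tail = sum_tail_le[OF \<sigma>_cells[OF cV]]
  show ?thesis
  proof (cases "e c = a")
    case False
    have "sum x (tail_of l (fst (\<sigma> c), 0)) < sum x (branch l (\<pi> a))"
      using \<pi>_a[OF d0(1)] d0(2) \<pi>_less[OF ab(1)] \<sigma>_fst[OF cV] by (intro branch_heavy) auto
    also have "\<dots> \<le> sum x (\<sigma> ` rest c)"
      by (rule rest_weight_ge[OF ab(1) full_ab(1) rest_contains_a[OF c False]])
    finally show ?thesis using tail by simp
  next
    case True
    have B: "sum x (branch l (\<pi> b)) \<le> sum x (\<sigma> ` rest c)"
      by (rule rest_weight_ge[OF ab(2) full_ab(2) rest_contains_b[OF c True]])
    show ?thesis
    proof (cases "l (fst (\<sigma> c)) \<le> l (\<pi> b)")
      case le: True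
      then have "sum x (tail_of l (fst (\<sigma> c), 0)) < sum x (branch l (\<pi> b))"
        using \<pi>_less[OF ab(2)] \<sigma>_fst[OF cV] by (intro branch_heavy) auto
      then show ?thesis using B tail by simp
    next
      case long: False
      have m2: "2 \<le> m" using card_mono[OF finite_ends, of "{a, b}"] ab m by simp
      show ?thesis
      proof (cases "m = 2")
        case True
        have "sum x (\<sigma> ` T c) \<le> sum x (tail_of l (\<sigma> c))"
          by (rule sum_mono_cells[OF two_ends_T_image[OF True c \<open>e c = a\<close>]
                tail_of_subset_cells[OF \<sigma>_fst[OF cV]]])
        then show ?thesis using T_weight(1)[OF c] by simp
      next
        case False
        \<comment> \<open>\<open>branch_heavy\<close> does not apply, because the image of
          \<open>c\<close> lies on a path longer than that of \<open>b\<close>. The third end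
          \<open>d\<close> also belongs to \<open>rest c\<close> and adds the weight of its free
          end.\<close>
        then obtain d where d: "d \<in> ends" "d \<noteq> a" "d \<noteq> b" "d \<notin> T c"
          using third m m2 c True by auto
        have db: "l (\<pi> d) \<le> l (\<pi> b)" using \<pi>_b d by blast
        have "l (fst (\<sigma> c)) \<le> Suc (l (\<pi> d))" "l (fst (\<sigma> c)) \<le> Suc (l (\<pi> b))"
          using near \<sigma>_fst[OF cV] \<pi>_less d ab by auto
        then have "l (fst (\<sigma> c)) = Suc (l (\<pi> b))" "l (fst (\<sigma> c)) = Suc (l (\<pi> d))"
          using long db by auto
        then have "sum x (tail_of l (fst (\<sigma> c), 0)) < sum x (branch l (\<pi> b)) + x (\<pi> d, l (\<pi> d))"
          using \<sigma>_fst[OF cV] \<pi>_less d ab by (intro branch_end_heavy) auto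
        also have "\<dots> = sum x (insert (\<sigma> d) (branch l (\<pi> b)))"
        proof -
          have "\<pi> d \<noteq> \<pi> b" using \<pi> d ab by (auto simp: bij_betw_def dest: inj_onD)
          then have "\<sigma> d \<notin> branch l (\<pi> b)" using \<sigma>_end[OF d(1)] by (auto simp: branch_def)
          then show ?thesis using \<sigma>_end[OF d(1)] by simp
        qed
        also have "\<dots> \<le> sum x (\<sigma> ` rest c)"
        proof (rule sum_mono_cells)
          have "d \<in> rest c" using d c ends_subset cuts_not_ends by (auto simp: rest_def)
          then show "insert (\<sigma> d) (branch l (\<pi> b)) \<subseteq> \<sigma> ` rest c"
            using branch_covered[OF ab(2) full_ab(2)] rest_contains_b[OF c True] by blast
          show "\<sigma> ` rest c \<subseteq> cells m l" by (rule image_subset_cells) (auto simp: rest_def)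
        qed
        finally show ?thesis using tail by simp
      qed
    qed
  qed
qed

lemma sep_pairs_subset: "{(u, v). sep c u v} \<subseteq> V \<times> V"
  using sep_in by blast

lemma x\<sigma>_pos: "v \<in> V \<Longrightarrow> x (\<sigma> v) > 0"
  using x_pos \<sigma>_cells by blast

text \<open>Let A and B be the weights of \<open>T c\<close> and \<open>rest c\<close>. Since A + B
  is the total without the image of \<open>c\<close>, the product A B exceeds s (A + B - s) by (A -
  s) (B - s), which is nonnegative. Pairs separated inside \<open>T c\<close> or inside
  \<open>rest c\<close> only add weight. Equality excludes such pairs and forces A = s, so
  \<open>T c\<close> is mapped onto the tail.\<close>

lemma sep_weight_bound:
  assumes c: "c \<in> cuts"
  shows "tail_weight m l x (\<sigma> c) \<le> pair_weight sep (\<lambda>v. x (\<sigma> v)) c"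
    and "tail_weight m l x (\<sigma> c) = pair_weight sep (\<lambda>v. x (\<sigma> v)) c \<Longrightarrow> u \<in> V \<Longrightarrow> v \<in> V \<Longrightarrow> sep c u v \<longleftrightarrow>
      \<sigma> u \<noteq> \<sigma> c \<and> \<sigma> v \<noteq> \<sigma> c \<and> (\<sigma> u \<in> tail_of l (\<sigma> c)) \<noteq> (\<sigma> v \<in> tail_of l (\<sigma> c))"
proof -
  define y where "y v = x (\<sigma> v)" for v
  define P where "P = {(u, v). sep c u v}"
  define Q where "Q = T c \<times> rest c \<union> rest c \<times> T c"
  define s where "s = sum x (tail_of l (\<sigma> c))"
  have cV: "c \<in> V" using c cuts_subset by blast
  have TV: "T c \<subseteq> V" "c \<notin> T c" using T_subset[OF c] by auto
  have RV: "rest c \<subseteq> V" and disj: "T c \<inter> rest c = {}" by (auto simp: rest_def)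
  have img: "sum y A = sum x (\<sigma> ` A)" if "A \<subseteq> V" for A
    unfolding y_def using that by (simp add: sum.reindex[OF inj_on_subset[OF inj_\<sigma>]])
  have finT: "finite (T c)" "finite (rest c)" using TV RV fin finite_subset by auto
  have "V = insert c (T c \<union> rest c)" using cV TV by (auto simp: rest_def)
  then have "sum y V = sum y (insert c (T c \<union> rest c))" by simp
  also have "\<dots> = y c + (sum y (T c) + sum y (rest c))"
    using finT disj TV by (subst sum.insert) (auto simp: rest_def sum.union_disjoint)
  finally have W: "sum y (T c) + sum y (rest c) = sum x (cells m l) - x (\<sigma> c)"
    using img[of V] \<sigma> by (simp add: bij_betw_def y_def)
  have finP: "finite P" unfolding P_def
    by (rule finite_subset[OF sep_pairs_subset]) (simp add: fin)
  have QP: "Q \<subseteq> P"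
  proof -
    have "sep c u v" if "u \<in> T c" "v \<in> rest c" for u v
      using T_sep[OF c that(1), of v] that(2) by (auto simp: rest_def)
    then show ?thesis using sep_sym by (auto simp: Q_def P_def)
  qed
  have pos: "y u * y v > 0" if "(u, v) \<in> P" for u v
    using that sep_in x\<sigma>_pos unfolding P_def y_def by (metis (mono_tags) case_prodD mem_Collect_eq mult_pos_pos)
  have "(\<Sum>(u, v)\<in>Q. y u * y v) = (\<Sum>(u, v)\<in>T c \<times> rest c. y u * y v) + (\<Sum>(u, v)\<in>rest c \<times> T c. y u * y v)"
    unfolding Q_def using finT disj by (intro sum.union_disjoint) auto
  also have "\<dots> = 2 * (sum y (T c) * sum y (rest c))"
    by (simp add: sum.cartesian_product[symmetric] sum_product[symmetric])
  finally have Qsum: "(\<Sum>(u, v)\<in>Q. y u * y v) = 2 * (sum y (T c) * sum y (rest c))" .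
  have Ple: "(\<Sum>(u, v)\<in>Q. y u * y v) \<le> (\<Sum>(u, v)\<in>P. y u * y v)"
    using QP finP pos by (intro sum_mono2) (auto intro: less_imp_le)
  have t1: "s \<le> sum y (T c)" using T_weight(1)[OF c] img[OF TV(1)] by (simp add: s_def)
  have t2: "s < sum y (rest c) \<or> sum y (T c) = s"
    using rest_weight[OF c] img[OF TV(1)] img[OF RV] by (simp add: s_def)
  have prod: "sum y (T c) * sum y (rest c) - s * (sum x (cells m l) - x (\<sigma> c) - s)
      = (sum y (T c) - s) * (sum y (rest c) - s)"
    unfolding W[symmetric] by (simp add: algebra_simps)
  have prod_nonneg: "(sum y (T c) - s) * (sum y (rest c) - s) \<ge> 0"
    using t1 t2 by auto
  have tw: "tail_weight m l x (\<sigma> c) = 2 * (s * (sum x (cells m l) - x (\<sigma> c) - s))"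
    by (simp add: tail_weight_def s_def)
  have sw: "pair_weight sep (\<lambda>v. x (\<sigma> v)) c = (\<Sum>(u, v)\<in>P. y u * y v)"
    by (simp add: pair_weight_def P_def y_def)
  show "tail_weight m l x (\<sigma> c) \<le> pair_weight sep (\<lambda>v. x (\<sigma> v)) c"
    using Ple prod prod_nonneg unfolding tw sw Qsum by linarith
  assume eq: "tail_weight m l x (\<sigma> c) = pair_weight sep (\<lambda>v. x (\<sigma> v)) c" and uv: "u \<in> V" "v \<in> V"
  have eqP: "(\<Sum>(u, v)\<in>Q. y u * y v) = (\<Sum>(u, v)\<in>P. y u * y v)"
    and "(sum y (T c) - s) * (sum y (rest c) - s) = 0"
    using eq Ple prod prod_nonneg unfolding tw sw Qsum by linarith+
  then have Ts: "sum y (T c) = s" using t2 by auto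
  have "P = Q"
  proof (rule ccontr)
    assume "P \<noteq> Q"
    then obtain u v where uv: "(u, v) \<in> P" "(u, v) \<notin> Q" using QP by auto
    have "(\<Sum>(u, v)\<in>Q. y u * y v) < (\<Sum>(u, v)\<in>P. y u * y v)"
      using uv QP finP pos[OF uv(1)] pos by (intro sum_strict_mono2[where b = "(u, v)"]) (auto intro: less_imp_le)
    then show False using eqP by simp
  qed
  then have sepQ: "sep c u v \<longleftrightarrow> (u, v) \<in> Q" by (auto simp: P_def)
  have reg: "rank c \<le> l (\<pi> (e c))"
    using T_weight(2)[OF c] Ts img[OF TV(1)] by (force simp: s_def)
  have "\<sigma> ` T c = tail_of l (\<sigma> c)"
  proof (rule ccontr)
    assume n: "\<not> ?thesis"
    have "s < sum x (\<sigma> ` T c)"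
      unfolding s_def using tail_subset_T[OF c reg] n
      by (intro sum_strict_mono_cells image_subset_cells TV(1)) auto
    then show False using Ts img[OF TV(1)] by simp
  qed
  then have inT: "\<sigma> w \<in> tail_of l (\<sigma> c) \<longleftrightarrow> w \<in> T c" if "w \<in> V" for w
    using that TV inj_\<sigma> by (metis inj_on_image_mem_iff)
  have inc: "\<sigma> w = \<sigma> c \<longleftrightarrow> w = c" if "w \<in> V" for w
    using that cV inj_\<sigma> by (auto dest: inj_onD)
  show "sep c u v \<longleftrightarrow>
      \<sigma> u \<noteq> \<sigma> c \<and> \<sigma> v \<noteq> \<sigma> c \<and> (\<sigma> u \<in> tail_of l (\<sigma> c)) \<noteq> (\<sigma> v \<in> tail_of l (\<sigma> c))"
    unfolding sepQ inT[OF uv(1)] inT[OF uv(2)] inc[OF uv(1)] inc[OF uv(2)]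
    using uv TV by (auto simp: Q_def rest_def)
qed

lemma \<sigma>_cuts: "bij_betw \<sigma> cuts {p \<in> cells m l. snd p < l (fst p)}"
proof -
  have "\<sigma> ` ends = {p \<in> cells m l. \<not> snd p < l (fst p)}"
  proof
    show "\<sigma> ` ends \<subseteq> {p \<in> cells m l. \<not> snd p < l (fst p)}"
      using \<sigma>_end \<pi>_less by (auto simp: cells_def)
    show "{p \<in> cells m l. \<not> snd p < l (fst p)} \<subseteq> \<sigma> ` ends"
    proof
      fix p assume p: "p \<in> {p \<in> cells m l. \<not> snd p < l (fst p)}"
      then have "p = (fst p, l (fst p))" "fst p < m" by (auto simp: cells_def)
      moreover obtain d where "d \<in> ends" "\<pi> d = fst p"
        using \<pi> \<open>fst p < m\<close> by (metis bij_betw_def imageE lessThan_iff)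
      ultimately show "p \<in> \<sigma> ` ends" using \<sigma>_end by force
    qed
  qed
  moreover have "cuts = V - ends" using cuts_subset by (auto simp: ends_def)
  ultimately have "\<sigma> ` cuts = cells m l - {p \<in> cells m l. \<not> snd p < l (fst p)}"
    using \<sigma> ends_subset inj_on_image_set_diff[OF inj_\<sigma>, of V ends] by (simp add: bij_betw_def)
  also have "\<dots> = {p \<in> cells m l. snd p < l (fst p)}" by auto
  finally show ?thesis
    using inj_on_subset[OF inj_\<sigma> cuts_subset] by (simp add: bij_betw_def)
qed

end

text \<open>The pairs of vertices separated by \<open>p\<close> in the extremal graph.\<close>

definition cell_sep :: "(nat \<Rightarrow> nat) \<Rightarrow> nat \<times> nat \<Rightarrow> nat \<times> nat \<Rightarrow> nat \<times> nat \<Rightarrow> bool" where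
  "cell_sep l p q r \<longleftrightarrow> q \<noteq> p \<and> r \<noteq> p \<and> (q \<in> tail_of l p) \<noteq> (r \<in> tail_of l p)"

lemma (in separation) ex_weight_assignment:
  assumes n: "card V \<ge> 2"
    and m: "card ends = m" and k: "(\<Sum>i<m. l i) = card cuts"
    and near: "\<And>i j. i < m \<Longrightarrow> j < m \<Longrightarrow> l i \<le> Suc (l j)"
    and x_pos: "\<And>p. p \<in> cells m l \<Longrightarrow> x p > (0::real)"
    and branch_heavy: "\<And>i j. i < m \<Longrightarrow> j < m \<Longrightarrow> l j \<le> l i \<Longrightarrow>
      sum x (tail_of l (j, 0)) < sum x (branch l i)"
    and branch_end_heavy: "\<And>i j j'. i < m \<Longrightarrow> j < m \<Longrightarrow> j' < m \<Longrightarrow> l i = Suc (l j) \<Longrightarrow>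
      l i = Suc (l j') \<Longrightarrow> sum x (tail_of l (i, 0)) < sum x (branch l j) + x (j', l j')"
  shows "\<exists>a b e T \<pi> \<sigma>. weight_assignment V sep a b e T m l x \<pi> \<sigma>"
proof -
  obtain a b e T where "chain_decomposition V sep a b e T"
    using ex_chain_decomposition[OF n] by blast
  then interpret chain_decomposition V sep a b e T .
  obtain \<pi> where \<pi>: "bij_betw \<pi> ends {..<m}"
    and la: "\<And>d. d \<in> ends \<Longrightarrow> l (\<pi> d) \<le> l (\<pi> a)"
    and lb: "\<And>d. d \<in> ends \<Longrightarrow> d \<noteq> a \<Longrightarrow> l (\<pi> d) \<le> l (\<pi> b)"
    and full: "l (\<pi> a) \<le> card (chain a)" "l (\<pi> b) \<le> card (chain b)"
    and ex: "\<And>d d'. d \<in> ends \<Longrightarrow> d' \<in> ends \<Longrightarrow> l (\<pi> d) < card (chain d) \<Longrightarrow>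
      card (chain d') < l (\<pi> d') \<Longrightarrow> l (\<pi> d') \<le> l (\<pi> d)"
    using ex_sorted_labelling[OF m k near] by blast
  define s where "s v = (\<pi> (tip v), l (\<pi> (tip v)) - rank v)" for v
  \<comment> \<open>The vertices with a prescribed place; the surplus of the chains is spread
    arbitrarily over the cells left free.\<close>
  define V0 where "V0 = {v \<in> V. rank v \<le> l (\<pi> (tip v))}"
  have "inj_on s V0"
  proof (rule inj_onI)
    fix v w assume vw: "v \<in> V0" "w \<in> V0" "s v = s w"
    have "\<pi> (tip v) = \<pi> (tip w)" using vw by (simp add: s_def)
    moreover have "tip v \<in> ends" "tip w \<in> ends" using vw tip_ends by (auto simp: V0_def)
    ultimately have t: "tip v = tip w" by (rule inj_onD[OF bij_betw_imp_inj_on[OF \<pi>]])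
    have "rank v \<le> l (\<pi> (tip w))" "rank w \<le> l (\<pi> (tip w))"
      "l (\<pi> (tip w)) - rank v = l (\<pi> (tip w)) - rank w"
      using vw t by (auto simp: V0_def s_def)
    then have "rank v = rank w" by linarith
    then show "v = w" using rank_inj[OF _ _ t] vw by (simp add: V0_def)
  qed
  moreover have "s ` V0 \<subseteq> cells m l"
    using \<pi> tip_ends by (auto simp: V0_def s_def cells_def bij_betw_def)
  moreover have "card V = card (cells m l)"
    using card_ends_cuts m k by (simp add: card_cells)
  ultimately obtain \<sigma> where \<sigma>: "bij_betw \<sigma> V (cells m l)" "\<And>v. v \<in> V0 \<Longrightarrow> \<sigma> v = s v"
    using ex_bij_extending[of V "cells m l" V0 s] fin by (auto simp: V0_def)
  have "weight_assignment V sep a b e T m l x \<pi> \<sigma>"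
  proof (intro weight_assignment.intro weight_assignment_axioms.intro)
    show "\<sigma> v = (\<pi> (tip v), l (\<pi> (tip v)) - rank v)" if "v \<in> V" "rank v \<le> l (\<pi> (tip v))" for v
      using \<sigma>(2)[of v] that by (simp add: V0_def s_def)
  qed (assumption | rule chain_decomposition_axioms k near x_pos branch_heavy branch_end_heavy
      \<pi> la lb full ex \<sigma>(1))+
  then show ?thesis by blast
qed

section \<open>Distances and separation in a connected graph\<close>

definition cut_sep :: "'a pair_pre_digraph \<Rightarrow> 'a \<Rightarrow> 'a \<Rightarrow> 'a \<Rightarrow> bool" where
  "cut_sep G c u v \<longleftrightarrow> c \<in> pverts G \<and> u \<in> pverts G - {c} \<and> v \<in> pverts G - {c} \<and>
    (u, v) \<notin> (Restr (parcs G) (pverts G - {c}))\<^sup>*"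

lemma rtrancl_on_eq_rtrancl:
  assumes "r \<subseteq> F \<times> F" "u \<in> F"
  shows "(u, v) \<in> rtrancl_on F r \<longleftrightarrow> (u, v) \<in> r\<^sup>*"
proof
  assume "(u, v) \<in> r\<^sup>*"
  then show "(u, v) \<in> rtrancl_on F r"
    by induction (use assms in \<open>auto intro: rtrancl_on_into_rtrancl_on\<close>)
qed (rule rtrancl_on_rtranclI)

locale connected_pair_graph = pair_graph G for G :: "'a pair_pre_digraph" +
  assumes conn: "connected (with_proj G)"
begin

abbreviation "V \<equiv> pverts G"
abbreviation "E \<equiv> parcs G"

lemma sym_E: "sym E"
  using pair_sym_arcs by (simp add: symmetric_def)

lemma E_sub: "E \<subseteq> V \<times> V"
  using wellformed' by auto

lemma E_irrefl: "(u, u) \<notin> E"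
  using pair_no_loops[of "(u, u)"] by auto

lemma parcs_mk_symmetric_with_proj: "parcs (mk_symmetric (with_proj G)) = E"
  using sym_E by (auto simp: parcs_mk_symmetric sym_def)

lemma V_nonempty: "V \<noteq> {}"
  using conn by (auto simp: connected_def strongly_connected_def)

lemma reaches: "u \<in> V \<Longrightarrow> v \<in> V \<Longrightarrow> (u, v) \<in> E\<^sup>*"
  using conn rtrancl_on_eq_rtrancl[OF E_sub]
  by (auto simp: connected_def strongly_connected_def reachable_def parcs_mk_symmetric_with_proj)

lemma connected_del_vert_iff:
  "connected (pre_digraph.del_vert (with_proj G) c) \<longleftrightarrow> V - {c} \<noteq> {} \<and>
    (\<forall>u\<in>V - {c}. \<forall>v\<in>V - {c}. (u, v) \<in> (Restr E (V - {c}))\<^sup>*)"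
proof -
  let ?D = "pre_digraph.del_vert (with_proj G) c"
  have "parcs (mk_symmetric ?D) = Restr E (V - {c})"
    using sym_E E_sub by (auto simp: parcs_mk_symmetric del_vert_simps sym_def)
  moreover have "pverts (mk_symmetric ?D) = V - {c}" by (simp add: del_vert_simps)
  ultimately show ?thesis
    using rtrancl_on_eq_rtrancl[of "Restr E (V - {c})" "V - {c}"]
    by (auto simp: connected_def strongly_connected_def reachable_def)
qed

lemma cut_vertex_iff: "cut_vertex G c \<longleftrightarrow> (\<exists>u v. cut_sep G c u v)"
proof
  assume "cut_vertex G c"
  then have c: "c \<in> V" "V \<noteq> {c}" "\<not> connected (pre_digraph.del_vert (with_proj G) c)"
    by (auto simp: cut_vertex_def)
  then have "V - {c} \<noteq> {}" by blast
  then obtain u v where "u \<in> V - {c}" "v \<in> V - {c}" "(u, v) \<notin> (Restr E (V - {c}))\<^sup>*"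
    using c(3) unfolding connected_del_vert_iff by blast
  then show "\<exists>u v. cut_sep G c u v" using c(1) unfolding cut_sep_def by blast
next
  assume "\<exists>u v. cut_sep G c u v"
  then obtain u v where uv: "c \<in> V" "u \<in> V - {c}" "v \<in> V - {c}" "(u, v) \<notin> (Restr E (V - {c}))\<^sup>*"
    unfolding cut_sep_def by blast
  then have "\<not> connected (pre_digraph.del_vert (with_proj G) c)"
    unfolding connected_del_vert_iff by blast
  then show "cut_vertex G c" using uv by (auto simp: cut_vertex_def)
qed

lemma separation_cut_sep: "separation V (cut_sep G)"
proof
  show "finite V" by (rule pair_finite_verts)
  fix c u v assume s: "cut_sep G c u v"
  then show "c \<in> V \<and> u \<in> V \<and> v \<in> V \<and> c \<noteq> u \<and> c \<noteq> v \<and> u \<noteq> v" by (auto simp: cut_sep_def)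
  have "sym (Restr E (V - {c}))" using sym_E by (auto simp: sym_def)
  then have "sym ((Restr E (V - {c}))\<^sup>*)" by (rule sym_rtrancl)
  then show "cut_sep G c v u" using s unfolding cut_sep_def sym_def by blast
  show "cut_sep G c u w \<or> cut_sep G c w v" if "w \<in> V" "w \<noteq> c" for w
    using s that unfolding cut_sep_def by (meson DiffI rtrancl_trans singletonD)
next
  fix c u c' assume s: "cut_sep G c u c'"
  let ?R = "Restr E (V - {c})"
  have c: "c \<in> V" "u \<in> V" "c' \<in> V" "c \<noteq> u" "c' \<noteq> c" "(u, c') \<notin> ?R\<^sup>*"
    using s by (auto simp: cut_sep_def)
  have avoid: "(u, w) \<in> (Restr E (V - {c'}))\<^sup>*" if "(u, w) \<in> ?R\<^sup>*" for w
    using that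
  proof induction
    case (step y z)
    have "y \<noteq> c'" "z \<noteq> c'" using step c(6) by (auto intro: rtrancl_into_rtrancl)
    then show ?case using step by (auto intro: rtrancl_into_rtrancl)
  qed simp
  \<comment> \<open>Follow a walk from \<open>u\<close> to \<open>c\<close> until it first meets
    \<open>c\<close>. Before that it stays in the component of \<open>u\<close> without
    \<open>c\<close>, which does not contain \<open>c'\<close>.\<close>
  have last: "(u, w) \<in> ?R\<^sup>* \<or> (u, c) \<in> (Restr E (V - {c'}))\<^sup>*" if "(u, w) \<in> E\<^sup>*" for w
    using that
  proof induction
    case (step y z)
    show ?case
    proof (cases "(u, y) \<in> ?R\<^sup>*")
      case True
      have "y \<noteq> c" using True c(4) by (auto elim: rtranclE)
      have "y \<noteq> c'" using True c(6) by auto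
      show ?thesis
      proof (cases "z = c")
        case True
        then have "(y, c) \<in> Restr E (V - {c'})" using step E_sub \<open>y \<noteq> c'\<close> c by auto
        then show ?thesis using avoid[OF \<open>(u, y) \<in> ?R\<^sup>*\<close>] by (auto intro: rtrancl_into_rtrancl)
      next
        case False
        then have "(y, z) \<in> ?R" using step E_sub \<open>y \<noteq> c\<close> by auto
        then show ?thesis using \<open>(u, y) \<in> ?R\<^sup>*\<close> by (auto intro: rtrancl_into_rtrancl)
      qed
    next
      case False
      then show ?thesis using step by blast
    qed
  qed simp
  have "(u, c) \<notin> ?R\<^sup>*" using c(4) by (auto elim: rtranclE)
  then have "(u, c) \<in> (Restr E (V - {c'}))\<^sup>*" using last[OF reaches[OF c(2,1)]] by blast
  then show "\<not> cut_sep G c' u c" by (simp add: cut_sep_def)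
qed

sublocale separation "pverts G" "cut_sep G"
  by (rule separation_cut_sep)

lemma cuts_eq: "cuts = {c. cut_vertex G c}"
  by (simp add: cuts_def cut_vertex_iff)

section \<open>Distances as powers of the arc relation\<close>

lemma awalk_imp_relpow: "awalk u p v \<Longrightarrow> (u, v) \<in> E ^^ length p"
proof (induction p arbitrary: u)
  case Nil
  then show ?case by (simp add: awalk_Nil_iff)
next
  case (Cons a p)
  then have "a \<in> E" "u = fst a" "awalk (snd a) p v" by (auto simp: awalk_Cons_iff)
  then have "(u, snd a) \<in> E" "(snd a, v) \<in> E ^^ length p" using Cons.IH[of "snd a"] by auto
  then show ?case unfolding length_Cons by (rule relpow_Suc_I2)
qed

lemma relpow_imp_awalk: "u \<in> V \<Longrightarrow> (u, v) \<in> E ^^ d \<Longrightarrow> \<exists>p. awalk u p v \<and> length p = d"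
proof (induction d arbitrary: u)
  case 0
  then show ?case by (auto simp: awalk_Nil_iff)
next
  case (Suc d)
  then obtain w where w: "(u, w) \<in> E" "(w, v) \<in> E ^^ d" by (meson relpow_Suc_E2)
  then obtain p where "awalk w p v" "length p = d" using Suc.IH[of w] E_sub by auto
  then show ?case using w by (intro exI[of _ "(u, w) # p"]) (auto simp: awalk_Cons_iff)
qed

text \<open>\<open>graph_dist\<close> ranges over paths without repeated vertices; removing cycles
  from walks lets relation powers compute it.\<close>

lemma ex_apath_le:
  assumes "awalk u p v"
  shows "\<exists>q. apath u q v \<and> length q \<le> length p"
  using assms
proof (induction rule: awalk_to_apath_induct)
  case (path p)
  then show ?case by (auto simp: apath_def)
next
  case (decomp p q r s)
  have "p = q @ r @ s"
    using awalk_cyc_decompE[OF decomp(2,1,3)] by blast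
  then show ?case using decomp(4) by fastforce
qed

lemma graph_dist_le:
  assumes "u \<in> V" "(u, v) \<in> E ^^ d"
  shows "graph_dist G u v \<le> d"
proof -
  obtain q where "apath u q v" "length q \<le> d"
    using relpow_imp_awalk[OF assms] ex_apath_le by blast
  moreover from this have "graph_dist G u v \<le> length q"
    unfolding graph_dist_def by (intro Least_le) blast
  ultimately show ?thesis by simp
qed

lemma relpow_graph_dist:
  assumes "u \<in> V" "v \<in> V"
  shows "(u, v) \<in> E ^^ graph_dist G u v"
proof -
  obtain d where "(u, v) \<in> E ^^ d" using reaches[OF assms] by (auto simp: rtrancl_power)
  then obtain q where "apath u q v"
    using relpow_imp_awalk[OF assms(1)] ex_apath_le by blast
  then have "\<exists>p. apath u p v \<and> length p = graph_dist G u v"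
    unfolding graph_dist_def by (intro LeastI_ex[of "\<lambda>d. \<exists>p. apath u p v \<and> length p = d"]) blast
  then show ?thesis using awalk_imp_relpow awalkI_apath by fastforce
qed

lemma graph_dist_sym:
  assumes "u \<in> V" "v \<in> V"
  shows "graph_dist G u v = graph_dist G v u"
proof -
  have flip: "(y, x) \<in> E ^^ d" if "(x, y) \<in> E ^^ d" for x y d
    using that
  proof (induction d arbitrary: y)
    case (Suc d)
    then obtain w where "(x, w) \<in> E ^^ d" "(w, y) \<in> E" by auto
    then show ?case using Suc.IH[of w] sym_E by (meson relpow_Suc_I2 symD)
  qed simp
  show ?thesis
    using graph_dist_le[OF assms(1) flip[OF relpow_graph_dist[OF assms(2,1)]]]
      graph_dist_le[OF assms(2) flip[OF relpow_graph_dist[OF assms]]] by simp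
qed

lemma graph_dist_self: "u \<in> V \<Longrightarrow> graph_dist G u u = 0"
  using graph_dist_le[of u u 0] by simp

lemma graph_dist_eq_1_iff:
  assumes "u \<in> V" "v \<in> V"
  shows "graph_dist G u v = 1 \<longleftrightarrow> (u, v) \<in> E"
proof
  assume "graph_dist G u v = 1"
  then show "(u, v) \<in> E" using relpow_graph_dist[OF assms] by simp
next
  assume uv: "(u, v) \<in> E"
  then have "u \<noteq> v" using E_irrefl by auto
  then have "graph_dist G u v \<noteq> 0" using relpow_graph_dist[OF assms] by (metis relpow_0_E)
  moreover have "graph_dist G u v \<le> 1" using graph_dist_le[OF assms(1), of v 1] uv by simp
  ultimately show "graph_dist G u v = 1" by simp
qed

text \<open>A walk from \<open>u\<close> to \<open>v\<close> has every separator of the two among its inner vertices.\<close>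

lemma separators_less_dist:
  assumes "u \<in> V" "v \<in> V" "u \<noteq> v"
  shows "card (separators u v) < graph_dist G u v"
proof -
  define d where "d = graph_dist G u v"
  obtain f where f: "f 0 = u" "f d = v" "\<And>i. i < d \<Longrightarrow> (f i, f (Suc i)) \<in> E"
    using relpow_graph_dist[OF assms(1,2)] by (auto simp: relpow_fun_conv d_def)
  have "separators u v \<subseteq> f ` {0<..<d}"
  proof
    fix c assume "c \<in> separators u v"
    then have c: "cut_sep G c u v" by (simp add: separators_def)
    have "\<exists>i\<le>d. f i = c"
    proof (rule ccontr)
      assume n: "\<not> ?thesis"
      have "(u, f i) \<in> (Restr E (V - {c}))\<^sup>*" if "i \<le> d" for i
        using that
      proof (induction i)
        case (Suc i)
        have "(f i, f (Suc i)) \<in> Restr E (V - {c})" using f(3)[of i] Suc.prems n E_sub by force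
        then show ?case using Suc by (auto intro: rtrancl_into_rtrancl)
      qed (simp add: f)
      then show False using c f(2) by (auto simp: cut_sep_def)
    qed
    then obtain i where i: "i \<le> d" "f i = c" by blast
    then have "i \<noteq> 0" "i \<noteq> d" using c f by (auto simp: cut_sep_def)
    then show "c \<in> f ` {0<..<d}" using i by auto
  qed
  then have "card (separators u v) \<le> card (f ` {0<..<d})" by (intro card_mono) auto
  also have "\<dots> \<le> d - 1" using card_image_le[of "{0<..<d}" f] by simp
  also have "\<dots> < d" using f(1,2) assms(3) by (cases d) auto
  finally show ?thesis by (simp add: d_def)
qed

end

lemma connected_graph_with_cut_vertices_iff:
  "connected_graph_with_cut_vertices n k G \<longleftrightarrow>
    connected_pair_graph G \<and> card (pverts G) = n \<and> card {v. cut_vertex G v} = k"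
  by (auto simp: connected_graph_with_cut_vertices_def connected_pair_graph_def
      connected_pair_graph_axioms_def)

text \<open>Double counting: the separators of all pairs are summed cut vertex by cut vertex. The
  zero diagonal accounts for the subtracted squares.\<close>

lemma (in separation) qform_separators:
  "qform V (\<lambda>u v. if u = v then 0 else 1 + real (card (separators u v))) y =
    (sum y V)\<^sup>2 - (\<Sum>v\<in>V. (y v)\<^sup>2) + (\<Sum>c\<in>cuts. pair_weight sep y c)"
proof -
  have pw: "pair_weight sep y c = (\<Sum>u\<in>V. \<Sum>v\<in>V. if sep c u v then y u * y v else 0)" for c
  proof -
    have eq: "{(u, v). sep c u v} = {p \<in> V \<times> V. sep c (fst p) (snd p)}" using sep_in by auto
    have "pair_weight sep y c = (\<Sum>p\<in>V \<times> V. if sep c (fst p) (snd p) then y (fst p) * y (snd p) else 0)"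
      unfolding pair_weight_def eq by (simp add: case_prod_unfold fin sum.inter_filter)
    then show ?thesis by (simp add: sum.cartesian_product case_prod_unfold)
  qed
  have split: "(if u = v then 0 else 1 + real (card (separators u v))) * y u * y v =
      y u * y v - (if u = v then y u * y v else 0) + (\<Sum>c\<in>cuts. if sep c u v then y u * y v else 0)"
    for u v
  proof -
    have "{c \<in> cuts. sep c u v} = separators u v" by (auto simp: separators_def cuts_def)
    then have "(\<Sum>c\<in>cuts. if sep c u v then y u * y v else 0) = real (card (separators u v)) * (y u * y v)"
      using finite_cuts by (simp add: sum.If_cases Int_def)
    moreover have "separators u u = {}" for u using sep_in by (auto simp: separators_def)
    ultimately show ?thesis by (auto simp: algebra_simps)
  qed
  have "qform V (\<lambda>u v. if u = v then 0 else 1 + real (card (separators u v))) y =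
      (\<Sum>u\<in>V. \<Sum>v\<in>V. y u * y v) - (\<Sum>u\<in>V. \<Sum>v\<in>V. if u = v then y u * y v else 0)
      + (\<Sum>u\<in>V. \<Sum>v\<in>V. \<Sum>c\<in>cuts. if sep c u v then y u * y v else 0)"
    unfolding qform_def split by (simp add: sum.distrib sum_subtractf)
  also have "(\<Sum>u\<in>V. \<Sum>v\<in>V. y u * y v) = (sum y V)\<^sup>2"
    by (simp add: power2_eq_square sum_product)
  also have "(\<Sum>u\<in>V. \<Sum>v\<in>V. if u = v then y u * y v else 0) = (\<Sum>v\<in>V. (y v)\<^sup>2)"
    using fin by (simp add: power2_eq_square)
  also have "(\<Sum>u\<in>V. \<Sum>v\<in>V. \<Sum>c\<in>cuts. if sep c u v then y u * y v else 0)
      = (\<Sum>u\<in>V. \<Sum>c\<in>cuts. \<Sum>v\<in>V. if sep c u v then y u * y v else 0)"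
    by (intro sum.cong refl sum.swap)
  also have "\<dots> = (\<Sum>c\<in>cuts. pair_weight sep y c)"
    unfolding pw by (rule sum.swap)
  finally show ?thesis .
qed

section \<open>The extremal graph\<close>

text \<open>One of the two truncated differences is 0, so their sum is the absolute difference.
  Between two paths the \<open>Suc\<close> is the clique edge.\<close>

definition cell_dist :: "nat \<times> nat \<Rightarrow> nat \<times> nat \<Rightarrow> nat" where
  "cell_dist p q = (if fst p = fst q then (snd p - snd q) + (snd q - snd p) else Suc (snd p + snd q))"

lemma pverts_clique_with_paths [simp]: "pverts (clique_with_paths m l) = cells m l"
  by (simp add: clique_with_paths_def cells_def)

lemma parcs_clique_with_paths:
  "parcs (clique_with_paths m l) = {((i, 0), (j, 0)) | i j. i < m \<and> j < m \<and> i \<noteq> j}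
     \<union> {((i, j), (i, Suc j)) | i j. i < m \<and> j < l i} \<union> {((i, Suc j), (i, j)) | i j. i < m \<and> j < l i}"
  by (simp add: clique_with_paths_def)

lemma clique_with_paths_arc_cases:
  assumes "(p, q) \<in> parcs (clique_with_paths m l)"
  obtains (clique) i j where "p = (i, 0)" "q = (j, 0)" "i < m" "j < m" "i \<noteq> j"
  | (up) i j where "p = (i, j)" "q = (i, Suc j)" "i < m" "j < l i"
  | (down) i j where "p = (i, Suc j)" "q = (i, j)" "i < m" "j < l i"
  using assms unfolding parcs_clique_with_paths by blast

lemma pair_graph_clique_with_paths: "pair_graph (clique_with_paths m l)"
proof -
  let ?G = "clique_with_paths m l"
  have sub: "parcs ?G \<subseteq> cells m l \<times> cells m l"
    by (auto simp: cells_def elim: clique_with_paths_arc_cases)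
  have "finite (parcs ?G)" by (rule finite_subset[OF sub]) simp
  moreover have "symmetric (with_proj ?G)"
    by (auto simp: symmetric_def sym_def parcs_clique_with_paths)
  moreover have "fst e \<noteq> snd e" if "e \<in> parcs ?G" for e
    using that by (cases e) (auto elim: clique_with_paths_arc_cases)
  ultimately show ?thesis
    using sub by unfold_locales auto
qed

context
  fixes m :: nat and l :: "nat \<Rightarrow> nat"
begin

lemma path_relpow:
  assumes "i < m" "j + d \<le> l i"
  shows "((i, j), (i, j + d)) \<in> parcs (clique_with_paths m l) ^^ d"
    and "((i, j + d), (i, j)) \<in> parcs (clique_with_paths m l) ^^ d"
proof -
  show "((i, j), (i, j + d)) \<in> parcs (clique_with_paths m l) ^^ d"
    using assms(2)
  proof (induction d)
    case (Suc d)
    have "((i, j + d), (i, Suc (j + d))) \<in> parcs (clique_with_paths m l)"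
      using assms(1) Suc.prems by (auto simp: parcs_clique_with_paths)
    then show ?case using Suc by auto
  qed simp
  show "((i, j + d), (i, j)) \<in> parcs (clique_with_paths m l) ^^ d"
    using assms(2)
  proof (induction d)
    case (Suc d)
    have "((i, Suc (j + d)), (i, j + d)) \<in> parcs (clique_with_paths m l)"
      using assms(1) Suc.prems by (auto simp: parcs_clique_with_paths)
    moreover have "((i, j + d), (i, j)) \<in> parcs (clique_with_paths m l) ^^ d" using Suc by simp
    ultimately show ?case unfolding add_Suc_right by (rule relpow_Suc_I2)
  qed simp
qed

lemma relpow_cell_dist:
  assumes "p \<in> cells m l" "q \<in> cells m l"
  shows "(p, q) \<in> parcs (clique_with_paths m l) ^^ cell_dist p q"
proof -
  obtain i j i' j' where pq: "p = (i, j)" "q = (i', j')" by (cases p, cases q) auto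
  have c: "i < m" "j \<le> l i" "i' < m" "j' \<le> l i'" using assms by (auto simp: pq cells_def)
  show ?thesis
  proof (cases "i = i'")
    case True
    then show ?thesis
      using path_relpow(1)[of i j "j' - j"] path_relpow(2)[of i j' "j - j'"] c
      by (cases "j \<le> j'") (auto simp: pq cell_dist_def)
  next
    case False
    have "((i, j), (i, 0)) \<in> parcs (clique_with_paths m l) ^^ j" using path_relpow(2)[of i 0 j] c by simp
    moreover have "((i, 0), (i', 0)) \<in> parcs (clique_with_paths m l) ^^ 1"
      using c False by (auto simp: parcs_clique_with_paths)
    moreover have "((i', 0), (i', j')) \<in> parcs (clique_with_paths m l) ^^ j'"
      using path_relpow(1)[of i' 0 j'] c by simp
    ultimately have "((i, j), (i', j')) \<in> parcs (clique_with_paths m l) ^^ (j + 1 + j')"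
      unfolding relpow_add by blast
    then show ?thesis using False by (simp add: pq cell_dist_def)
  qed
qed

lemma connected_clique_with_paths:
  assumes "m > 0"
  shows "connected_pair_graph (clique_with_paths m l)"
proof -
  interpret pair_graph "clique_with_paths m l" by (rule pair_graph_clique_with_paths)
  have E: "parcs (clique_with_paths m l) \<subseteq> cells m l \<times> cells m l" using wellformed' by auto
  have "parcs (mk_symmetric (with_proj (clique_with_paths m l))) = parcs (clique_with_paths m l)"
    using pair_sym_arcs by (auto simp: parcs_mk_symmetric symmetric_def sym_def)
  moreover have "(p, q) \<in> (parcs (clique_with_paths m l))\<^sup>*" if "p \<in> cells m l" "q \<in> cells m l" for p q
    using relpow_cell_dist[OF that] by (rule relpow_imp_rtrancl)
  moreover have "(0, 0) \<in> cells m l" using assms by (simp add: cells_def)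
  ultimately have "connected (with_proj (clique_with_paths m l))"
    using rtrancl_on_eq_rtrancl[OF E]
    by (auto simp: connected_def strongly_connected_def reachable_def)
  then show ?thesis by unfold_locales
qed

text \<open>No arc avoiding \<open>c\<close> enters or leaves the tail of \<open>c\<close>, so
  membership in the tail is constant along walks that avoid \<open>c\<close>.\<close>

lemma cell_sep_imp_cut_sep:
  assumes c: "c \<in> cells m l" "p \<in> cells m l" "q \<in> cells m l" and s: "cell_sep l c p q"
  shows "cut_sep (clique_with_paths m l) c p q"
proof -
  let ?R = "Restr (parcs (clique_with_paths m l)) (cells m l - {c})"
  have step: "u \<in> tail_of l c \<longleftrightarrow> v \<in> tail_of l c" if uv: "(u, v) \<in> ?R" for u v
  proof -
    have "(u, v) \<in> parcs (clique_with_paths m l)" "u \<noteq> c" "v \<noteq> c" using uv by auto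
    then show ?thesis
      by (cases c) (auto simp: tail_of_def elim!: clique_with_paths_arc_cases)
  qed
  have "p \<in> tail_of l c \<longleftrightarrow> v \<in> tail_of l c" if "(p, v) \<in> ?R\<^sup>*" for v
    using that by induction (use step in blast)+
  then have "(p, q) \<notin> ?R\<^sup>*" using s unfolding cell_sep_def by blast
  then show ?thesis using c s by (auto simp: cut_sep_def cell_sep_def)
qed

text \<open>On one path the separating cells lie strictly between the two; on different paths they
  run from each root up to, but not including, \<open>p\<close> and \<open>q\<close>.\<close>

lemma card_cell_sep:
  assumes "p \<in> cells m l" "q \<in> cells m l" "p \<noteq> q"
  shows "cell_dist p q = Suc (card {c \<in> cells m l. cell_sep l c p q})"
proof -
  obtain i j i' j' where pq: "p = (i, j)" "q = (i', j')" by (cases p, cases q) auto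
  have c: "i < m" "j \<le> l i" "i' < m" "j' \<le> l i'" using assms by (auto simp: pq cells_def)
  show ?thesis
  proof (cases "i = i'")
    case True
    then have "{c \<in> cells m l. cell_sep l c p q} = Pair i ` ({j<..<j'} \<union> {j'<..<j})"
      using c by (auto simp: pq cell_sep_def tail_of_def cells_def image_iff)
    moreover have "card (Pair i ` ({j<..<j'} \<union> {j'<..<j})) = card ({j<..<j'} \<union> {j'<..<j})"
      by (intro card_image inj_onI) simp
    moreover have "card ({j<..<j'} \<union> {j'<..<j}) = (j' - j - 1) + (j - j' - 1)"
      by (subst card_Un_disjoint) auto
    ultimately show ?thesis using assms(3) True by (simp add: pq cell_dist_def)
  next
    case False
    then have "{c \<in> cells m l. cell_sep l c p q} = Pair i ` {..<j} \<union> Pair i' ` {..<j'}"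
      using c by (auto simp: pq cell_sep_def tail_of_def cells_def image_iff)
    moreover have "card (Pair i ` {..<j} \<union> Pair i' ` {..<j'}) = j + j'"
      using False by (subst card_Un_disjoint) (auto simp: card_image inj_on_def)
    ultimately show ?thesis using False by (simp add: pq cell_dist_def)
  qed
qed

context
  assumes m_pos: "m > 0"
begin

interpretation H: connected_pair_graph "clique_with_paths m l"
  by (rule connected_clique_with_paths[OF m_pos])

text \<open>
  The separators given by the paths already force the distance \<open>cell_dist\<close>, which is attained by
  a walk. Hence there are no other separators.
\<close>

lemma cut_sep_clique_with_paths:
  "cut_sep (clique_with_paths m l) c p q \<longleftrightarrow>
    c \<in> cells m l \<and> p \<in> cells m l \<and> q \<in> cells m l \<and> cell_sep l c p q"
  and graph_dist_clique_with_paths: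
  "p \<in> cells m l \<Longrightarrow> q \<in> cells m l \<Longrightarrow> graph_dist (clique_with_paths m l) p q = cell_dist p q"
proof -
  have both: "{c \<in> cells m l. cell_sep l c p q} = H.separators p q \<and>
      graph_dist (clique_with_paths m l) p q = cell_dist p q"
    if pq: "p \<in> cells m l" "q \<in> cells m l" "p \<noteq> q" for p q
  proof -
    have sub: "{c \<in> cells m l. cell_sep l c p q} \<subseteq> H.separators p q"
      unfolding H.separators_def using cell_sep_imp_cut_sep pq by blast
    then have le: "card {c \<in> cells m l. cell_sep l c p q} \<le> card (H.separators p q)"
      by (intro card_mono H.finite_separators)
    have "card (H.separators p q) < graph_dist (clique_with_paths m l) p q"
      using H.separators_less_dist pq by simp
    moreover have "graph_dist (clique_with_paths m l) p q \<le> cell_dist p q"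
      using H.graph_dist_le relpow_cell_dist pq by simp
    ultimately have "card {c \<in> cells m l. cell_sep l c p q} = card (H.separators p q)"
      "graph_dist (clique_with_paths m l) p q = cell_dist p q"
      using le card_cell_sep[OF pq] by linarith+
    then show ?thesis using card_subset_eq[OF H.finite_separators sub] by simp
  qed
  show "graph_dist (clique_with_paths m l) p q = cell_dist p q" if "p \<in> cells m l" "q \<in> cells m l"
    using both[of p q] that H.graph_dist_self[of p] by (cases "p = q") (auto simp: cell_dist_def)
  show "cut_sep (clique_with_paths m l) c p q \<longleftrightarrow>
    c \<in> cells m l \<and> p \<in> cells m l \<and> q \<in> cells m l \<and> cell_sep l c p q"
  proof
    assume s: "cut_sep (clique_with_paths m l) c p q"
    then have "p \<in> cells m l" "q \<in> cells m l" "p \<noteq> q" using H.sep_in by auto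
    moreover have "c \<in> H.separators p q" using s by (simp add: H.separators_def)
    ultimately show "c \<in> cells m l \<and> p \<in> cells m l \<and> q \<in> cells m l \<and> cell_sep l c p q"
      using both[of p q] by auto
  qed (auto intro: cell_sep_imp_cut_sep)
qed

text \<open>For \<open>m = 1\<close> and \<open>l 0 > 0\<close> the graph is a bare path whose root
  is one of its ends and hence no cut vertex; the assumption excludes this.\<close>

lemma cuts_clique_with_paths:
  assumes "m = 1 \<Longrightarrow> l 0 = 0"
  shows "H.cuts = {p \<in> cells m l. snd p < l (fst p)}"
proof
  show "H.cuts \<subseteq> {p \<in> cells m l. snd p < l (fst p)}"
    by (auto simp: H.cuts_def cut_sep_clique_with_paths cell_sep_def tail_of_def)
  show "{p \<in> cells m l. snd p < l (fst p)} \<subseteq> H.cuts"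
  proof
    fix p assume p: "p \<in> {p \<in> cells m l. snd p < l (fst p)}"
    then obtain i j where ij: "p = (i, j)" "i < m" "j < l i" by (cases p) (auto simp: cells_def)
    then have "m \<noteq> 1" using assms by auto
    then obtain i' where i': "i' < m" "i' \<noteq> i" using ij
      by (metis One_nat_def gr_implies_not0 less_one linorder_neqE_nat m_pos nat_neq_iff)
    have "cut_sep (clique_with_paths m l) p (i, Suc j) (i', 0)"
      using ij i' by (auto simp: cut_sep_clique_with_paths cell_sep_def cells_def tail_of_def)
    then show "p \<in> H.cuts" by (auto simp: H.cuts_def)
  qed
qed

lemma connected_graph_clique_with_paths:
  assumes "m = 1 \<Longrightarrow> l 0 = 0"
  shows "connected_graph_with_cut_vertices (m + (\<Sum>i<m. l i)) (\<Sum>i<m. l i) (clique_with_paths m l)"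
proof -
  have "{p \<in> cells m l. snd p < l (fst p)} = (SIGMA i:{..<m}. {..<l i})"
    by (auto simp: cells_def)
  then have "card {c. cut_vertex (clique_with_paths m l) c} = (\<Sum>i<m. l i)"
    using cuts_clique_with_paths[OF assms] H.cuts_eq by simp
  then show ?thesis
    using H.connected_pair_graph_axioms
    by (simp add: connected_graph_with_cut_vertices_iff card_cells)
qed

lemma qform_clique_with_paths:
  assumes "m = 1 \<Longrightarrow> l 0 = 0"
  shows "qform (cells m l) (rdist (clique_with_paths m l)) x =
    (sum x (cells m l))\<^sup>2 - (\<Sum>p\<in>cells m l. (x p)\<^sup>2)
    + (\<Sum>p\<in>{p \<in> cells m l. snd p < l (fst p)}. tail_weight m l x p)"
proof -
  have sep_eq: "H.separators p q = {c \<in> cells m l. cell_sep l c p q}"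
    if "p \<in> cells m l" "q \<in> cells m l" for p q
    using that by (auto simp: H.separators_def cut_sep_clique_with_paths)
  have pw: "pair_weight (cut_sep (clique_with_paths m l)) x p = tail_weight m l x p"
    if p: "p \<in> cells m l" for p
  proof -
    define A where "A = tail_of l p"
    define B where "B = cells m l - A - {p}"
    have AV: "A \<subseteq> cells m l" "p \<notin> A"
      using p by (auto simp: A_def tail_of_def cells_def)
    have fin: "finite A" "finite B" by (auto simp: A_def B_def)
    have "{(u, v). cut_sep (clique_with_paths m l) p u v} = A \<times> B \<union> B \<times> A"
      using p AV by (auto simp: cut_sep_clique_with_paths cell_sep_def A_def B_def)
    then have "pair_weight (cut_sep (clique_with_paths m l)) x p =
        (\<Sum>(u, v)\<in>A \<times> B. x u * x v) + (\<Sum>(u, v)\<in>B \<times> A. x u * x v)"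
      unfolding pair_weight_def using fin
      by (simp only:) (intro sum.union_disjoint, auto simp: B_def)
    also have "\<dots> = 2 * (sum x A * sum x B)"
      by (simp add: sum.cartesian_product[symmetric] sum_product[symmetric])
    also have "sum x B = sum x (cells m l) - x p - sum x A"
      using AV p by (simp add: B_def sum_diff fin sum_diff1)
    finally show ?thesis by (simp add: tail_weight_def A_def)
  qed
  have "qform (cells m l) (rdist (clique_with_paths m l)) x =
      qform (cells m l) (\<lambda>u v. if u = v then 0 else 1 + real (card (H.separators u v))) x"
    unfolding qform_def
  proof (intro sum.cong refl)
    fix u v assume uv: "u \<in> cells m l" "v \<in> cells m l"
    then have "rdist (clique_with_paths m l) u v =
        (if u = v then 0 else 1 + real (card (H.separators u v)))"
      using card_cell_sep[OF uv] by (auto simp: graph_dist_clique_with_paths sep_eq cell_dist_def)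
    then show "rdist (clique_with_paths m l) u v * x u * x v =
        (if u = v then 0 else 1 + real (card (H.separators u v))) * x u * x v" by simp
  qed
  also have "\<dots> = (sum x (cells m l))\<^sup>2 - (\<Sum>p\<in>cells m l. (x p)\<^sup>2)
      + (\<Sum>c\<in>H.cuts. pair_weight (cut_sep (clique_with_paths m l)) x c)"
    using H.qform_separators[of x] by simp
  also have "(\<Sum>c\<in>H.cuts. pair_weight (cut_sep (clique_with_paths m l)) x c)
      = (\<Sum>p\<in>{p \<in> cells m l. snd p < l (fst p)}. tail_weight m l x p)"
  proof (rule sum.cong)
    show "H.cuts = {p \<in> cells m l. snd p < l (fst p)}" using assms by (rule cuts_clique_with_paths)
  qed (simp add: pw)
  finally show ?thesis .
qed

end

end

section \<open>Eigenvalue equations of the extremal graph\<close>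

lemma sum_branch: "sum x (branch l i) = (\<Sum>h<Suc (l i). x (i, l i - h))"
proof -
  have "sum x (branch l i) = (\<Sum>j<Suc (l i). x (i, j))"
    by (simp add: branch_def sum.reindex inj_on_def lessThan_Suc_atMost)
  also have "\<dots> = (\<Sum>h<Suc (l i). x (i, Suc (l i) - Suc h))"
    by (rule sum.nat_diff_reindex[symmetric])
  finally show ?thesis by simp
qed

lemma sum_tail_of:
  assumes "h \<le> l i"
  shows "sum x (tail_of l (i, l i - h)) = (\<Sum>h'<h. x (i, l i - h'))"
proof -
  have "sum x (tail_of l (i, l i - h)) = (\<Sum>j\<in>{l i - h<..l i}. x (i, j))"
    by (simp add: tail_of_def sum.reindex inj_on_def)
  also have "\<dots> = (\<Sum>h'<h. x (i, l i - h'))"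
    using assms by (intro sum.reindex_bij_witness[of _ "\<lambda>h'. l i - h'" "\<lambda>j. l i - j"]) auto
  finally show ?thesis .
qed

lemma sum_cells: "sum x (cells m l) = (\<Sum>i<m. sum x (branch l i))"
proof -
  have "sum x (cells m l) = (\<Sum>i<m. \<Sum>j\<le>l i. x (i, j))"
    unfolding cells_eq_Sigma by (simp add: sum.Sigma)
  then show ?thesis by (simp add: branch_def sum.reindex inj_on_def)
qed

locale cell_eigenvector =
  fixes m :: nat and l :: "nat \<Rightarrow> nat" and x :: "nat \<times> nat \<Rightarrow> real" and L :: real
  assumes m2: "m \<ge> 2"
    and x_pos: "\<And>p. p \<in> cells m l \<Longrightarrow> x p > 0"
    and eigen: "\<And>p. p \<in> cells m l \<Longrightarrow> (\<Sum>q\<in>cells m l. real (cell_dist p q) * x q) = L * x p"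
begin

text \<open>All distances to other cells are at least 1. This becomes \<open>large\<close>, which
  limits the first step in \<open>rootless_long_branch_less\<close>.\<close>

lemma large_entry:
  assumes p: "p \<in> cells m l"
  shows "L * x p \<ge> sum x (cells m l) - x p"
proof -
  have "sum x (cells m l) - x p = sum x (cells m l - {p})" using p by (simp add: sum_diff1)
  also have "\<dots> \<le> (\<Sum>q\<in>cells m l - {p}. real (cell_dist p q) * x q)"
  proof (rule sum_mono)
    fix q assume q: "q \<in> cells m l - {p}"
    then have "cell_dist p q \<ge> 1" by (auto simp: cell_dist_def prod_eq_iff)
    then show "x q \<le> real (cell_dist p q) * x q" using q x_pos[of q] by simp
  qed
  also have "\<dots> \<le> (\<Sum>q\<in>cells m l. real (cell_dist p q) * x q)"
  proof (rule sum_mono2)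
    show "0 \<le> real (cell_dist p q) * x q" if "q \<in> cells m l - (cells m l - {p})" for q
      using x_pos[of q] that by simp
  qed auto
  finally show ?thesis using eigen[OF p] by simp
qed

lemma L_pos: "L > 0"
proof -
  have c: "(0, 0) \<in> cells m l" "(1, 0) \<in> cells m l" using m2 by (auto simp: cells_def)
  have "sum x {(0, 0), (1, 0)} \<le> sum x (cells m l)"
    using c x_pos by (intro sum_mono2) (auto intro: less_imp_le)
  then have "0 < sum x (cells m l) - x (0, 0)" using x_pos[OF c(2)] by simp
  also have "\<dots> \<le> L * x (0, 0)" by (rule large_entry[OF c(1)])
  finally show ?thesis using x_pos[OF c(1)] by (simp add: zero_less_mult_iff)
qed

text \<open>One step outwards adds 1 to the distance from each cell outside the tail and subtracts 1
  inside it.\<close>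

lemma eigen_step:
  assumes i: "i < m" and j: "j < l i"
  shows "L * (x (i, Suc j) - x (i, j)) = sum x (cells m l) - 2 * sum x (tail_of l (i, j))"
proof -
  have sub: "tail_of l (i, j) \<subseteq> cells m l" using tail_of_subset_cells i by simp
  have diff: "real (cell_dist (i, Suc j) q) * x q - real (cell_dist (i, j) q) * x q
      = x q - (if q \<in> tail_of l (i, j) then 2 * x q else 0)" if "q \<in> cells m l" for q
    using that by (cases q) (auto simp: cell_dist_def tail_of_def cells_def algebra_simps of_nat_diff
        image_iff not_less_eq not_less split: if_splits)
  have "L * (x (i, Suc j) - x (i, j)) =
      (\<Sum>q\<in>cells m l. real (cell_dist (i, Suc j) q) * x q - real (cell_dist (i, j) q) * x q)"
    using eigen[of "(i, Suc j)"] eigen[of "(i, j)"] i j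
    by (simp add: cells_def sum_subtractf right_diff_distrib)
  also have "\<dots> = (\<Sum>q\<in>cells m l. x q - (if q \<in> tail_of l (i, j) then 2 * x q else 0))"
    by (intro sum.cong refl diff)
  also have "\<dots> = sum x (cells m l) - (\<Sum>q\<in>cells m l \<inter> tail_of l (i, j). 2 * x q)"
    by (simp add: sum_subtractf sum.inter_restrict)
  also have "cells m l \<inter> tail_of l (i, j) = tail_of l (i, j)" using sub by blast
  finally show ?thesis by (simp add: sum_distrib_left)
qed

text \<open>From the root of path \<open>i\<close>, a cell \<open>q\<close> has distance
  \<open>snd q\<close> on that path and one more elsewhere. The right-hand side is independent of
  \<open>i\<close> and becomes the constant \<open>C\<close> of
  \<open>branch_eigenvector\<close>.\<close>

lemma eigen_root:
  assumes i: "i < m"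
  shows "L * x (i, 0) + sum x (branch l i) =
    (\<Sum>q\<in>cells m l. real (snd q) * x q) + sum x (cells m l)"
proof -
  have sub: "branch l i \<subseteq> cells m l" by (rule branch_subset_cells[OF i])
  have "L * x (i, 0) = (\<Sum>q\<in>cells m l. real (cell_dist (i, 0) q) * x q)"
    using eigen[of "(i, 0)"] i by (simp add: cells_def)
  also have "\<dots> = (\<Sum>q\<in>cells m l. real (snd q) * x q + x q - (if q \<in> branch l i then x q else 0))"
    by (intro sum.cong refl) (auto simp: cell_dist_def branch_def cells_def algebra_simps)
  also have "\<dots> = (\<Sum>q\<in>cells m l. real (snd q) * x q) + sum x (cells m l) - sum x (cells m l \<inter> branch l i)"
    by (simp add: sum_subtractf sum.distrib sum.inter_restrict)
  also have "cells m l \<inter> branch l i = branch l i" using sub by blast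
  finally show ?thesis by simp
qed

sublocale branch_eigenvector m l "\<lambda>i h. x (i, l i - h)" L
  "(\<Sum>q\<in>cells m l. real (snd q) * x q) + sum x (cells m l)"
  "\<lambda>i h. \<Sum>h'<h. x (i, l i - h')" "\<Sum>i<m. \<Sum>h'<Suc (l i). x (i, l i - h')"
proof -
  have W: "(\<Sum>i<m. \<Sum>h'<Suc (l i). x (i, l i - h')) = sum x (cells m l)"
    by (simp add: sum_cells sum_branch)
  show "branch_eigenvector m l (\<lambda>i h. x (i, l i - h)) L
     ((\<Sum>q\<in>cells m l. real (snd q) * x q) + sum x (cells m l))"
  proof
    show "L > 0" by (rule L_pos)
    fix i h assume i: "i < m" and h: "h \<le> l i"
    then have c: "(i, l i - h) \<in> cells m l" by (simp add: cells_def)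
    show "x (i, l i - h) > 0" by (rule x_pos[OF c])
    show "L * x (i, l i - h) \<ge> (\<Sum>i<m. \<Sum>h'<Suc (l i). x (i, l i - h')) - x (i, l i - h)"
      unfolding W by (rule large_entry[OF c])
  next
    fix i h assume i: "i < m" and h: "h < l i"
    then have "Suc (l i - Suc h) = l i - h" by simp
    then show "L * (x (i, l i - h) - x (i, l i - Suc h)) =
        (\<Sum>i<m. \<Sum>h'<Suc (l i). x (i, l i - h')) - 2 * (\<Sum>h'<Suc h. x (i, l i - h'))"
      unfolding W using eigen_step[OF i, of "l i - Suc h"] sum_tail_of[of "Suc h" l i x] h by simp
  next
    fix i assume i: "i < m"
    show "L * x (i, l i - l i) + (\<Sum>h'<Suc (l i). x (i, l i - h')) =
        (\<Sum>q\<in>cells m l. real (snd q) * x q) + sum x (cells m l)"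
      using eigen_root[OF i] by (simp add: sum_branch)
  qed
qed

lemma branch_heavy:
  assumes "i < m" "j < m" "l j \<le> l i" "l i \<le> Suc (l j)"
  shows "sum x (tail_of l (j, 0)) < sum x (branch l i)"
  using branch_gt_rootless_branch[OF assms] sum_tail_of[of "l j" l j x] by (simp add: sum_branch)

lemma branch_end_heavy:
  assumes "i < m" "j < m" "j' < m" "l i = Suc (l j)" "l i = Suc (l j')"
  shows "sum x (tail_of l (i, 0)) < sum x (branch l j) + x (j', l j')"
  using rootless_long_branch_less[OF assms] sum_tail_of[of "l i" l i x] by (simp add: sum_branch)

end

section \<open>The main comparison\<close>

text \<open>All distances to other vertices are positive, so a zero entry of the nonnegative
  eigenvector would annihilate all the others.\<close>

lemma (in connected_pair_graph) ex_perron_vector: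
  obtains x where "\<And>v. v \<in> V \<Longrightarrow> x v > 0" and "(\<Sum>v\<in>V. (x v)\<^sup>2) = 1"
    and "\<And>u. u \<in> V \<Longrightarrow> (\<Sum>v\<in>V. rdist G u v * x v) = distance_spectral_radius G * x u"
    and "\<And>z. qform V (rdist G) z \<le> distance_spectral_radius G * (\<Sum>v\<in>V. (z v)\<^sup>2)"
proof -
  obtain x where x: "\<And>v. v \<in> V \<Longrightarrow> x v \<ge> 0" "(\<Sum>v\<in>V. (x v)\<^sup>2) = 1"
    "\<And>u. u \<in> V \<Longrightarrow> (\<Sum>v\<in>V. rdist G u v * x v) = distance_spectral_radius G * x u"
    "\<And>z. qform V (rdist G) z \<le> distance_spectral_radius G * (\<Sum>v\<in>V. (z v)\<^sup>2)"
    using distance_spectral_radius_rayleigh[OF pair_finite_verts V_nonempty graph_dist_sym] by blast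
  have "x u \<noteq> 0" if u: "u \<in> V" for u
  proof
    assume "x u = 0"
    then have "(\<Sum>v\<in>V. rdist G u v * x v) = 0" using x(3)[OF u] by simp
    then have zero: "\<forall>v\<in>V. rdist G u v * x v = 0"
      using x(1) pair_finite_verts by (subst (asm) sum_nonneg_eq_0_iff) auto
    have "x v = 0" if v: "v \<in> V" for v
      using zero v \<open>x u = 0\<close> separators_less_dist[OF u v] by (cases "u = v") auto
    then show False using x(2) by simp
  qed
  then show thesis using that[of x] x by (simp add: less_le)
qed

lemma (in connected_pair_graph) distance_spectral_radius_trivial:
  assumes "V = {v}"
  shows "distance_spectral_radius G = 0"
proof -
  obtain x where "(\<Sum>u\<in>V. (x u)\<^sup>2) = (1::real)"
    "\<And>u. u \<in> V \<Longrightarrow> (\<Sum>v\<in>V. rdist G u v * x v) = distance_spectral_radius G * x u"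
    using ex_perron_vector by metis
  then show ?thesis using assms graph_dist_self[of v] by auto
qed

lemma digraph_iso_of_bij:
  assumes G: "pair_wf_digraph G" and \<sigma>: "bij_betw \<sigma> (pverts G) (pverts H)"
    and sub: "parcs H \<subseteq> pverts H \<times> pverts H"
    and arcs: "\<And>u v. u \<in> pverts G \<Longrightarrow> v \<in> pverts G \<Longrightarrow> (u, v) \<in> parcs G \<longleftrightarrow> (\<sigma> u, \<sigma> v) \<in> parcs H"
  shows "digraph_iso (with_proj G) (with_proj H)"
proof -
  interpret pair_wf_digraph G by (rule G)
  define f where "f = \<lparr>iso_verts = \<sigma>, iso_arcs = map_prod \<sigma> \<sigma>, iso_head = snd, iso_tail = fst\<rparr>"
  have inj: "inj_on \<sigma> (pverts G)" using \<sigma> by (simp add: bij_betw_def)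
  have E: "parcs G \<subseteq> pverts G \<times> pverts G" using wellformed' by auto
  have "inj_on (map_prod \<sigma> \<sigma>) (parcs G)"
    using map_prod_inj_on[OF inj inj] E by (rule inj_on_subset)
  then have "digraph_isomorphism f"
    unfolding digraph_isomorphism_def using inj wf_digraph_axioms by (simp add: f_def)
  moreover have "map_prod \<sigma> \<sigma> ` parcs G = parcs H"
  proof
    show "map_prod \<sigma> \<sigma> ` parcs G \<subseteq> parcs H" using E arcs by auto
    show "parcs H \<subseteq> map_prod \<sigma> \<sigma> ` parcs G"
    proof
      fix a assume a: "a \<in> parcs H"
      then obtain p q where pq: "a = (p, q)" "p \<in> \<sigma> ` pverts G" "q \<in> \<sigma> ` pverts G"
        using sub \<sigma> by (auto simp: bij_betw_def)
      then obtain u v where "u \<in> pverts G" "v \<in> pverts G" "p = \<sigma> u" "q = \<sigma> v" by blast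
      then show "a \<in> map_prod \<sigma> \<sigma> ` parcs G" using arcs a pq by force
    qed
  qed
  then have "with_proj H = app_iso f (with_proj G)"
    using \<sigma> by (simp add: app_iso_def f_def with_proj_def bij_betw_def)
  ultimately show ?thesis unfolding digraph_iso_def by blast
qed

lemma (in connected_pair_graph) card_ends_ge_2:
  assumes "card V \<ge> 2"
  shows "card ends \<ge> 2"
proof -
  obtain a b e T where "chain_decomposition V (cut_sep G) a b e T"
    using ex_chain_decomposition[OF assms] by blast
  then interpret C: chain_decomposition V "cut_sep G" a b e T .
  show ?thesis using card_mono[OF finite_ends, of "{a, b}"] C.ab by simp
qed

text \<open>The radius \<open>L\<close> is a constant plus the tail weights. This is at most
  \<open>qform V R y\<close>, then at most \<open>qform V (rdist G) y\<close>, and then at most the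
  radius of \<open>G\<close>, as \<open>y\<close> has norm 1. If the outer values agree, every
  inequality is tight term by term.\<close>

lemma (in connected_pair_graph) compare_with_clique_with_paths:
  assumes n: "card V \<ge> 2" and m: "card ends = m" and k: "(\<Sum>i<m. l i) = card cuts"
    and near: "\<And>i j. i < m \<Longrightarrow> j < m \<Longrightarrow> l i \<le> Suc (l j)"
  shows "distance_spectral_radius (clique_with_paths m l) \<le> distance_spectral_radius G"
    and "distance_spectral_radius G = distance_spectral_radius (clique_with_paths m l) \<Longrightarrow>
      digraph_iso (with_proj G) (with_proj (clique_with_paths m l))"
proof -
  define H where "H = clique_with_paths m l"
  define L where "L = distance_spectral_radius H"
  define D where "D = {p \<in> cells m l. snd p < l (fst p)}"
  have m2: "m \<ge> 2" using card_ends_ge_2[OF n] m by simp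
  then have m0: "m > 0" and m1: "m = 1 \<Longrightarrow> l 0 = 0" by auto
  interpret H: connected_pair_graph H
    unfolding H_def by (rule connected_clique_with_paths[OF m0])
  have VH: "pverts H = cells m l" by (simp add: H_def)
  have distH: "graph_dist H p q = cell_dist p q" if "p \<in> cells m l" "q \<in> cells m l" for p q
    unfolding H_def using graph_dist_clique_with_paths[OF m0 that] .
  obtain x where x_pos: "\<And>p. p \<in> cells m l \<Longrightarrow> x p > 0" and x1: "(\<Sum>p\<in>cells m l. (x p)\<^sup>2) = 1"
    and ev: "\<And>p. p \<in> cells m l \<Longrightarrow> (\<Sum>q\<in>cells m l. rdist H p q * x q) = L * x p"
    and "\<And>z. qform (cells m l) (rdist H) z \<le> L * (\<Sum>p\<in>cells m l. (z p)\<^sup>2)"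
    by (rule H.ex_perron_vector[unfolded VH, folded L_def]) blast
  interpret X: cell_eigenvector m l x L
  proof
    show "m \<ge> 2" by (rule m2)
    fix p assume p: "p \<in> cells m l"
    then show "x p > 0" by (rule x_pos)
    have "(\<Sum>q\<in>cells m l. real (cell_dist p q) * x q) = (\<Sum>q\<in>cells m l. rdist H p q * x q)"
      by (intro sum.cong refl) (simp add: distH p)
    then show "(\<Sum>q\<in>cells m l. real (cell_dist p q) * x q) = L * x p" using ev[OF p] by simp
  qed
  have "\<exists>a b e T \<pi> \<sigma>. weight_assignment V (cut_sep G) a b e T m l x \<pi> \<sigma>"
  proof (rule ex_weight_assignment)
    show "sum x (tail_of l (j, 0)) < sum x (branch l i)" if "i < m" "j < m" "l j \<le> l i" for i j
      using that near[OF that(1,2)] by (rule X.branch_heavy)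
  qed (fact n m k | assumption | rule near x_pos X.branch_end_heavy)+
  then obtain a b e T \<pi> \<sigma> where "weight_assignment V (cut_sep G) a b e T m l x \<pi> \<sigma>" by blast
  then interpret A: weight_assignment V "cut_sep G" a b e T m l x \<pi> \<sigma> .
  define y where "y v = x (\<sigma> v)" for v
  have y_eq: "y = (\<lambda>v. x (\<sigma> v))" by (simp add: fun_eq_iff y_def)
  define R where "R u v = (if u = v then 0 else 1 + real (card (separators u v)))" for u v
  have y_pos: "y v > 0" if "v \<in> V" for v using A.x\<sigma>_pos[OF that] by (simp add: y_def)
  have y_sum: "(\<Sum>v\<in>V. g (y v)) = (\<Sum>p\<in>cells m l. g (x p))" for g :: "real \<Rightarrow> real"
    unfolding y_def by (rule sum.reindex_bij_betw[OF A.\<sigma>, of "\<lambda>p. g (x p)"])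
  have R_le: "R u v \<le> rdist G u v" if "u \<in> V" "v \<in> V" for u v
    using separators_less_dist[OF that] by (auto simp: R_def)
  have term_le: "R u v * y u * y v \<le> rdist G u v * y u * y v" if "u \<in> V" "v \<in> V" for u v
    using R_le[OF that] y_pos that by (intro mult_right_mono) (auto intro: less_imp_le)
  have le1: "qform V R y \<le> qform V (rdist G) y"
    unfolding qform_def by (intro sum_mono term_le)
  have le2: "(\<Sum>c\<in>cuts. tail_weight m l x (\<sigma> c)) \<le> (\<Sum>c\<in>cuts. pair_weight (cut_sep G) y c)"
    unfolding y_def by (intro sum_mono A.sep_weight_bound(1))
  have tw: "(\<Sum>c\<in>cuts. tail_weight m l x (\<sigma> c)) = (\<Sum>p\<in>D. tail_weight m l x p)"
    unfolding D_def by (rule sum.reindex_bij_betw[OF A.\<sigma>_cuts])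
  have QR: "qform V R y = (sum x (cells m l))\<^sup>2 - 1 + (\<Sum>c\<in>cuts. pair_weight (cut_sep G) y c)"
    unfolding R_def qform_separators using y_sum[of "\<lambda>t. t"] y_sum[of "\<lambda>t. t\<^sup>2"] x1 by simp
  have QH: "L = (sum x (cells m l))\<^sup>2 - 1 + (\<Sum>p\<in>D. tail_weight m l x p)"
  proof -
    have "qform (cells m l) (rdist H) x = L * 1"
      unfolding x1[symmetric] by (rule qform_eigenvector) (rule ev)
    then show ?thesis
      using qform_clique_with_paths[OF m0, of l x] m1 x1 by (simp add: H_def D_def)
  qed
  have QG: "qform V (rdist G) y \<le> distance_spectral_radius G"
  proof -
    obtain w where "\<And>z. qform V (rdist G) z \<le> distance_spectral_radius G * (\<Sum>v\<in>V. (z v)\<^sup>2)"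
      using ex_perron_vector by metis
    from this[of y] show ?thesis using y_sum[of "\<lambda>t. t\<^sup>2"] x1 by simp
  qed
  show "distance_spectral_radius (clique_with_paths m l) \<le> distance_spectral_radius G"
    using le1 le2 QG unfolding tw QR H_def[symmetric] L_def[symmetric] QH by linarith
  assume "distance_spectral_radius G = distance_spectral_radius (clique_with_paths m l)"
  then have eq: "distance_spectral_radius G = L" by (simp add: L_def H_def)
  have eq1: "qform V R y = qform V (rdist G) y"
    and eq2: "(\<Sum>c\<in>cuts. tail_weight m l x (\<sigma> c)) = (\<Sum>c\<in>cuts. pair_weight (cut_sep G) y c)"
    using le1 le2 QG QR QH eq tw by linarith+
  \<comment> \<open>All weights are positive, so equality of the sums forces every distance to be
    one more than the number of separators.\<close>
  have dist: "rdist G u v = R u v" if uv: "u \<in> V" "v \<in> V" for u v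
  proof -
    have "(\<Sum>v\<in>V. R u v * y u * y v) = (\<Sum>v\<in>V. rdist G u v * y u * y v)"
      by (rule sum_mono_inv[OF eq1[unfolded qform_def] _ uv(1) fin]) (intro sum_mono term_le)
    then have "R u v * y u * y v = rdist G u v * y u * y v"
      by (rule sum_mono_inv[OF _ term_le[OF uv(1)] uv(2) fin])
    then show ?thesis using y_pos[OF uv(1)] y_pos[OF uv(2)] by simp
  qed
  have tight: "tail_weight m l x (\<sigma> c) = pair_weight (cut_sep G) y c" if "c \<in> cuts" for c
    using A.sep_weight_bound(1) unfolding y_eq[symmetric]
    by (rule sum_mono_inv[OF eq2 _ that finite_cuts])
  have sep: "cut_sep G c u v \<longleftrightarrow> cell_sep l (\<sigma> c) (\<sigma> u) (\<sigma> v)"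
    if "c \<in> V" "u \<in> V" "v \<in> V" for c u v
  proof (cases "c \<in> cuts")
    case True
    then show ?thesis
      using A.sep_weight_bound(2)[OF True _ that(2,3)] tight[OF True]
      by (simp add: cell_sep_def y_eq)
  next
    case False
    \<comment> \<open>A vertex that is not a cut vertex goes to a free end, beyond which there is
      nothing to separate.\<close>
    then have "c \<in> ends" using that by (simp add: ends_def)
    then have "tail_of l (\<sigma> c) = {}" using A.\<sigma>_end by (simp add: tail_of_def)
    then show ?thesis using False by (auto simp: cell_sep_def cuts_def)
  qed
  have dist_eq: "graph_dist G u v = graph_dist H (\<sigma> u) (\<sigma> v)" if uv: "u \<in> V" "v \<in> V" for u v
  proof (cases "u = v")
    case True
    then show ?thesis
      using uv graph_dist_self H.graph_dist_self A.\<sigma>_cells VH by simp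
  next
    case False
    have neq: "\<sigma> u \<noteq> \<sigma> v" using False uv A.inj_\<sigma> by (auto dest: inj_onD)
    have "\<sigma> ` separators u v = {p \<in> cells m l. cell_sep l p (\<sigma> u) (\<sigma> v)}"
    proof
      show "\<sigma> ` separators u v \<subseteq> {p \<in> cells m l. cell_sep l p (\<sigma> u) (\<sigma> v)}"
      proof
        fix p assume "p \<in> \<sigma> ` separators u v"
        then obtain c where c: "cut_sep G c u v" "p = \<sigma> c" by (auto simp: separators_def)
        then have "c \<in> V" using sep_in by blast
        then show "p \<in> {p \<in> cells m l. cell_sep l p (\<sigma> u) (\<sigma> v)}"
          using c sep uv A.\<sigma>_cells by simp
      qed
      show "{p \<in> cells m l. cell_sep l p (\<sigma> u) (\<sigma> v)} \<subseteq> \<sigma> ` separators u v"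
      proof
        fix p assume p: "p \<in> {p \<in> cells m l. cell_sep l p (\<sigma> u) (\<sigma> v)}"
        then obtain c where "c \<in> V" "p = \<sigma> c" using A.\<sigma> by (auto simp: bij_betw_def)
        then show "p \<in> \<sigma> ` separators u v" using p sep uv by (auto simp: separators_def)
      qed
    qed
    moreover have "card (\<sigma> ` separators u v) = card (separators u v)"
      using separators_subset cuts_subset
      by (intro card_image inj_on_subset[OF A.inj_\<sigma>]) blast
    ultimately have "card (separators u v) = card {p \<in> cells m l. cell_sep l p (\<sigma> u) (\<sigma> v)}"
      by simp
    moreover have "real (graph_dist G u v) = real (Suc (card (separators u v)))"
      using dist[OF uv] False by (simp add: R_def)
    ultimately show ?thesis
      using card_cell_sep[OF A.\<sigma>_cells A.\<sigma>_cells neq] uv distH A.\<sigma>_cells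
      by (metis of_nat_eq_iff)
  qed
  have "digraph_iso (with_proj G) (with_proj H)"
  proof (rule digraph_iso_of_bij)
    show "pair_wf_digraph G" ..
    show "bij_betw \<sigma> V (pverts H)" unfolding VH by (rule A.\<sigma>)
    show "parcs H \<subseteq> pverts H \<times> pverts H" by (rule H.E_sub)
    show "(u, v) \<in> E \<longleftrightarrow> (\<sigma> u, \<sigma> v) \<in> parcs H" if uv: "u \<in> V" "v \<in> V" for u v
      using graph_dist_eq_1_iff[OF uv] H.graph_dist_eq_1_iff[of "\<sigma> u" "\<sigma> v"] dist_eq[OF uv]
        A.\<sigma>_cells uv VH by simp
  qed
  then show "digraph_iso (with_proj G) (with_proj (clique_with_paths m l))" by (simp add: H_def)
qed

lemma (in connected_pair_graph) trivial_graph: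
  assumes "card V < 2"
  obtains v where "V = {v}" "E = {}" "cuts = {}"
proof -
  have "card V \<noteq> 0" using V_nonempty pair_finite_verts by simp
  then have "card V = 1" using assms by linarith
  then obtain v where v: "V = {v}" by (auto simp: card_1_singleton_iff)
  then have "E = {}" using E_sub E_irrefl by auto
  moreover have "cuts = {}" using v sep_in by (auto simp: cuts_def)
  ultimately show thesis using that v by blast
qed

theorem theorem2p1:
  fixes n k :: nat and l :: "nat \<Rightarrow> nat"
  assumes "\<exists>H :: nat pair_pre_digraph. connected_graph_with_cut_vertices n k H"
    and "almost_equal_lengths (n - k) k l"
  shows "connected_graph_with_cut_vertices n k (clique_with_paths (n - k) l) \<and>
    (\<forall>G :: 'a pair_pre_digraph. connected_graph_with_cut_vertices n k G \<longrightarrow>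
       distance_spectral_radius G \<ge> distance_spectral_radius (clique_with_paths (n - k) l) \<and>
       (distance_spectral_radius G = distance_spectral_radius (clique_with_paths (n - k) l) \<longrightarrow>
          digraph_iso (with_proj G) (with_proj (clique_with_paths (n - k) l))))"
proof -
  define m where "m = n - k"
  have k: "(\<Sum>i<m. l i) = k" and near: "\<And>i j. i < m \<Longrightarrow> j < m \<Longrightarrow> l i \<le> Suc (l j)"
    using assms(2) by (force simp: almost_equal_lengths_def m_def)+
  obtain H0 :: "nat pair_pre_digraph" where "connected_graph_with_cut_vertices n k H0"
    using assms(1) by blast
  then have H0: "connected_pair_graph H0" "card (pverts H0) = n" "card {v. cut_vertex H0 v} = k"
    by (auto simp: connected_graph_with_cut_vertices_iff)
  interpret H0: connected_pair_graph H0 by (rule H0)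
  \<comment> \<open>\<open>n - k\<close> is truncated subtraction. The graph \<open>H0\<close>
    guarantees \<open>k \<le> n\<close> and \<open>m > 0\<close>, and for \<open>m = 1\<close> it is
    a single vertex.\<close>
  have nk: "m + k = n" "m > 0" "m = 1 \<Longrightarrow> l 0 = 0"
  proof -
    have ec: "card H0.ends + k = n" using H0.card_ends_cuts H0 H0.cuts_eq by simp
    then show "m + k = n" by (simp add: m_def)
    have "m = card H0.ends" using ec by (simp add: m_def)
    moreover have "n = 1 \<and> k = 0" if "\<not> n \<ge> 2"
      using that H0.trivial_graph H0 H0.cuts_eq by (metis card.empty card_1_singleton_iff not_le One_nat_def)
    ultimately show "m > 0" "m = 1 \<Longrightarrow> l 0 = 0"
      using H0.card_ends_ge_2 H0 k m_def by fastforce+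
  qed
  have G: "distance_spectral_radius G \<ge> distance_spectral_radius (clique_with_paths m l) \<and>
       (distance_spectral_radius G = distance_spectral_radius (clique_with_paths m l) \<longrightarrow>
          digraph_iso (with_proj G) (with_proj (clique_with_paths m l)))"
    if g: "connected_graph_with_cut_vertices n k G" for G :: "'a pair_pre_digraph"
  proof -
    have G: "connected_pair_graph G" "card (pverts G) = n" "card {v. cut_vertex G v} = k"
      using g by (auto simp: connected_graph_with_cut_vertices_iff)
    interpret G: connected_pair_graph G by (rule G)
    show ?thesis
    proof (cases "n \<ge> 2")
      case True
      have "card G.ends = m" using G.card_ends_cuts G G.cuts_eq by (simp add: m_def)
      then show ?thesis
        using G.compare_with_clique_with_paths[of m l] True G k near G.cuts_eq by simp
    next
      \<comment> \<open>A single vertex admits no pair \<open>a\<close>, \<open>b\<close>; both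
        graphs then have one vertex and radius 0.\<close>
      case False
      then obtain v where v: "pverts G = {v}" "parcs G = {}" "G.cuts = {}"
        using G.trivial_graph G by (metis not_le)
      have "k = 0" "n = 1" using v G G.cuts_eq by auto
      then have m1: "m = 1" "l 0 = 0" using nk by auto
      interpret H: connected_pair_graph "clique_with_paths m l"
        by (rule connected_clique_with_paths[OF nk(2)])
      have VH: "pverts (clique_with_paths m l) = {(0, 0)}" using m1 by (auto simp: cells_def)
      have "digraph_iso (with_proj G) (with_proj (clique_with_paths m l))"
      proof (rule digraph_iso_of_bij)
        show "pair_wf_digraph G" ..
        show "bij_betw (\<lambda>_. (0, 0)) (pverts G) (pverts (clique_with_paths m l))"
          unfolding VH v(1) by (simp add: bij_betw_def)
      qed (use H.E_sub H.E_irrefl v in auto)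
      then show ?thesis
        using G.distance_spectral_radius_trivial[OF v(1)] H.distance_spectral_radius_trivial[OF VH]
        by simp
    qed
  qed
  have "connected_graph_with_cut_vertices (m + (\<Sum>i<m. l i)) (\<Sum>i<m. l i) (clique_with_paths m l)"
    using nk(2,3) by (rule connected_graph_clique_with_paths)
  then show ?thesis using G nk(1) unfolding k m_def[symmetric] by blast
qed

end
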